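(* Consider the randomized Gram-Schmidt (RGS) algorithm described in the context, applied to $\widehat{\mathbf{W}}\in\mathbb{R}^{n\times m}$ and $\mathbf{\Theta}\in\mathbb{R}^{k\times n}$, using the Givens or Householder least-squares solver (QR factorization based on Givens rotations or Householder transformation) in Step (2), and computed with unit roundoffs $$u_{crs}\leq 10^{-3}\,\mathrm{cond}(\widehat{\mathbf{W}})^{-1}m^{-2},\qquad u_{fine}\leq (100\,m^{1/2}n^{3/2}+10^4\,m^{3/2}k)^{-1}u_{crs}.$$ Suppose Assumptions (A) stated in the context hold. If $\mathbf{\Theta}$ is an $\varepsilon$-embedding for $\widehat{\mathbf{W}}$, with $\varepsilon\leq 1/4$, then $\mathbf{\Theta}$ is an $\varepsilon'$-embedding for the computed factor $\widehat{\mathbf{Q}}$, with $$\varepsilon' = 2\varepsilon + 180\,u_{crs}\,m^2\,\mathrm{cond}(\widehat{\mathbf{W}}).$$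
   Context: Notation. $\|\cdot\|$ is the $\ell_2$-norm of a vector or the spectral norm of a matrix, $\|\cdot\|_{\mathrm F}$ the Frobenius norm, $\mathrm{cond}(\mathbf{X})=\sigma_{max}(\mathbf{X})/\sigma_{min}(\mathbf{X})$. For a matrix $\mathbf{X}$, $|\mathbf{X}|$ is the matrix of entrywise absolute values, and $\mathbf{X}\le\mathbf{Y}$ is meant entrywise. $[\mathbf{R}]_{(a:b,c)}$ denotes the vector of entries in rows $a,\dots,b$ of column $c$. $\mathbf{X}_j$ denotes the matrix made of the first $j$ columns $\mathbf{x}_1,\dots,\mathbf{x}_j$. A hat, or $\mathrm{fl}(\cdot)$, denotes the quantity actually computed in finite precision arithmetic. $\varepsilon$-embedding. For $\varepsilon<1$, $\mathbf{\Theta}\in\mathbb{R}^{k\times n}$ is an $\varepsilon$-embedding for a subspace $V\subset\mathbb{R}^n$ if $|\langle \mathbf{x},\mathbf{y}\rangle-\langle\mathbf{\Theta}\mathbf{x},\mathbf{\Theta}\mathbf{y}\rangle|\le\varepsilon\|\mathbf{x}\|\|\mathbf{y}\|$ for all $\mathbf{x},\mathbf{y}\in V$. It is an $\varepsilon$-embedding for a matrix if it is one for the column space of that matrix. RGS algorithm. Input: $\mathbf{W}=[\mathbf{w}_1,\dots,\mathbf{w}_m]\in\mathbb{R}^{n\times m}$ and $\mathbf{\Theta}\in\mathbb{R}^{k\times n}$, $m\le k\ll n$ (the actually stored input columns are denoted $\widehat{\mathbf{w}}_i$, and $\widehat{\mathbf{W}}=[\widehat{\mathbf{w}}_1,\dots,\widehat{\mathbf{w}}_m]$).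 Output: $\mathbf{Q}=[\mathbf{q}_1,\dots,\mathbf{q}_m]\in\mathbb{R}^{n\times m}$ and upper triangular $\mathbf{R}\in\mathbb{R}^{m\times m}$ with entries $r_{i,j}$. For $i=1,\dots,m$: (1) $\mathbf{p}_i=\mathbf{\Theta}\mathbf{w}_i$; (2) solve the $k\times(i-1)$ least-squares problem $[\mathbf{R}]_{(1:i-1,i)}=\arg\min_{\mathbf{y}}\|\mathbf{S}_{i-1}\mathbf{y}-\mathbf{p}_i\|$; (3) $\mathbf{q}'_i=\mathbf{w}_i-\mathbf{Q}_{i-1}[\mathbf{R}]_{(1:i-1,i)}$; (4) $\mathbf{s}'_i=\mathbf{\Theta}\mathbf{q}'_i$; (5) $r_{i,i}=\|\mathbf{s}'_i\|$; (6) $\mathbf{s}_i=\mathbf{s}'_i/r_{i,i}$; (7) $\mathbf{q}_i=\mathbf{q}'_i/r_{i,i}$. Here $\mathbf{S}_j=[\mathbf{s}_1,\dots,\mathbf{s}_j]$; for $i=1$, $\mathbf{q}'_1=\mathbf{w}_1$ and $\mathbf{s}'_1=\mathbf{p}_1$. Arithmetic. The algorithm is executed in floating point arithmetic (each elementary operation satisfies $\mathrm{fl}(x\,\mathrm{op}\,y)=(x\,\mathrm{op}\,y)(1+\xi)$ with $|\xi|$ at most the unit roundoff): Step (3) with coarse unit roundoff $u_{crs}$, all other steps with fine unit roundoff $u_{fine}$, where $u_{fine}\le u_{crs}\le 0.01/m$. Matrix-vector products are computed in the standard way. Assumptions (A). For some constant $\varepsilon_0\le 1/2$, with $D=\sqrt{1+\varepsilon_0}$: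 $\|\mathbf{\Theta}\|_{\mathrm F}\le\sqrt{1+\varepsilon_0}\,\sqrt{n}$; and, with $\mathbf{\Delta q}'_i:=\widehat{\mathbf{q}}'_i-(\widehat{\mathbf{w}}_i-\widehat{\mathbf{Q}}_{i-1}[\widehat{\mathbf{R}}]_{(1:i-1,i)})$ and $\mathbf{\Delta q}_i:=\widehat{\mathbf{q}}_i-\widehat{\mathbf{q}}'_i/\widehat{r}_{i,i}$, for all $1\le i\le m$: $|\mathbf{\Delta q}'_i|\le 1.02u_{crs}(|\widehat{\mathbf{w}}_i|+i|\widehat{\mathbf{Q}}_{i-1}||[\widehat{\mathbf{R}}]_{(1:i-1,i)}|)$, $\;|\mathbf{\Delta q}_i|\le u_{fine}|\widehat{\mathbf{q}}'_i/\widehat{r}_{i,i}|$, $\|\mathbf{\Theta}\mathbf{\Delta q}'_i\|\le 1.02u_{crs}D\,\big\||\widehat{\mathbf{w}}_i|+i|\widehat{\mathbf{Q}}_{i-1}||[\widehat{\mathbf{R}}]_{(1:i-1,i)}|\big\|$, $\;\|\mathbf{\Theta}\mathbf{\Delta q}_i\|\le u_{fine}D\|\widehat{\mathbf{q}}'_i/\widehat{r}_{i,i}\|$. *)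

theory Defs
  imports Complex_Main "Jordan_Normal_Form.Char_Poly" "Jordan_Normal_Form.VS_Connect"
begin

text \<open>All indices are 0-based: column \<open>i\<close> below is column \<open>i + 1\<close> of the usual
  presentation of the randomized Gram-Schmidt (RGS) process.\<close>

section \<open>Norms, condition number, embeddings\<close>

definition l2_norm :: "real vec \<Rightarrow> real" where
  "l2_norm v = sqrt (v \<bullet> v)"

definition frobenius_norm :: "real mat \<Rightarrow> real" where
  "frobenius_norm A = sqrt (\<Sum>i<dim_row A. \<Sum>j<dim_col A. (A $$ (i,j))\<^sup>2)"

text \<open>Meant for matrices with at least as many rows as columns; for a wide matrix the set
  contains a spurious 0.\<close>

definition singular_values :: "real mat \<Rightarrow> real set" where
  "singular_values A = {s. 0 \<le> s \<and> eigenvalue (A\<^sup>T * A) (s\<^sup>2)}"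

text \<open>If the smallest singular value is 0, then \<open>cond A = 0\<close> and \<open>inverse (cond A) = 0\<close>, so a
  requirement \<open>0 < u \<le> c * inverse (cond A)\<close> is unsatisfiable, as it is with the convention
  \<open>cond A = \<infinity>\<close>.\<close>

definition cond :: "real mat \<Rightarrow> real" where
  "cond A = Max (singular_values A) / Min (singular_values A)"

definition eps_embedding :: "real \<Rightarrow> real mat \<Rightarrow> real vec set \<Rightarrow> bool" where
  "eps_embedding \<epsilon> \<Theta> V \<longleftrightarrow> \<epsilon> < 1 \<and>
     (\<forall>x\<in>V. \<forall>y\<in>V. \<bar>x \<bullet> y - (\<Theta> *\<^sub>v x) \<bullet> (\<Theta> *\<^sub>v y)\<bar> \<le> \<epsilon> * l2_norm x * l2_norm y)"

definition eps_embedding_mat :: "real \<Rightarrow> real mat \<Rightarrow> real mat \<Rightarrow> bool" where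
  "eps_embedding_mat \<epsilon> \<Theta> A \<longleftrightarrow> eps_embedding \<epsilon> \<Theta> (vec_space.col_space (dim_row A) A)"

definition first_cols :: "real mat \<Rightarrow> nat \<Rightarrow> real mat" where
  "first_cols A j = mat_of_cols (dim_row A) (take j (cols A))"

section \<open>Floating point arithmetic\<close>

text \<open>The standard model, without overflow and underflow. Operations are total on the reals;
  nothing is assumed about division by 0 and square roots of negative numbers.\<close>

record fl_ops =
  fl_add :: "real \<Rightarrow> real \<Rightarrow> real"
  fl_sub :: "real \<Rightarrow> real \<Rightarrow> real"
  fl_mul :: "real \<Rightarrow> real \<Rightarrow> real"
  fl_div :: "real \<Rightarrow> real \<Rightarrow> real"
  fl_sqrt :: "real \<Rightarrow> real"

definition rounded :: "real \<Rightarrow> real \<Rightarrow> real \<Rightarrow> bool" where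
  "rounded u x x_hat \<longleftrightarrow> (\<exists>\<xi>. \<bar>\<xi>\<bar> \<le> u \<and> x_hat = x * (1 + \<xi>))"

definition fl_arithmetic :: "real \<Rightarrow> fl_ops \<Rightarrow> bool" where
  "fl_arithmetic u F \<longleftrightarrow>
     (\<forall>x y. rounded u (x + y) (fl_add F x y)) \<and>
     (\<forall>x y. rounded u (x - y) (fl_sub F x y)) \<and>
     (\<forall>x y. rounded u (x * y) (fl_mul F x y)) \<and>
     (\<forall>x y. y \<noteq> 0 \<longrightarrow> rounded u (x / y) (fl_div F x y)) \<and>
     (\<forall>x. 0 \<le> x \<longrightarrow> rounded u (sqrt x) (fl_sqrt F x))"

text \<open>Sums are accumulated from left to right, without an addition to an initial 0.\<close>

fun fl_sum :: "fl_ops \<Rightarrow> real list \<Rightarrow> real" where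
  "fl_sum F [] = 0"
| "fl_sum F (x # xs) = foldl (fl_add F) x xs"

definition fl_inner :: "fl_ops \<Rightarrow> real vec \<Rightarrow> real vec \<Rightarrow> real" where
  "fl_inner F x y = fl_sum F (map (\<lambda>i. fl_mul F (x $ i) (y $ i)) [0..<dim_vec y])"

definition fl_norm :: "fl_ops \<Rightarrow> real vec \<Rightarrow> real" where
  "fl_norm F x = fl_sqrt F (fl_inner F x x)"

definition fl_mat_vec :: "fl_ops \<Rightarrow> real mat \<Rightarrow> real vec \<Rightarrow> real vec" where
  "fl_mat_vec F A x = vec (dim_row A) (\<lambda>i. fl_inner F (row A i) x)"

definition fl_vec_sub :: "fl_ops \<Rightarrow> real vec \<Rightarrow> real vec \<Rightarrow> real vec" where
  "fl_vec_sub F x y = vec (dim_vec x) (\<lambda>i. fl_sub F (x $ i) (y $ i))"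

definition fl_vec_div :: "fl_ops \<Rightarrow> real vec \<Rightarrow> real \<Rightarrow> real vec" where
  "fl_vec_div F x c = vec (dim_vec x) (\<lambda>i. fl_div F (x $ i) c)"

section \<open>Least-squares solvers\<close>

text \<open>Both solvers reduce the first \<open>dim_col A\<close> columns of the augmented matrix \<open>[A | b]\<close> to
  upper triangular form, so that the last column becomes the transformed right-hand side, and
  then solve the leading triangular system by back substitution. Eliminated entries are set
  to 0 rather than computed.\<close>

text \<open>Householder step for column \<open>t\<close>: with \<open>x\<close> the part of that column in rows \<open>t, t+1, \<dots>\<close>,
  \<open>s = sign(x\<^sub>0) \<parallel>x\<parallel>\<close>, \<open>v = x + s e\<^sub>0\<close> and \<open>\<beta> = 1 / (s v\<^sub>0) = 2 / (v\<^sup>T v)\<close>, the reflector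
  \<open>I - \<beta> v v\<^sup>T\<close> maps \<open>x\<close> to \<open>-s e\<^sub>0\<close>. A vanishing \<open>x\<close> is skipped.\<close>

definition householder_step :: "fl_ops \<Rightarrow> nat \<Rightarrow> real mat \<Rightarrow> real mat" where
  "householder_step F t B =
     (let x = (\<lambda>c. vec (dim_row B - t) (\<lambda>a. B $$ (t + a, c)));
          nrm = fl_norm F (x t);
          s = (if x t $ 0 \<ge> 0 then nrm else - nrm);
          v = vec (dim_row B - t) (\<lambda>a. if a = 0 then fl_add F (x t $ 0) s else x t $ a);
          \<beta> = fl_div F 1 (fl_mul F s (v $ 0));
          w = (\<lambda>c. fl_mul F \<beta> (fl_inner F v (x c)))
      in if nrm = 0 then B
         else mat (dim_row B) (dim_col B) (\<lambda>(a,c).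
           if a < t \<or> c < t then B $$ (a,c)
           else if c = t then (if a = t then - s else 0)
           else fl_sub F (B $$ (a,c)) (fl_mul F (w c) (v $ (a - t)))))"

text \<open>Rotation of rows \<open>i - 1\<close> and \<open>i\<close> that annihilates the entry in row \<open>i\<close>, column \<open>t\<close>.\<close>

definition givens_rotation :: "fl_ops \<Rightarrow> nat \<Rightarrow> nat \<Rightarrow> real mat \<Rightarrow> real mat" where
  "givens_rotation F t i B =
     (let x = B $$ (i - 1, t); y = B $$ (i, t);
          \<rho> = fl_sqrt F (fl_add F (fl_mul F x x) (fl_mul F y y));
          c = fl_div F x \<rho>;
          s = fl_div F y \<rho>
      in if y = 0 then B
         else mat (dim_row B) (dim_col B) (\<lambda>(a,l).
           if l < t \<or> a \<notin> {i - 1, i} then B $$ (a,l)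
           else if a = i - 1 then fl_add F (fl_mul F c (B $$ (i - 1, l))) (fl_mul F s (B $$ (i, l)))
           else if l = t then 0
           else fl_sub F (fl_mul F c (B $$ (i, l))) (fl_mul F s (B $$ (i - 1, l)))))"

definition givens_step :: "fl_ops \<Rightarrow> nat \<Rightarrow> real mat \<Rightarrow> real mat" where
  "givens_step F t B = fold (givens_rotation F t) (rev [t + 1..<dim_row B]) B"

datatype ls_solver = Givens | Householder

fun qr_step :: "ls_solver \<Rightarrow> fl_ops \<Rightarrow> nat \<Rightarrow> real mat \<Rightarrow> real mat" where
  "qr_step Givens F = givens_step F"
| "qr_step Householder F = householder_step F"

text \<open>\<open>back_subst_last F U c n d\<close> lists the last \<open>d\<close> of the \<open>n\<close> unknowns.\<close>

fun back_subst_last :: "fl_ops \<Rightarrow> real mat \<Rightarrow> real vec \<Rightarrow> nat \<Rightarrow> nat \<Rightarrow> real list" where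
  "back_subst_last F U c n 0 = []"
| "back_subst_last F U c n (Suc d) =
     (let j = n - Suc d;
          ys = back_subst_last F U c n d;
          r = foldl (\<lambda>r l. fl_sub F r (fl_mul F (U $$ (j,l)) (ys ! (l - Suc j)))) (c $ j) [Suc j..<n]
      in fl_div F r (U $$ (j,j)) # ys)"

definition fl_least_squares :: "ls_solver \<Rightarrow> fl_ops \<Rightarrow> real mat \<Rightarrow> real vec \<Rightarrow> real vec" where
  "fl_least_squares solver F A b =
     (let n = dim_col A;
          B = fold (qr_step solver F) [0..<n] (mat_of_cols (dim_row A) (cols A @ [b]))
      in vec_of_list (back_subst_last F B (col B n) n n))"

section \<open>The RGS algorithm in finite precision\<close>

text \<open>All matrices are the computed ones. \<open>P\<close>, \<open>Q'\<close> and \<open>S'\<close> collect as columns the sketches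
  \<open>p\<^sub>i\<close> and the unnormalized vectors \<open>q'\<^sub>i\<close> and \<open>s'\<^sub>i\<close>.\<close>

definition rgs_run ::
  "ls_solver \<Rightarrow> fl_ops \<Rightarrow> fl_ops \<Rightarrow> real mat \<Rightarrow> real mat \<Rightarrow>
   real mat \<Rightarrow> real mat \<Rightarrow> real mat \<Rightarrow> real mat \<Rightarrow> real mat \<Rightarrow> real mat \<Rightarrow> bool" where
  "rgs_run solver crs fine \<Theta> W P Q' S' S Q R \<longleftrightarrow>
     (let k = dim_row \<Theta>; n = dim_row W; m = dim_col W in
      P \<in> carrier_mat k m \<and> Q' \<in> carrier_mat n m \<and> S' \<in> carrier_mat k m \<and>
      S \<in> carrier_mat k m \<and> Q \<in> carrier_mat n m \<and>
      R \<in> carrier_mat m m \<and> upper_triangular R \<and>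
      (\<forall>i<m.
         col P i = fl_mat_vec fine \<Theta> (col W i) \<and>
         (i > 0 \<longrightarrow> vec_first (col R i) i =
            fl_least_squares solver fine (first_cols S i) (col P i)) \<and>
         col Q' i = (if i = 0 then col W i
            else fl_vec_sub crs (col W i) (fl_mat_vec crs (first_cols Q i) (vec_first (col R i) i))) \<and>
         col S' i = (if i = 0 then col P i else fl_mat_vec fine \<Theta> (col Q' i)) \<and>
         R $$ (i,i) = fl_norm fine (col S' i) \<and>
         col S i = fl_vec_div fine (col S' i) (R $$ (i,i)) \<and>
         col Q i = fl_vec_div fine (col Q' i) (R $$ (i,i))))"

text \<open>\<open>\<Delta>q'\<close> and \<open>\<Delta>q\<close> are the local errors of the projection and of the normalization step;
  \<open>\<le>\<close> between vectors is entrywise. The factor \<open>i + 1\<close> is the 1-based column number.\<close>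

definition rgs_assumptions ::
  "real \<Rightarrow> real \<Rightarrow> real \<Rightarrow> real mat \<Rightarrow> real mat \<Rightarrow> real mat \<Rightarrow> real mat \<Rightarrow> real mat \<Rightarrow> bool" where
  "rgs_assumptions \<epsilon>\<^sub>0 u_crs u_fine \<Theta> W Q' Q R \<longleftrightarrow>
     (let D = sqrt (1 + \<epsilon>\<^sub>0) in
      \<epsilon>\<^sub>0 \<le> 1/2 \<and>
      frobenius_norm \<Theta> \<le> sqrt (1 + \<epsilon>\<^sub>0) * sqrt (real (dim_row W)) \<and>
      (\<forall>i<dim_col W.
         let r = vec_first (col R i) i;
             \<Delta>q' = col Q' i - (col W i - first_cols Q i *\<^sub>v r);
             q_exact = (1 / R $$ (i,i)) \<cdot>\<^sub>v col Q' i;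
             \<Delta>q = col Q i - q_exact;
             bound = map_vec abs (col W i)
               + real (i + 1) \<cdot>\<^sub>v (map_mat abs (first_cols Q i) *\<^sub>v map_vec abs r)
         in map_vec abs \<Delta>q' \<le> (1.02 * u_crs) \<cdot>\<^sub>v bound \<and>
            map_vec abs \<Delta>q \<le> u_fine \<cdot>\<^sub>v map_vec abs q_exact \<and>
            l2_norm (\<Theta> *\<^sub>v \<Delta>q') \<le> 1.02 * u_crs * D * l2_norm bound \<and>
            l2_norm (\<Theta> *\<^sub>v \<Delta>q) \<le> u_fine * D * l2_norm q_exact))"

end

theory Submission
  imports Defs "HOL-Analysis.L2_Norm"
begin

text \<open>
  The computed factors satisfy \<open>Q R = W + F\<close>, where by Assumptions (A) the columns of \<open>F\<close> and
  \<open>\<Theta> F\<close> are \<open>O(u m\<^sup>3\<^sup>/\<^sup>2 \<sigma>\<^sub>m\<^sub>a\<^sub>x)\<close> as long as the previous columns of \<open>Q\<close> and the coefficients of the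
  current least-squares problem are bounded. A vector of the column space of \<open>Q\<close> is \<open>(W + F) a\<close>, and
  \<open>\<parallel>F a\<parallel> \<le> \<tau> \<parallel>W a\<parallel>\<close> with \<open>\<tau> = 6 u m\<^sup>2 cond W\<close>, so the \<open>\<epsilon>\<close>-embedding of \<open>W\<close> transfers to
  \<open>W + F\<close> with constant \<open>\<epsilon> + 6 \<tau>\<close>.
  The bounds needed for \<open>F\<close> are an induction over the columns: the new column before normalization is
  \<open>(W + F) a\<close> with last coefficient 1, hence at least about \<open>\<sigma>\<^sub>m\<^sub>i\<^sub>n\<close> in norm, and the transferred
  embedding bounds its norm by that of its sketch. The sketches \<open>S\<close> stay nearly orthonormal,
  which controls the least-squares solution.

  For the solver it suffices that each Givens or Householder step preserves all inner products of
  columns up to a small relative error. The normal equations only involve these inner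
  products, so no orthogonal factor has to be accumulated.
\<close>

section \<open>Vectors as functions and Gram perturbation\<close>

text \<open>The obstacle is a circularity. Only sketches are normalized, so bounding the columns of
  \<open>Q\<close> needs an embedding, while proving an embedding needs bounds on these columns. It
  is broken because the error made in one column involves only earlier columns of \<open>Q\<close>.
  cond W enters through \<sigma>: combinations F a are measured against \<parallel>W a\<parallel>
  \<ge> \<sigma> \<parallel>a\<parallel>, and the factor sqrt m lost to Cauchy-Schwarz turns m^(3/2)
  into m^2. The two terms in the bound on \<open>u_fine\<close> have different origins. A sketch has
  an error of order n times the Frobenius norm of \<Theta>, hence n^(3/2). The term with k pays for
  the least-squares solver, which perturbs inner products by order k m and sums them over up to m
  columns. Once both are absorbed, every error is a multiple of the coarse roundoff. The argument
  yields the constant \<epsilon> + 36 u m^2 cond W. Constants such as 21/20 or 6/5 are rational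
  over-estimates with some slack. Vectors are functions with an explicit length, so that prefixes
  and zero-padded tails need no conversion.\<close>

definition nrm :: "nat \<Rightarrow> (nat \<Rightarrow> real) \<Rightarrow> real" where
  "nrm k f = L2_set f {..<k}"

lemma nrm_nonneg [simp]: "0 \<le> nrm k f"
  by (simp add: nrm_def)

definition ip :: "nat \<Rightarrow> (nat \<Rightarrow> real) \<Rightarrow> (nat \<Rightarrow> real) \<Rightarrow> real" where
  "ip k f g = (\<Sum>a<k. f a * g a)"

lemma ip_commute: "ip k f g = ip k g f"
  by (simp add: ip_def mult.commute)

lemma ip_add_left: "ip k (\<lambda>a. f a + g a) h = ip k f h + ip k g h"
  by (simp add: ip_def distrib_right sum.distrib)

lemma ip_add_right: "ip k h (\<lambda>a. f a + g a) = ip k h f + ip k h g"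
  by (simp add: ip_def distrib_left sum.distrib)

lemma ip_diff_left: "ip k (\<lambda>a. f a - g a) h = ip k f h - ip k g h"
  by (simp add: ip_def left_diff_distrib sum_subtractf)

lemma ip_diff_right: "ip k h (\<lambda>a. f a - g a) = ip k h f - ip k h g"
  by (simp add: ip_def right_diff_distrib sum_subtractf)

lemma ip_scale_left: "ip k (\<lambda>a. c * f a) g = c * ip k f g"
  by (simp add: ip_def sum_distrib_left mult.assoc)

lemma ip_scale_right: "ip k f (\<lambda>a. c * g a) = c * ip k f g"
  by (simp add: ip_def sum_distrib_left mult.left_commute)

lemma ip_sum_left: "ip k (\<lambda>a. \<Sum>c\<in>C. f c a) g = (\<Sum>c\<in>C. ip k (f c) g)"
  unfolding ip_def by (simp add: sum_distrib_right sum.swap[of _ _ C])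

lemma ip_sum_right: "ip k g (\<lambda>a. \<Sum>c\<in>C. f c a) = (\<Sum>c\<in>C. ip k g (f c))"
  unfolding ip_def by (simp add: sum_distrib_left sum.swap[of _ _ C])

lemma ip_cong: "(\<And>a. a < k \<Longrightarrow> f a = f' a) \<Longrightarrow> (\<And>a. a < k \<Longrightarrow> g a = g' a) \<Longrightarrow> ip k f g = ip k f' g'"
  by (simp add: ip_def)

lemma nrm_cong: "(\<And>a. a < k \<Longrightarrow> f a = f' a) \<Longrightarrow> nrm k f = nrm k f'"
  unfolding nrm_def by (rule L2_set_cong) auto

lemma ip_self: "ip k f f = (nrm k f)\<^sup>2"
  by (simp add: ip_def nrm_def L2_set_def sum_nonneg power2_eq_square)

lemma nrm_eq_sqrt_ip: "nrm k f = sqrt (ip k f f)"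
  by (simp add: ip_self)

lemma ip_abs_le: "\<bar>ip k f g\<bar> \<le> nrm k f * nrm k g"
proof -
  have "\<bar>ip k f g\<bar> \<le> (\<Sum>a<k. \<bar>f a\<bar> * \<bar>g a\<bar>)"
    unfolding ip_def by (rule order.trans[OF sum_abs]) (simp add: abs_mult)
  also have "\<dots> \<le> nrm k f * nrm k g" unfolding nrm_def by (rule L2_set_mult_ineq)
  finally show ?thesis .
qed

lemma ip_abs_le_mult: "nrm k f \<le> A \<Longrightarrow> nrm k g \<le> B \<Longrightarrow> \<bar>ip k f g\<bar> \<le> A * B"
  by (rule order.trans[OF ip_abs_le mult_mono']) simp_all

lemma nrm_add_le: "nrm k (\<lambda>a. f a + g a) \<le> nrm k f + nrm k g"
  unfolding nrm_def by (rule L2_set_triangle_ineq)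

lemma nrm_scale: "nrm k (\<lambda>a. c * f a) = \<bar>c\<bar> * nrm k f"
  by (simp add: nrm_def L2_set_def power_mult_distrib sum_distrib_left[symmetric] real_sqrt_mult)

lemma nrm_minus: "nrm k (\<lambda>a. - f a) = nrm k f"
  by (simp add: nrm_def L2_set_def)

lemma nrm_abs: "nrm k (\<lambda>a. \<bar>f a\<bar>) = nrm k f"
  by (simp add: nrm_def L2_set_def)

lemma nrm_diff_le: "nrm k (\<lambda>a. f a - g a) \<le> nrm k f + nrm k g"
  using nrm_add_le[of k f "\<lambda>a. - g a"] by (simp add: nrm_minus)

lemma nrm_diff_commute: "nrm k (\<lambda>a. f a - g a) = nrm k (\<lambda>a. g a - f a)"
  using nrm_minus[of k "\<lambda>a. f a - g a"] by simp

lemma nrm_le_add_diff: "nrm k f \<le> nrm k g + nrm k (\<lambda>a. f a - g a)"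
  using nrm_add_le[of k g "\<lambda>a. f a - g a"] by simp

lemma nrm_sum_le: "nrm k (\<lambda>a. \<Sum>c\<in>C. f c a) \<le> (\<Sum>c\<in>C. nrm k (f c))"
proof (induction C rule: infinite_finite_induct)
  case (insert c C)
  then show ?case using nrm_add_le[of k "f c" "\<lambda>a. \<Sum>c\<in>C. f c a"] by simp
qed (simp_all add: nrm_def L2_set_def)

lemma nrm_lincomb_le:
  assumes "\<And>c. c < m \<Longrightarrow> nrm k (f c) \<le> B"
  shows "nrm k (\<lambda>a. \<Sum>c<m. z c * f c a) \<le> B * (\<Sum>c<m. \<bar>z c\<bar>)"
proof -
  have "nrm k (\<lambda>a. \<Sum>c<m. z c * f c a) \<le> (\<Sum>c<m. \<bar>z c\<bar> * nrm k (f c))"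
    using nrm_sum_le[of k "\<lambda>c a. z c * f c a" "{..<m}"] by (simp add: nrm_scale)
  also have "\<dots> \<le> (\<Sum>c<m. \<bar>z c\<bar> * B)"
    using assms by (intro sum_mono mult_left_mono) auto
  finally show ?thesis by (simp add: sum_distrib_left mult.commute)
qed

lemma nrm_mono: "(\<And>a. a < k \<Longrightarrow> \<bar>f a\<bar> \<le> g a) \<Longrightarrow> nrm k f \<le> nrm k g"
  using L2_set_mono[of "{..<k}" "\<lambda>a. \<bar>f a\<bar>" g] by (simp add: nrm_abs flip: nrm_def)

lemma abs_le_nrm: "a < k \<Longrightarrow> \<bar>f a\<bar> \<le> nrm k f"
  using member_le_L2_set[of "{..<k}" a "\<lambda>a. \<bar>f a\<bar>"] by (simp add: nrm_abs flip: nrm_def)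

lemma nrm_prefix_le: "i \<le> m \<Longrightarrow> nrm i f \<le> nrm m f"
  unfolding nrm_def L2_set_def by (intro real_sqrt_le_mono sum_mono2) auto

text \<open>Cauchy-Schwarz against the all-ones vector. Each use costs a factor sqrt m in the error
  bounds.\<close>

lemma sum_abs_le_nrm: "(\<Sum>c<m. \<bar>y c\<bar>) \<le> sqrt (real m) * nrm m y"
  using L2_set_mult_ineq[of "\<lambda>_. 1" y "{..<m}"] by (simp add: L2_set_constant nrm_def)

lemma nrm_le_sqrt_mult: "(\<And>a. a < k \<Longrightarrow> \<bar>f a\<bar> \<le> B) \<Longrightarrow> nrm k f \<le> sqrt (real k) * B"
proof -
  assume a: "\<And>a. a < k \<Longrightarrow> \<bar>f a\<bar> \<le> B"
  have "nrm k f \<le> nrm k (\<lambda>_. \<bar>B\<bar>)" by (rule nrm_mono) (use a in force)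
  also have "\<dots> = sqrt (real k) * \<bar>B\<bar>" by (simp add: L2_set_constant nrm_def)
  \<comment> \<open>The sign of \<open>B\<close> is not assumed: for k > 0 it follows from any
    entry, and for k = 0 both sides vanish.\<close>
  also have "\<dots> = sqrt (real k) * B"
  proof (cases k)
    case (Suc k')
    then have "0 \<le> B" using a[of 0] by simp
    then show ?thesis by simp
  qed simp
  finally show ?thesis .
qed

lemma nrm_eq_0_iff: "nrm k f = 0 \<longleftrightarrow> (\<forall>a<k. f a = 0)"
  by (auto simp: nrm_def L2_set_eq_0_iff)

text \<open>\<open>h\<close> and \<open>h'\<close> play the role of the exactly transformed columns:
  an isometry leaves the Gram entry unchanged, so only the three error terms of the expansion around
  \<open>h\<close> and \<open>h'\<close> remain.\<close>

lemma gram_perturb: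
  assumes H: "ip k h h' = ip k f f'" "nrm k h = nrm k f" "nrm k h' = nrm k f'"
    and e: "nrm k (\<lambda>a. b a - h a) \<le> \<eta> * nrm k f" "nrm k (\<lambda>a. b' a - h' a) \<le> \<eta> * nrm k f'"
    and "0 \<le> \<eta>"
  shows "\<bar>ip k b b' - ip k f f'\<bar> \<le> (2 * \<eta> + \<eta>\<^sup>2) * (nrm k f * nrm k f')"
proof -
  let ?e = "\<lambda>a. b a - h a" and ?e' = "\<lambda>a. b' a - h' a"
  have "ip k b b' = ip k (\<lambda>a. h a + ?e a) (\<lambda>a. h' a + ?e' a)" by (rule ip_cong) auto
  then have "ip k b b' - ip k f f' = ip k h ?e' + ip k ?e h' + ip k ?e ?e'"
    unfolding ip_add_left ip_add_right by (simp add: H)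
  moreover have "\<bar>ip k h ?e'\<bar> \<le> nrm k f * (\<eta> * nrm k f')"
    by (rule order.trans[OF ip_abs_le]) (auto intro!: mult_mono e simp: H)
  moreover have "\<bar>ip k ?e h'\<bar> \<le> (\<eta> * nrm k f) * nrm k f'"
    by (rule order.trans[OF ip_abs_le]) (auto intro!: mult_mono e simp: H \<open>0 \<le> \<eta>\<close>)
  moreover have "\<bar>ip k ?e ?e'\<bar> \<le> (\<eta> * nrm k f) * (\<eta> * nrm k f')"
  proof -
    have "nrm k ?e * nrm k ?e' \<le> (\<eta> * nrm k f) * (\<eta> * nrm k f')"
      by (rule mult_mono[OF e]) (simp_all add: \<open>0 \<le> \<eta>\<close>)
    then show ?thesis using ip_abs_le[of k ?e ?e'] by linarith
  qed
  ultimately show ?thesis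
    by (simp add: algebra_simps power2_eq_square)
qed

section \<open>Rounding errors\<close>

lemma roundedI:
  assumes "\<bar>y - x\<bar> \<le> u * \<bar>x\<bar>" "0 \<le> u"
  shows "rounded u x y"
proof (cases "x = 0")
  case True
  then show ?thesis using assms unfolding rounded_def by (intro exI[of _ 0]) simp
next
  case False
  then show ?thesis using assms unfolding rounded_def
    by (intro exI[of _ "(y - x) / x"]) (simp add: abs_divide divide_le_eq distrib_left)
qed

lemma roundedD:
  assumes "rounded u x y"
  shows "\<bar>y - x\<bar> \<le> u * \<bar>x\<bar>"
proof -
  obtain a where a: "\<bar>a\<bar> \<le> u" "y = x * (1 + a)" using assms unfolding rounded_def by blast
  then have "y - x = a * x" by (simp add: algebra_simps)
  then show ?thesis using mult_right_mono[OF a(1), of "\<bar>x\<bar>"] by (simp add: abs_mult)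
qed

lemma rounded_nonneg: "rounded u x y \<Longrightarrow> 0 \<le> u"
  unfolding rounded_def by auto

lemma rounded_refl: "0 \<le> u \<Longrightarrow> rounded u x x"
  unfolding rounded_def by (rule exI[of _ 0]) auto

lemma rounded_mono: "rounded u x y \<Longrightarrow> u \<le> v \<Longrightarrow> rounded v x y"
  unfolding rounded_def by force

lemma abs_one_plus_prod_le:
  fixes a b u v :: real
  assumes "\<bar>a\<bar> \<le> u" "\<bar>b\<bar> \<le> v"
  shows "\<bar>(1 + a) * (1 + b) - 1\<bar> \<le> u + v + u * v"
proof -
  have "\<bar>a * b\<bar> \<le> u * v" using assms by (auto simp: abs_mult intro!: mult_mono)
  moreover have "(1 + a) * (1 + b) - 1 = a + b + a * b" by (simp add: algebra_simps)
  ultimately show ?thesis using assms by linarith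
qed

lemma rounded_mult:
  assumes "rounded u x x'" "rounded v y y'"
  shows "rounded (u + v + u * v) (x * y) (x' * y')"
proof -
  obtain a b where "\<bar>a\<bar> \<le> u" "x' = x * (1 + a)" "\<bar>b\<bar> \<le> v" "y' = y * (1 + b)"
    using assms unfolding rounded_def by auto
  then show ?thesis unfolding rounded_def
    by (intro exI[of _ "(1 + a) * (1 + b) - 1"]) (use abs_one_plus_prod_le in \<open>auto simp: algebra_simps\<close>)
qed

lemma rounded_trans:
  assumes "rounded u x y" "rounded v y z"
  shows "rounded (u + v + u * v) x z"
proof -
  obtain a b where "\<bar>a\<bar> \<le> u" "y = x * (1 + a)" "\<bar>b\<bar> \<le> v" "z = y * (1 + b)"
    using assms unfolding rounded_def by auto
  then show ?thesis unfolding rounded_def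
    by (intro exI[of _ "(1 + a) * (1 + b) - 1"]) (use abs_one_plus_prod_le in \<open>auto simp: algebra_simps\<close>)
qed

lemma rounded_inverse:
  assumes "rounded u x x'" "u < 1"
  shows "rounded (u / (1 - u)) (inverse x) (inverse x')"
proof -
  obtain a where a: "\<bar>a\<bar> \<le> u" "x' = x * (1 + a)"
    using assms unfolding rounded_def by auto
  have "0 < 1 - u" "1 - u \<le> 1 + a" using a assms by auto
  have "\<bar>inverse (1 + a) - 1\<bar> = \<bar>a\<bar> / (1 + a)"
  proof -
    have "inverse (1 + a) - 1 = - a / (1 + a)"
      using \<open>0 < 1 - u\<close> \<open>1 - u \<le> 1 + a\<close> by (simp add: field_simps)
    then show ?thesis using \<open>0 < 1 - u\<close> \<open>1 - u \<le> 1 + a\<close> by (simp add: abs_divide)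
  qed
  also have "\<dots> \<le> u / (1 - u)"
    using \<open>0 < 1 - u\<close> \<open>1 - u \<le> 1 + a\<close> a by (intro frac_le) auto
  finally show ?thesis unfolding rounded_def
    by (intro exI[of _ "inverse (1 + a) - 1"]) (auto simp: a)
qed

lemma rounded_divide:
  assumes "rounded u x x'" "rounded v y y'" "v < 1"
  shows "rounded (u + v / (1 - v) + u * (v / (1 - v))) (x / y) (x' / y')"
  using rounded_mult[OF assms(1) rounded_inverse[OF assms(2,3)]] by (simp add: divide_inverse)

text \<open>Since sqrt (1 + a) - 1 equals a divided by sqrt (1 + a) + 1 \<ge> 1, a square root never
  enlarges a relative error.\<close>

lemma rounded_sqrt:
  assumes "rounded u x x'" "0 \<le> x" "u \<le> 1"
  shows "0 \<le> x'" "rounded u (sqrt x) (sqrt x')"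
proof -
  obtain a where a: "\<bar>a\<bar> \<le> u" "x' = x * (1 + a)"
    using assms unfolding rounded_def by auto
  have "0 \<le> 1 + a" using a assms by auto
  then show "0 \<le> x'" using a assms by auto
  have "(sqrt (1 + a) - 1) * (sqrt (1 + a) + 1) = a"
    using \<open>0 \<le> 1 + a\<close> by (simp add: algebra_simps)
  then have "\<bar>a\<bar> = \<bar>sqrt (1 + a) - 1\<bar> * (sqrt (1 + a) + 1)"
    using \<open>0 \<le> 1 + a\<close> abs_mult[of "sqrt (1 + a) - 1" "sqrt (1 + a) + 1"] by simp
  moreover have "\<bar>sqrt (1 + a) - 1\<bar> * 1 \<le> \<bar>sqrt (1 + a) - 1\<bar> * (sqrt (1 + a) + 1)"
    using \<open>0 \<le> 1 + a\<close> by (intro mult_left_mono) auto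
  ultimately have "\<bar>sqrt (1 + a) - 1\<bar> \<le> \<bar>a\<bar>" by simp
  then have "\<bar>sqrt (1 + a) - 1\<bar> \<le> u" using a(1) by (rule order.trans)
  then show "rounded u (sqrt x) (sqrt x')" unfolding rounded_def
    by (intro exI[of _ "sqrt (1 + a) - 1"]) (auto simp: a real_sqrt_mult)
qed

text \<open>Without cancellation |x + y| = |x| + |y|. The sign choice in the Householder vector and
  the sum of squares in a rotation rely on this.\<close>

lemma rounded_add_same_sign:
  assumes "rounded u x x'" "rounded u y y'" "0 \<le> x * y"
  shows "rounded u (x + y) (x' + y')"
proof (rule roundedI)
  have "\<bar>x' - x\<bar> \<le> u * \<bar>x\<bar>" "\<bar>y' - y\<bar> \<le> u * \<bar>y\<bar>" using assms roundedD by auto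
  then have "\<bar>x' + y' - (x + y)\<bar> \<le> u * (\<bar>x\<bar> + \<bar>y\<bar>)" by (simp add: distrib_left)
  also have "\<bar>x\<bar> + \<bar>y\<bar> = \<bar>x + y\<bar>"
    using assms(3) by (auto simp: zero_le_mult_iff)
  finally show "\<bar>x' + y' - (x + y)\<bar> \<le> u * \<bar>x + y\<bar>" .
qed (use assms rounded_nonneg in auto)

lemma fl_arithmeticD:
  assumes "fl_arithmetic u F"
  shows "rounded u (x + y) (fl_add F x y)" "rounded u (x - y) (fl_sub F x y)"
    "rounded u (x * y) (fl_mul F x y)" "y \<noteq> 0 \<Longrightarrow> rounded u (x / y) (fl_div F x y)"
    "0 \<le> x \<Longrightarrow> rounded u (sqrt x) (fl_sqrt F x)" "0 \<le> u"
  using assms rounded_nonneg unfolding fl_arithmetic_def by blast+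

section \<open>Accumulated errors of sums, inner products and norms\<close>

lemma one_plus_power_le:
  fixes u :: real
  assumes "0 \<le> u" "real n * u \<le> 1/100"
  shows "(1 + u) ^ n - 1 \<le> 2 * real n * u"
proof -
  \<comment> \<open>\<open>n\<close> stays fixed during the induction because the smallness
    hypothesis is about \<open>n\<close>; it keeps the quadratic term u * 2 j u below u.\<close>
  have "(1 + u) ^ j \<le> 1 + 2 * real j * u" if "j \<le> n" for j
    using that
  proof (induction j)
    case (Suc j)
    have j: "real j * u \<le> 1/100"
      using Suc.prems assms by (meson Suc_leD mult_right_mono of_nat_mono order.trans)
    have "(1 + u) ^ Suc j \<le> (1 + u) * (1 + 2 * real j * u)"
      using Suc assms by (auto intro!: mult_left_mono)
    also have "\<dots> = 1 + 2 * real j * u + u + u * (2 * (real j * u))" by (simp add: algebra_simps)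
    also have "u * (2 * (real j * u)) \<le> u * 1"
      using j assms by (intro mult_left_mono) auto
    finally show ?case by (simp add: algebra_simps add_divide_distrib)
  qed simp
  from this[OF order.refl] show ?thesis by simp
qed

text \<open>The accumulator has an initial error \<gamma> of its own because summation starts from
  the first product rather than 0. Coupling the error to the sum of absolute values, which also
  dominates the partial sum, makes one more addition cost exactly a factor 1 + u.\<close>

lemma foldl_fl_add:
  assumes F: "fl_arithmetic u F"
    and x: "\<And>x y. (x, y) \<in> set xys \<Longrightarrow> rounded \<gamma> x y" and acc: "rounded \<gamma> z z'"
  shows "\<bar>foldl (fl_add F) z' (map snd xys) - (z + (\<Sum>(x,y)\<leftarrow>xys. x))\<bar>
    \<le> ((1 + \<gamma>) * (1 + u) ^ length xys - 1) * (\<bar>z\<bar> + (\<Sum>(x,y)\<leftarrow>xys. \<bar>x\<bar>))"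
  using x
proof (induction xys rule: rev_induct)
  case Nil
  then show ?case using roundedD[OF acc] by simp
next
  case (snoc p xys)
  obtain x y where p: "p = (x, y)" by force
  define g where "g = (1 + \<gamma>) * (1 + u) ^ length xys"
  define A where "A = \<bar>z\<bar> + (\<Sum>(x,y)\<leftarrow>xys. \<bar>x\<bar>)"
  define E where "E = z + (\<Sum>(x,y)\<leftarrow>xys. x)"
  define r where "r = foldl (fl_add F) z' (map snd xys)"
  have u: "0 \<le> u" and \<gamma>: "0 \<le> \<gamma>" using fl_arithmeticD(6)[OF F] rounded_nonneg[OF acc] by simp_all
  have IH: "\<bar>r - E\<bar> \<le> (g - 1) * A"
    unfolding r_def E_def g_def A_def by (rule snoc.IH, rule snoc.prems) simp
  have "\<bar>y - x\<bar> \<le> \<gamma> * \<bar>x\<bar>" by (rule roundedD, rule snoc.prems) (simp add: p)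
  also have "\<dots> \<le> (g - 1) * \<bar>x\<bar>"
  proof (rule mult_right_mono)
    have "(1 + \<gamma>) * 1 \<le> g" unfolding g_def using u \<gamma> by (intro mult_left_mono) auto
    then show "\<gamma> \<le> g - 1" by simp
  qed auto
  finally have y: "\<bar>y - x\<bar> \<le> (g - 1) * \<bar>x\<bar>" .
  have s: "\<bar>(r + y) - (E + x)\<bar> \<le> (g - 1) * (A + \<bar>x\<bar>)"
    using IH y by (simp add: algebra_simps)
  have EA: "\<bar>E + x\<bar> \<le> A + \<bar>x\<bar>"
  proof -
    have "\<bar>\<Sum>(x,y)\<leftarrow>xys. x\<bar> \<le> (\<Sum>(x,y)\<leftarrow>xys. \<bar>x\<bar>)"
      by (induction xys) (auto simp: split_beta)
    then show ?thesis unfolding E_def A_def by linarith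
  qed
  have "\<bar>fl_add F r y - (r + y)\<bar> \<le> u * \<bar>r + y\<bar>" using fl_arithmeticD(1)[OF F] roundedD by blast
  also have "\<dots> \<le> u * (g * (A + \<bar>x\<bar>))"
    using s EA u by (intro mult_left_mono) (auto simp: algebra_simps)
  finally have "\<bar>fl_add F r y - (E + x)\<bar> \<le> (g * (1 + u) - 1) * (A + \<bar>x\<bar>)"
    using s by (simp add: algebra_simps)
  then show ?case by (simp add: p g_def A_def E_def r_def algebra_simps)
qed

lemma sum_lessThan_eq_sum_list:
  fixes f :: "nat \<Rightarrow> real"
  assumes "0 < n"
  shows "(\<Sum>i<n. f i) = f 0 + sum_list (map f [Suc 0..<n])"
proof -
  have "(\<Sum>i<n. f i) = sum_list (map f [0..<n])"
    by (metis atLeast_upt distinct_upt sum_list_distinct_conv_sum_set lessThan_atLeast0)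
  also have "[0..<n] = 0 # [Suc 0..<n]" using assms by (rule upt_conv_Cons)
  finally show ?thesis by simp
qed

lemma fl_inner_error:
  assumes F: "fl_arithmetic u F" and n: "dim_vec y = n" "real n * u \<le> 1/100"
  shows "\<bar>fl_inner F x y - (\<Sum>i<n. x $ i * y $ i)\<bar> \<le> 2 * real n * u * (\<Sum>i<n. \<bar>x $ i * y $ i\<bar>)"
proof (cases n)
  case 0
  then show ?thesis by (simp add: fl_inner_def n)
next
  case (Suc n')
  have u: "0 \<le> u" using F by (rule fl_arithmeticD(6))
  have n0: "0 < n" using Suc by simp
  have upt: "[0..<n] = 0 # [Suc 0..<n]" using Suc by (simp add: upt_conv_Cons)
  define f where "f = (\<lambda>i. (x $ i * y $ i, fl_mul F (x $ i) (y $ i)))"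
  have "\<bar>foldl (fl_add F) (snd (f 0)) (map snd (map f [Suc 0..<n])) - (fst (f 0) + (\<Sum>(x,y)\<leftarrow>map f [Suc 0..<n]. x))\<bar>
    \<le> ((1 + u) * (1 + u) ^ length (map f [Suc 0..<n]) - 1) * (\<bar>fst (f 0)\<bar> + (\<Sum>(x,y)\<leftarrow>map f [Suc 0..<n]. \<bar>x\<bar>))"
    by (rule foldl_fl_add[OF F]) (use fl_arithmeticD(3)[OF F] in \<open>auto simp: f_def\<close>)
  moreover have "fl_inner F x y = foldl (fl_add F) (snd (f 0)) (map snd (map f [Suc 0..<n]))"
    unfolding fl_inner_def n(1) upt f_def by (simp only: list.map fl_sum.simps fst_conv snd_conv map_map comp_def)
  moreover have "fst (f 0) + (\<Sum>(x,y)\<leftarrow>map f [Suc 0..<n]. x) = (\<Sum>i<n. x $ i * y $ i)"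
    unfolding sum_lessThan_eq_sum_list[OF n0] f_def by (simp add: comp_def)
  moreover have "\<bar>fst (f 0)\<bar> + (\<Sum>(x,y)\<leftarrow>map f [Suc 0..<n]. \<bar>x\<bar>) = (\<Sum>i<n. \<bar>x $ i * y $ i\<bar>)"
    unfolding sum_lessThan_eq_sum_list[OF n0] f_def by (simp add: comp_def)
  \<comment> \<open>One rounding for each product and at most n - 1 additions.\<close>
  moreover have "(1 + u) * (1 + u) ^ length (map f [Suc 0..<n]) = (1 + u) ^ n"
    using n0 by (simp flip: power_Suc)
  ultimately have "\<bar>fl_inner F x y - (\<Sum>i<n. x $ i * y $ i)\<bar> \<le> ((1 + u) ^ n - 1) * (\<Sum>i<n. \<bar>x $ i * y $ i\<bar>)"
    by (simp only:)
  also have "\<dots> \<le> 2 * real n * u * (\<Sum>i<n. \<bar>x $ i * y $ i\<bar>)"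
    by (intro mult_right_mono one_plus_power_le u n) (auto intro: sum_nonneg)
  finally show ?thesis .
qed

text \<open>All summands are squares, so the error of the inner product is relative to its value,
  and the square root preserves this. The factor 4 covers 2 n u, the final rounding and their
  product.\<close>

lemma fl_norm_rounded:
  assumes F: "fl_arithmetic u F" and n: "dim_vec x = n" "real n * u \<le> 1/100" "1 \<le> n"
  shows "rounded (4 * real n * u) (nrm n (\<lambda>i. x $ i)) (fl_norm F x)"
proof -
  have u: "0 \<le> u" using F by (rule fl_arithmeticD(6))
  have s0: "0 \<le> (\<Sum>i<n. x $ i * x $ i)" by (auto intro: sum_nonneg)
  moreover have "\<bar>fl_inner F x x - (\<Sum>i<n. x $ i * x $ i)\<bar> \<le> 2 * real n * u * (\<Sum>i<n. x $ i * x $ i)"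
    using fl_inner_error[OF F n(1,2), of x] by simp
  ultimately have r: "rounded (2 * real n * u) (\<Sum>i<n. x $ i * x $ i) (fl_inner F x x)"
    using u by (intro roundedI) simp_all
  have "2 * real n * u \<le> 1" using n by linarith
  note s = rounded_sqrt[OF r s0 this]
  have "u \<le> real n * u" using n u by (simp add: mult_le_cancel_right1)
  have "rounded (2 * real n * u + u + 2 * real n * u * u) (sqrt (\<Sum>i<n. x $ i * x $ i)) (fl_norm F x)"
    unfolding fl_norm_def using rounded_trans[OF s(2) fl_arithmeticD(5)[OF F s(1)]] .
  moreover have "2 * (real n * u) * u \<le> 1 * u" using n u by (intro mult_right_mono) auto
  then have "2 * real n * u + u + 2 * real n * u * u \<le> 4 * real n * u"
    using \<open>u \<le> real n * u\<close> by (simp add: algebra_simps)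
  ultimately show ?thesis
    unfolding nrm_eq_sqrt_ip ip_def by (rule rounded_mono)
qed

lemma rounded_0_iff: "rounded u x y \<Longrightarrow> u < 1 \<Longrightarrow> y = 0 \<longleftrightarrow> x = 0"
  unfolding rounded_def by fastforce

section \<open>Householder reflections\<close>

definition colf :: "real mat \<Rightarrow> nat \<Rightarrow> nat \<Rightarrow> real" where
  "colf B c a = B $$ (a, c)"

text \<open>Connects the code, which works on a tail of length k - t, with the analysis, which pads
  that tail by zeros to length k so that all columns live in one space.\<close>

lemma sum_tail:
  fixes f :: "nat \<Rightarrow> real"
  assumes "\<And>a. a < t \<Longrightarrow> f a = 0" "t \<le> k"
  shows "(\<Sum>i<k - t. f (t + i)) = (\<Sum>a<k. f a)"
proof -
  have "(\<Sum>a<k. f a) = (\<Sum>a\<in>{..<t} \<union> {t..<k}. f a)"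
    using assms by (intro sum.cong) auto
  also have "\<dots> = (\<Sum>a\<in>{..<t}. f a) + (\<Sum>a\<in>{t..<k}. f a)"
    by (rule sum.union_disjoint) auto
  also have "(\<Sum>a\<in>{..<t}. f a) = 0" using assms by simp
  also have "(\<Sum>a\<in>{t..<k}. f a) = (\<Sum>i<k - t. f (t + i))"
    using sum.shift_bounds_nat_ivl[of f 0 t "k - t"] assms(2) by (simp add: atLeast0LessThan add.commute)
  finally show ?thesis by simp
qed

text \<open>The cross terms -2 \<beta> <v,f> <v,g> and \<beta>^2 <v,v> <v,f> <v,g> cancel exactly
  when \<beta> <v,v> = 2.\<close>

lemma reflection_ip:
  assumes "\<beta> * ip k v v = 2"
  shows "ip k (\<lambda>a. f a - \<beta> * ip k v f * v a) (\<lambda>a. g a - \<beta> * ip k v g * v a) = ip k f g"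
proof -
  have "ip k (\<lambda>a. f a - \<beta> * ip k v f * v a) (\<lambda>a. g a - \<beta> * ip k v g * v a)
    = ip k f g - 2 * (\<beta> * ip k v f * ip k v g) + \<beta> * ip k v f * ip k v g * (\<beta> * ip k v v)"
    unfolding ip_diff_left ip_diff_right ip_scale_left ip_scale_right ip_commute[of k f v]
    by (simp add: algebra_simps)
  then show ?thesis by (simp add: assms)
qed

section \<open>Rounding errors in applying a reflector\<close>

text \<open>Keeps the error budget linear: as a h \<le> 1/10, the perturbed value is at most 2 Z, so
  a rounding adds 2 to the coefficient and no second-order term survives.\<close>

lemma rounded_step:
  fixes a h Z :: real
  assumes "\<bar>x' - x\<bar> \<le> a * h * Z" "\<bar>x\<bar> \<le> Z" "rounded u x' y" "0 \<le> a" "a \<le> 1000" "0 \<le> u" "u \<le> h" "h \<le> 1/10^4"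
  shows "\<bar>y - x\<bar> \<le> (a + 2) * h * Z"
proof -
  have Z: "0 \<le> Z" using assms by linarith
  have h: "0 \<le> h" using assms by linarith
  have "a * h \<le> 1000 * (1/10^4)" using assms h by (intro mult_mono) auto
  then have "a * h * Z \<le> 1 * Z" using Z by (intro mult_right_mono) auto
  then have x': "\<bar>x'\<bar> \<le> 2 * Z" using assms by linarith
  have "\<bar>y - x'\<bar> \<le> u * \<bar>x'\<bar>" using assms roundedD by blast
  also have "\<dots> \<le> h * (2 * Z)" using assms x' h by (intro mult_mono) auto
  finally have "\<bar>y - x'\<bar> \<le> 2 * h * Z" by simp
  with assms(1) have "\<bar>y - x\<bar> \<le> a * h * Z + 2 * h * Z" by linarith
  then show ?thesis by (simp add: algebra_simps)
qed

text \<open>As b h \<le> 1/10, the second factor stays below 2 Y; doubling \<open>a\<close> thus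
  replaces the quadratic term a b h^2.\<close>

lemma product_step:
  fixes a b h X Y :: real
  assumes x: "\<bar>x' - x\<bar> \<le> a * h * X" "\<bar>x\<bar> \<le> X" and y: "\<bar>y' - y\<bar> \<le> b * h * Y" "\<bar>y\<bar> \<le> Y"
    and ab: "0 \<le> a" "0 \<le> b" "b \<le> 1000" "0 \<le> h" "h \<le> 1/10^4"
  shows "\<bar>x' * y' - x * y\<bar> \<le> (2 * a + b) * h * (X * Y)"
proof -
  have X: "0 \<le> X" and Y: "0 \<le> Y" using assms by linarith+
  have "b * h \<le> 1000 * (1/10^4)" using assms by (intro mult_mono) auto
  then have "b * h * Y \<le> 1 * Y" using Y by (intro mult_right_mono) auto
  then have y': "\<bar>y'\<bar> \<le> 2 * Y" using y by linarith
  have "x' * y' - x * y = (x' - x) * y' + x * (y' - y)" by (simp add: algebra_simps)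
  then have "\<bar>x' * y' - x * y\<bar> \<le> \<bar>x' - x\<bar> * \<bar>y'\<bar> + \<bar>x\<bar> * \<bar>y' - y\<bar>"
    using abs_triangle_ineq[of "(x' - x) * y'" "x * (y' - y)"] by (simp add: abs_mult)
  also have "\<dots> \<le> (a * h * X) * (2 * Y) + X * (b * h * Y)"
    using x y y' X Y ab by (intro add_mono mult_mono) auto
  finally show ?thesis by (simp add: algebra_simps)
qed

text \<open>The computed vector is perturbed by at most \<open>6h\<close> relatively per entry and the computed
  \<open>\<beta>\<close> by \<open>16h\<close>; the reflected vector then inherits an error of size \<open>O(h)\<close>, because
  \<open>\<beta> \<parallel>v\<parallel>\<^sup>2 = 2\<close>.\<close>

lemma reflection_entry_error:
  assumes F: "fl_arithmetic u F" and u: "u \<le> h" "h \<le> 1/10^4"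
    and v: "\<bar>v' - v\<bar> \<le> 6 * h * \<bar>v\<bar>"
    and \<beta>: "\<bar>\<beta>' - \<beta>\<bar> \<le> 16 * h * \<beta>" "0 \<le> \<beta>"
    and J: "\<bar>J' - J\<bar> \<le> 9 * h * P" "\<bar>J\<bar> \<le> P"
  shows "\<bar>fl_sub F b (fl_mul F (fl_mul F \<beta>' J') v') - (b - \<beta> * J * v)\<bar> \<le> h * \<bar>b\<bar> + 96 * h * (\<beta> * P * \<bar>v\<bar>)"
proof -
  have u0: "0 \<le> u" and h0: "0 \<le> h" using fl_arithmeticD(6)[OF F] u by auto
  have P: "0 \<le> P" using J(2) by linarith
  have "\<bar>\<beta>' * J' - \<beta> * J\<bar> \<le> (2 * 16 + 9) * h * (\<beta> * P)"
    by (rule product_step) (use \<beta> J h0 u in auto)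
  moreover have bJ: "\<bar>\<beta> * J\<bar> \<le> \<beta> * P"
    using \<beta>(2) J(2) by (simp add: abs_mult mult_left_mono)
  ultimately have w: "\<bar>fl_mul F \<beta>' J' - \<beta> * J\<bar> \<le> ((2 * 16 + 9) + 2) * h * (\<beta> * P)"
    by (rule rounded_step[OF _ _ fl_arithmeticD(3)[OF F]]) (use u u0 in auto)
  have "\<bar>fl_mul F \<beta>' J' * v' - \<beta> * J * v\<bar> \<le> (2 * ((2 * 16 + 9) + 2) + 6) * h * (\<beta> * P * \<bar>v\<bar>)"
    by (rule product_step[OF w bJ v]) (use u h0 in auto)
  moreover have z: "\<bar>\<beta> * J * v\<bar> \<le> \<beta> * P * \<bar>v\<bar>"
    using mult_right_mono[OF bJ, of "\<bar>v\<bar>"] by (simp add: abs_mult)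
  ultimately have z': "\<bar>fl_mul F (fl_mul F \<beta>' J') v' - \<beta> * J * v\<bar> \<le> (2 * ((2 * 16 + 9) + 2) + 6 + 2) * h * (\<beta> * P * \<bar>v\<bar>)"
    by (rule rounded_step[OF _ _ fl_arithmeticD(3)[OF F]]) (use u u0 in auto)
  define Z where "Z = \<beta> * P * \<bar>v\<bar>"
  have Z: "0 \<le> Z" unfolding Z_def using \<beta> P by auto
  define z where "z = \<beta> * J * v"
  define zz where "zz = fl_mul F (fl_mul F \<beta>' J') v'"
  have 1: "\<bar>zz - z\<bar> \<le> 94 * h * Z" and 2: "\<bar>z\<bar> \<le> Z" using z z' unfolding z_def zz_def Z_def by auto
  have "94 * h * Z \<le> 1 * Z" using u Z by (intro mult_right_mono) auto
  then have "\<bar>b - zz\<bar> \<le> \<bar>b\<bar> + 2 * Z" using 1 2 by linarith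
  have "\<bar>fl_sub F b zz - (b - zz)\<bar> \<le> u * \<bar>b - zz\<bar>" by (rule roundedD[OF fl_arithmeticD(2)[OF F]])
  also have "\<dots> \<le> h * (\<bar>b\<bar> + 2 * Z)"
    using u h0 \<open>\<bar>b - zz\<bar> \<le> \<bar>b\<bar> + 2 * Z\<close> by (intro mult_mono) auto
  finally have "\<bar>fl_sub F b zz - (b - z)\<bar> \<le> h * (\<bar>b\<bar> + 2 * Z) + 94 * h * Z" using 1 by linarith
  then show ?thesis by (simp add: Z_def z_def zz_def algebra_simps)
qed

text \<open>9 = 6 + 2 * 3/2: the perturbed entries contribute 6 h, and the inner product error 2 h
  acts on absolute values inflated by at most 3/2.\<close>

lemma fl_inner_perturbed_error:
  assumes F: "fl_arithmetic u F" and K: "dim_vec y = K" "real K * u \<le> h" "h \<le> 1/10^4"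
    and x: "\<And>i. i < K \<Longrightarrow> \<bar>x' $ i - x i\<bar> \<le> 6 * h * \<bar>x i\<bar>"
  shows "\<bar>fl_inner F x' y - (\<Sum>i<K. x i * y $ i)\<bar> \<le> 9 * h * (\<Sum>i<K. \<bar>x i\<bar> * \<bar>y $ i\<bar>)"
proof -
  define P where "P = (\<Sum>i<K. \<bar>x i\<bar> * \<bar>y $ i\<bar>)"
  have u: "0 \<le> u" using F by (rule fl_arithmeticD(6))
  have h: "0 \<le> h" using K(2) u by (meson mult_nonneg_nonneg of_nat_0_le_iff order.trans)
  have P: "0 \<le> P" unfolding P_def by (auto intro: sum_nonneg)
  have 1: "\<bar>(\<Sum>i<K. x' $ i * y $ i) - (\<Sum>i<K. x i * y $ i)\<bar> \<le> 6 * h * P"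
  proof -
    have "\<bar>(\<Sum>i<K. x' $ i * y $ i) - (\<Sum>i<K. x i * y $ i)\<bar> \<le> (\<Sum>i<K. \<bar>x' $ i - x i\<bar> * \<bar>y $ i\<bar>)"
      unfolding sum_subtractf[symmetric] left_diff_distrib[symmetric]
      by (rule order.trans[OF sum_abs]) (simp add: abs_mult)
    also have "\<dots> \<le> (\<Sum>i<K. 6 * h * \<bar>x i\<bar> * \<bar>y $ i\<bar>)"
      by (intro sum_mono mult_right_mono x) auto
    finally show ?thesis unfolding P_def by (simp add: sum_distrib_left mult.assoc)
  qed
  have "\<bar>x' $ i * y $ i\<bar> \<le> 3/2 * (\<bar>x i\<bar> * \<bar>y $ i\<bar>)" if "i < K" for i
  proof -
    have "6 * h * \<bar>x i\<bar> \<le> 1/2 * \<bar>x i\<bar>" using K by (intro mult_right_mono) auto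
    then have "\<bar>x' $ i\<bar> \<le> 3/2 * \<bar>x i\<bar>" using x[OF that] by linarith
    then have "\<bar>x' $ i\<bar> * \<bar>y $ i\<bar> \<le> 3/2 * \<bar>x i\<bar> * \<bar>y $ i\<bar>" by (rule mult_right_mono) auto
    then show ?thesis by (simp add: abs_mult)
  qed
  then have 2: "(\<Sum>i<K. \<bar>x' $ i * y $ i\<bar>) \<le> 3/2 * P"
    unfolding P_def sum_distrib_left by (intro sum_mono) auto
  have "\<bar>fl_inner F x' y - (\<Sum>i<K. x' $ i * y $ i)\<bar> \<le> 2 * real K * u * (\<Sum>i<K. \<bar>x' $ i * y $ i\<bar>)"
    by (rule fl_inner_error[OF F]) (use K in auto)
  also have "\<dots> \<le> (2 * h) * (3/2 * P)"
    by (rule mult_mono[OF _ 2]) (use K h in \<open>auto intro: sum_nonneg\<close>)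
  finally show ?thesis using 1 unfolding P_def by (simp add: algebra_simps)
qed


lemma householder_step_eq:
  fixes B :: "real mat"
  assumes "t < dim_row B"
  defines "x \<equiv> (\<lambda>t c. vec (dim_row B - t) (\<lambda>a. B $$ (t + a, c)))"
  shows "householder_step F t B =
     (let nrm = fl_norm F (x t t);
          s = (if B $$ (t, t) \<ge> 0 then nrm else - nrm);
          v = vec (dim_row B - t) (\<lambda>a. if a = 0 then fl_add F (B $$ (t, t)) s else B $$ (t + a, t));
          \<beta> = fl_div F 1 (fl_mul F s (fl_add F (B $$ (t, t)) s))
      in if nrm = 0 then B
         else mat (dim_row B) (dim_col B) (\<lambda>(a,c).
           if a < t \<or> c < t then B $$ (a,c)
           else if c = t then (if a = t then - s else 0)
           else fl_sub F (B $$ (a,c)) (fl_mul F (fl_mul F \<beta> (fl_inner F v (x t c))) (v $ (a - t)))))"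
proof -
  let ?x = "vec (dim_row B - t) (\<lambda>a. B $$ (t + a, t))"
  have x0: "?x $ 0 = B $$ (t, t)" using assms(1) by simp
  have v: "vec (dim_row B - t) (\<lambda>a. if a = 0 then fl_add F (B $$ (t, t)) s else ?x $ a)
    = vec (dim_row B - t) (\<lambda>a. if a = 0 then fl_add F (B $$ (t, t)) s else B $$ (t + a, t))" for s
    by (intro eq_vecI) auto
  have v0: "vec (dim_row B - t) (\<lambda>a. if a = 0 then fl_add F (B $$ (t, t)) s else B $$ (t + a, t)) $ 0
    = fl_add F (B $$ (t, t)) s" for s
    using assms(1) by simp
  show ?thesis unfolding householder_step_def Let_def x_def x0 v v0 ..
qed

section \<open>The two invariants of the triangularization\<close>

definition upper_upto :: "nat \<Rightarrow> real mat \<Rightarrow> bool" where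
  "upper_upto t B \<longleftrightarrow> (\<forall>c<t. \<forall>a<dim_row B. c < a \<longrightarrow> B $$ (a, c) = 0)"

text \<open>The error is relative to the two original columns involved, so the right-hand side can
  be carried as one more column whatever its size.\<close>

definition gram_close :: "nat \<Rightarrow> nat \<Rightarrow> real \<Rightarrow> real mat \<Rightarrow> real mat \<Rightarrow> bool" where
  "gram_close k N g A B \<longleftrightarrow> (\<forall>c<N. \<forall>d<N.
     \<bar>ip k (colf B c) (colf B d) - ip k (colf A c) (colf A d)\<bar> \<le> g * (nrm k (colf A c) * nrm k (colf A d)))"

lemma householder_step_upper:
  assumes "B \<in> carrier_mat k N" "t < k" "t < N" "fl_arithmetic u F" "real k * u \<le> 1/10^4" "upper_upto t B"
  shows "householder_step F t B \<in> carrier_mat k N" "upper_upto (Suc t) (householder_step F t B)"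
proof -
  have u: "0 \<le> u" by (rule fl_arithmeticD(6)[OF assms(4)])
  show "householder_step F t B \<in> carrier_mat k N"
    using assms(1) unfolding householder_step_def Let_def by auto
  define x where "x = vec (k - t) (\<lambda>a. B $$ (t + a, t))"
  have "real (k - t) * u \<le> real k * u" using u by (intro mult_right_mono) auto
  then have Ku: "real (k - t) * u \<le> 1/10^4" using assms(5) by linarith
  have r: "rounded (4 * real (k - t) * u) (nrm (k - t) (\<lambda>i. x $ i)) (fl_norm F x)"
    by (rule fl_norm_rounded[OF assms(4)]) (use assms Ku in \<open>auto simp: x_def\<close>)
  \<comment> \<open>A skipped step must find the column already eliminated: with relative error
    below 1, the computed norm vanishes only if the exact one does.\<close>
  have "B $$ (a, t) = 0" if "fl_norm F x = 0" "t \<le> a" "a < k" for a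
  proof -
    have "nrm (k - t) (\<lambda>i. x $ i) = 0"
    proof -
      have "4 * real (k - t) * u \<le> 4 * (1/10^4)"
        using mult_left_mono[OF Ku zero_le_numeral] by (simp only: mult.assoc)
      also have "\<dots> < 1" by simp
      finally have "4 * real (k - t) * u < 1" .
      from rounded_0_iff[OF r this] that(1) show ?thesis by simp
    qed
    then have "x $ (a - t) = 0" unfolding nrm_eq_0_iff using that by simp
    then show ?thesis using that by (simp add: x_def)
  qed
  note zero = this
  have tB: "t < dim_row B" using assms by auto
  \<comment> \<open>Triangularity depends only on which entries are copied or set to 0; all computed
    values are hidden in \<open>s\<close> and \<open>f\<close>.\<close>
  have "\<exists>s f. householder_step F t B = (if fl_norm F x = 0 then B else mat k N (\<lambda>(a,c).
      if a < t \<or> c < t then B $$ (a,c) else if c = t then (if a = t then s else 0) else f a c))"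
    unfolding householder_step_eq[OF tB] Let_def x_def carrier_matD[OF assms(1)] by (intro exI) (rule refl)
  then obtain s f where B': "householder_step F t B = (if fl_norm F x = 0 then B else mat k N (\<lambda>(a,c).
      if a < t \<or> c < t then B $$ (a,c) else if c = t then (if a = t then s else 0) else f a c))" by blast
  show "upper_upto (Suc t) (householder_step F t B)"
  proof (cases "fl_norm F x = 0")
    case True
    then show ?thesis using assms zero unfolding B' upper_upto_def by (auto simp: less_Suc_eq)
  next
    case False
    then show ?thesis using assms unfolding B' upper_upto_def by (auto simp: less_Suc_eq)
  qed
qed

text \<open>The reference is the exact reflector for the exact norm of the column tail. Each
  computed column differs from the reflected one by at most 200 h times its norm, and 2 * 200 h +
  (200 h)^2 \<le> 500 h.\<close>

lemma householder_step_gram: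
  assumes B: "B \<in> carrier_mat k N" and t: "t < k" "t < N" and F: "fl_arithmetic u F"
    and h: "real k * u \<le> h" "h \<le> 1/10^4" and up: "upper_upto t B"
  shows "gram_close k N (500 * h) B (householder_step F t B)"
proof -
  have u: "0 \<le> u" by (rule fl_arithmeticD(6)[OF F])
  have "1 * u \<le> real k * u" using t u by (intro mult_right_mono) auto
  then have uh: "u \<le> h" using h by simp
  have h0: "0 \<le> h" using u uh by simp
  define K where "K = k - t"
  have "real K * u \<le> real k * u" using u unfolding K_def by (intro mult_right_mono) auto
  then have Ku: "real K * u \<le> h" using h by simp
  define x where "x c = vec K (\<lambda>a. B $$ (t + a, c))" for c
  define \<sigma>' where "\<sigma>' = fl_norm F (x t)"
  define x0 where "x0 = B $$ (t, t)"
  define sg :: real where "sg = (if 0 \<le> x0 then 1 else -1)"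
  define s' where "s' = sg * \<sigma>'"
  define v0' where "v0' = fl_add F x0 s'"
  define v' where "v' = vec K (\<lambda>a. if a = 0 then v0' else B $$ (t + a, t))"
  define \<beta>' where "\<beta>' = fl_div F 1 (fl_mul F s' v0')"
  define B' where "B' = householder_step F t B"
  have tB: "t < dim_row B" using B t by auto
  have B'_eq: "B' = (if \<sigma>' = 0 then B else mat k N (\<lambda>(a,c).
           if a < t \<or> c < t then B $$ (a,c)
           else if c = t then (if a = t then - s' else 0)
           else fl_sub F (B $$ (a,c)) (fl_mul F (fl_mul F \<beta>' (fl_inner F v' (x c))) (v' $ (a - t)))))"
  proof -
    have s': "(if 0 \<le> B $$ (t, t) then z else - z) = sg * z" for z :: real
      unfolding sg_def x0_def by simp
    show ?thesis
      unfolding B'_def householder_step_eq[OF tB] Let_def s' x_def \<sigma>'_def K_def x0_def s'_def v0'_def v'_def \<beta>'_def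
        carrier_matD[OF B] ..
  qed
  define xt where "xt a = (if a < t then 0 else B $$ (a, t))" for a
  define \<sigma> where "\<sigma> = nrm k xt"
  have \<sigma>2: "\<sigma>\<^sup>2 = ip k xt xt" unfolding \<sigma>_def by (simp add: ip_self)
  have "ip K (\<lambda>i. x t $ i) (\<lambda>i. x t $ i) = (\<Sum>i<k - t. xt (t + i) * xt (t + i))"
    unfolding ip_def K_def by (intro sum.cong) (auto simp: x_def xt_def K_def)
  also have "\<dots> = ip k xt xt"
    unfolding ip_def using t by (intro sum_tail) (auto simp: xt_def)
  finally have "nrm K (\<lambda>i. x t $ i) = \<sigma>"
    unfolding \<sigma>_def nrm_eq_sqrt_ip by simp
  moreover have "rounded (4 * real K * u) (nrm K (\<lambda>i. x t $ i)) \<sigma>'"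
    unfolding \<sigma>'_def by (rule fl_norm_rounded[OF F]) (use t Ku h in \<open>auto simp: x_def K_def\<close>)
  ultimately have r\<sigma>: "rounded (4 * h) \<sigma> \<sigma>'"
    using Ku rounded_mono[of "4 * real K * u" \<sigma> \<sigma>' "4 * h"] by auto
  show ?thesis
  proof (cases "\<sigma>' = 0")
    case True
    then have "householder_step F t B = B" using B'_eq B'_def by simp
    then show ?thesis unfolding gram_close_def using h0 by simp
  next
    case False
    have \<sigma>: "0 < \<sigma>"
    proof -
      have "\<sigma> \<noteq> 0" using rounded_0_iff[OF r\<sigma>] False h by simp
      then show ?thesis using nrm_nonneg[of k xt] unfolding \<sigma>_def by linarith
    qed
    define s where "s = sg * \<sigma>"
    have sg2: "sg * sg = 1" and sgx: "sg * x0 = \<bar>x0\<bar>" unfolding sg_def by auto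
    \<comment> \<open>\<open>s\<close> never has the sign opposite to \<open>x0\<close>, so x0 + s
      involves no cancellation. This gives both D > 0 and a small relative error of
      \<open>v0'\<close>.\<close>
    have "x0 * s = \<bar>x0\<bar> * \<sigma>" unfolding s_def sgx[symmetric] by simp
    then have x0s: "0 \<le> x0 * s" using \<sigma> by simp
    have ss: "s * s = \<sigma>\<^sup>2" unfolding s_def power2_eq_square using sg2 by (simp add: algebra_simps)
    define v where "v a = (if a < t then 0 else if a = t then x0 + s else B $$ (a, t))" for a
    have v_eq: "v a = xt a + (if a = t then s else 0)" for a
      unfolding v_def xt_def x0_def by auto
    have ip_v: "ip k v f = ip k xt f + s * f t" for f
    proof -
      have "ip k v f = ip k xt f + ip k (\<lambda>a. if a = t then s else 0) f"
        unfolding ip_add_left[symmetric] by (rule ip_cong) (auto simp: v_eq)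
      also have "ip k (\<lambda>a. if a = t then s else 0) f = s * f t"
        unfolding ip_def using t by (simp add: if_distrib[of "\<lambda>z. z * _"] cong: if_cong)
      finally show ?thesis .
    qed
    have xtt: "xt t = x0" unfolding xt_def x0_def by simp
    have vtt: "v t = x0 + s" unfolding v_def by simp
    define D where "D = s * (x0 + s)"
    have D: "0 < D" unfolding D_def using ss x0s \<sigma> by (simp add: algebra_simps add_nonneg_pos)
    \<comment> \<open>Hence 1 / D is 2 / <v,v>, the factor that makes the reflector orthogonal, in
      the form evaluated by the code.\<close>
    have vv: "ip k v v = 2 * D"
      unfolding ip_v[of v] ip_commute[of k xt v] ip_v[of xt] xtt vtt \<sigma>2[symmetric] D_def ss[symmetric]
      by (simp add: algebra_simps)
    define \<beta> where "\<beta> = 1 / D"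
    have \<beta>: "0 < \<beta>" unfolding \<beta>_def using D by simp
    have \<beta>vv: "\<beta> * ip k v v = 2" unfolding \<beta>_def vv using D by simp
    have rs: "rounded (4 * h) s s'"
      using rounded_mult[OF rounded_refl[of 0 sg] r\<sigma>] unfolding s_def s'_def by simp
    have "rounded (4 * h + u + 4 * h * u) (x0 + s) v0'"
      unfolding v0'_def
      by (rule rounded_trans[OF rounded_add_same_sign fl_arithmeticD(1)[OF F]])
         (use rs x0s h0 in \<open>auto intro: rounded_refl\<close>)
    then have rv0: "rounded (6 * h) (x0 + s) v0'"
      if "h * u \<le> 1/10^4 * h"
      by (rule rounded_mono) (use that uh h0 in simp)
    have hu: "h * u \<le> 1/10^4 * h" using uh h u h0 by (subst mult.commute, intro mult_mono) auto
    note rv0 = rv0[OF hu]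
    have hh: "h * h \<le> 1/10^4 * h" using h h0 by (intro mult_right_mono) auto
    have "rounded (4 * h + 6 * h + 4 * h * (6 * h)) D (s' * v0')"
      unfolding D_def by (rule rounded_mult[OF rs rv0])
    then have "rounded (11 * h) D (s' * v0')"
      by (rule rounded_mono) (use hh h0 in simp)
    from rounded_trans[OF this fl_arithmeticD(3)[OF F]]
    have "rounded (13 * h) D (fl_mul F s' v0')"
      by (rule rounded_mono) (use hu uh h0 in simp)
    note rD = this
    have D'0: "fl_mul F s' v0' \<noteq> 0" using rounded_0_iff[OF rD] D h by simp
    have "rounded (13 * h / (1 - 13 * h)) \<beta> (1 / fl_mul F s' v0')"
      using rounded_inverse[OF rD] h unfolding \<beta>_def by (simp add: inverse_eq_divide)
    moreover have "13 * h / (1 - 13 * h) \<le> 14 * h"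
    proof -
      have "13 * h \<le> 14 * h * (1 - 13 * h)" using hh h0 by (simp add: algebra_simps)
      then show ?thesis using h by (simp add: pos_divide_le_eq)
    qed
    ultimately have "rounded (14 * h) \<beta> (1 / fl_mul F s' v0')" by (rule rounded_mono)
    from rounded_trans[OF this fl_arithmeticD(4)[OF F D'0]]
    have "rounded (16 * h) \<beta> \<beta>'"
      unfolding \<beta>'_def by (rule rounded_mono) (use hu uh h0 in simp)
    then have \<beta>': "\<bar>\<beta>' - \<beta>\<bar> \<le> 16 * h * \<beta>" using roundedD \<beta> by fastforce
    have v': "\<bar>v' $ (a - t) - v a\<bar> \<le> 6 * h * \<bar>v a\<bar>" if "t \<le> a" "a < k" for a
    proof (cases "a = t")
      case True
      then show ?thesis using roundedD[OF rv0] that unfolding v'_def K_def v_def by simp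
    next
      case False
      then show ?thesis using that h0 unfolding v'_def K_def v_def by simp
    qed
    define H where "H c a = colf B c a - \<beta> * ip k v (colf B c) * v a" for c a
    have H_ip: "ip k (H c) (H d) = ip k (colf B c) (colf B d)" for c d
      unfolding H_def by (rule reflection_ip[OF \<beta>vv])
    have H_nrm: "nrm k (H c) = nrm k (colf B c)" for c
      unfolding nrm_eq_sqrt_ip H_ip ..
    have err: "nrm k (\<lambda>a. colf B' c a - H c a) \<le> 200 * h * nrm k (colf B c)" if c: "c < N" for c
    proof -
      have B'_idx: "B' $$ (a, c) = (if a < t \<or> c < t then B $$ (a,c)
           else if c = t then (if a = t then - s' else 0)
           else fl_sub F (B $$ (a,c)) (fl_mul F (fl_mul F \<beta>' (fl_inner F v' (x c))) (v' $ (a - t))))"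
        if "a < k" for a
        unfolding B'_eq using False that c by simp
      consider "c < t" | "c = t" | "t < c" by linarith
      then show ?thesis
      proof cases
        case 1
        \<comment> \<open>Finished columns vanish in the rows where \<open>v\<close> is supported,
          so the exact reflector leaves them alone, as the code does.\<close>
        have "ip k v (colf B c) = ip k (\<lambda>_. 0) (\<lambda>_. 0)"
          unfolding ip_def using up 1 B by (intro sum.cong) (auto simp: v_def colf_def upper_upto_def)
        then have "ip k v (colf B c) = 0" by (simp add: ip_def)
        then have "nrm k (\<lambda>a. colf B' c a - H c a) = nrm k (\<lambda>_. 0)"
          by (intro nrm_cong) (use 1 in \<open>auto simp: B'_idx H_def colf_def\<close>)
        also have "\<dots> = 0" by (simp add: nrm_eq_0_iff)
        finally show ?thesis using h0 by simp
      next
        case 2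
        \<comment> \<open>The exact image of the pivot column has -s in row t and 0 below. Storing
          zeros there is exact, and only s - s' remains as an error.\<close>
        have "ip k xt (colf B t) = \<sigma>\<^sup>2"
          unfolding \<sigma>2 ip_def by (intro sum.cong) (auto simp: xt_def colf_def)
        then have "ip k v (colf B t) = D"
          unfolding ip_v D_def ss[symmetric] by (simp add: colf_def x0_def algebra_simps)
        then have H: "H c a = colf B t a - v a" for a
          using D unfolding H_def 2 \<beta>_def by simp
        have "nrm k (\<lambda>a. colf B' c a - H c a) = nrm k (\<lambda>a. if a = t then s - s' else 0)"
          unfolding H by (intro nrm_cong) (use 2 in \<open>auto simp: B'_idx[unfolded 2] colf_def v_def x0_def\<close>)
        also have "\<dots> = \<bar>s - s'\<bar>"
          unfolding nrm_eq_sqrt_ip ip_def using t by (simp add: if_distrib[of "\<lambda>z. z * _"] cong: if_cong)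
        also have "\<dots> \<le> 4 * h * \<bar>s\<bar>" using roundedD[OF rs] by (simp add: abs_minus_commute)
        also have "\<bar>s\<bar> = \<sigma>" unfolding s_def sg_def using \<sigma> by simp
        also have "\<sigma> \<le> nrm k (\<lambda>a. \<bar>colf B t a\<bar>)"
          unfolding \<sigma>_def by (rule nrm_mono) (simp add: xt_def colf_def)
        then have "4 * h * \<sigma> \<le> 200 * h * nrm k (colf B c)"
          unfolding nrm_abs 2 using h0 \<sigma> by (intro mult_mono) auto
        finally show ?thesis .
      next
        case 3
        define P where "P = ip k (\<lambda>a. \<bar>v a\<bar>) (\<lambda>a. \<bar>colf B c a\<bar>)"
        define J where "J = ip k v (colf B c)"
        define J' where "J' = fl_inner F v' (x c)"
        have J_eq: "(\<Sum>i<K. v (t + i) * x c $ i) = J"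
        proof -
          have "(\<Sum>i<K. v (t + i) * x c $ i) = (\<Sum>i<k - t. v (t + i) * colf B c (t + i))"
            unfolding K_def by (intro sum.cong) (auto simp: x_def colf_def K_def)
          also have "\<dots> = J" unfolding J_def ip_def using t by (intro sum_tail) (auto simp: v_def)
          finally show ?thesis .
        qed
        have P_eq: "(\<Sum>i<K. \<bar>v (t + i)\<bar> * \<bar>x c $ i\<bar>) = P"
        proof -
          have "(\<Sum>i<K. \<bar>v (t + i)\<bar> * \<bar>x c $ i\<bar>) = (\<Sum>i<k - t. \<bar>v (t + i)\<bar> * \<bar>colf B c (t + i)\<bar>)"
            unfolding K_def by (intro sum.cong) (auto simp: x_def colf_def K_def)
          also have "\<dots> = P" unfolding P_def ip_def using t by (intro sum_tail) (auto simp: v_def)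
          finally show ?thesis .
        qed
        have "\<bar>J' - (\<Sum>i<K. v (t + i) * x c $ i)\<bar> \<le> 9 * h * (\<Sum>i<K. \<bar>v (t + i)\<bar> * \<bar>x c $ i\<bar>)"
          unfolding J'_def
        proof (rule fl_inner_perturbed_error[OF F _ Ku h(2)])
          show "\<bar>v' $ i - v (t + i)\<bar> \<le> 6 * h * \<bar>v (t + i)\<bar>" if "i < K" for i
            using v'[of "t + i"] that t unfolding K_def by auto
        qed (simp add: x_def)
        then have J': "\<bar>J' - J\<bar> \<le> 9 * h * P" unfolding J_eq P_eq .
        have JP: "\<bar>J\<bar> \<le> P"
          unfolding J_def P_def ip_def by (rule order.trans[OF sum_abs]) (simp add: abs_mult)
        have P0: "0 \<le> P" using JP by linarith
        have P_le: "P \<le> nrm k v * nrm k (colf B c)"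
          using ip_abs_le[of k "\<lambda>a. \<bar>v a\<bar>" "\<lambda>a. \<bar>colf B c a\<bar>"] unfolding nrm_abs P_def by linarith
        have "\<bar>colf B' c a - H c a\<bar> \<le> h * \<bar>colf B c a\<bar> + 96 * h * (\<beta> * P) * \<bar>v a\<bar>" if a: "a < k" for a
        proof (cases "a < t")
          case True
          then show ?thesis using a h0 \<beta> P0 by (simp add: B'_idx H_def v_def colf_def)
        next
          case False
          have "colf B' c a = fl_sub F (B $$ (a,c)) (fl_mul F (fl_mul F \<beta>' J') (v' $ (a - t)))"
            unfolding colf_def B'_idx[OF a] J'_def using False 3 by simp
          moreover have "H c a = B $$ (a,c) - \<beta> * J * v a" unfolding H_def J_def colf_def ..
          ultimately show ?thesis
            using reflection_entry_error[OF F uh h(2) v' \<beta>' _ J' JP, of a "B $$ (a,c)"] False a \<beta>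
            by (simp add: colf_def mult.assoc)
        qed
        then have "nrm k (\<lambda>a. colf B' c a - H c a) \<le> nrm k (\<lambda>a. h * \<bar>colf B c a\<bar> + 96 * h * (\<beta> * P) * \<bar>v a\<bar>)"
          by (rule nrm_mono)
        also have "\<dots> \<le> h * nrm k (colf B c) + 96 * h * (\<beta> * P) * nrm k v"
          using nrm_add_le[of k "\<lambda>a. h * \<bar>colf B c a\<bar>" "\<lambda>a. 96 * h * (\<beta> * P) * \<bar>v a\<bar>"] h0 \<beta> P0
          by (simp add: nrm_scale nrm_abs)
        also have "96 * h * (\<beta> * P) * nrm k v \<le> 96 * h * (\<beta> * (nrm k v * nrm k (colf B c))) * nrm k v"
          using P_le \<beta> h0 by (intro mult_right_mono mult_left_mono) auto
        \<comment> \<open>\<beta> <v,v> = 2 removes any dependence on the size of \<open>v\<close>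
          and turns 96 h into 192 h.\<close>
        also have "\<dots> = 96 * h * (\<beta> * ip k v v) * nrm k (colf B c)"
          unfolding ip_self power2_eq_square by simp
        also have "\<dots> = 192 * h * nrm k (colf B c)" unfolding \<beta>vv by simp
        finally have "nrm k (\<lambda>a. colf B' c a - H c a) \<le> (193 * h) * nrm k (colf B c)" by (simp add: algebra_simps)
        also have "\<dots> \<le> (200 * h) * nrm k (colf B c)" using h0 by (intro mult_right_mono) auto
        finally show ?thesis .
      qed
    qed
    have "2 * (200 * h) + (200 * h)\<^sup>2 \<le> 500 * h"
      using hh h0 by (simp add: power2_eq_square)
    then have "(2 * (200 * h) + (200 * h)\<^sup>2) * (nrm k (colf B c) * nrm k (colf B d)) \<le> 500 * h * (nrm k (colf B c) * nrm k (colf B d))" for c d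
      by (intro mult_right_mono) auto
    moreover have "0 \<le> 200 * h" using h0 by simp
    ultimately show ?thesis
      unfolding gram_close_def B'_def[symmetric]
      by (intro allI impI) (rule order.trans[OF gram_perturb[OF H_ip H_nrm H_nrm err err]])
  qed
qed

section \<open>Givens rotations\<close>

lemma gram_close_nrm_le:
  assumes "gram_close k N g A B" "c < N" "0 \<le> g"
  shows "nrm k (colf B c) \<le> sqrt (1 + g) * nrm k (colf A c)"
proof (rule power2_le_imp_le)
  have "\<bar>ip k (colf B c) (colf B c) - ip k (colf A c) (colf A c)\<bar> \<le> g * (nrm k (colf A c) * nrm k (colf A c))"
    using assms unfolding gram_close_def by blast
  then have "(nrm k (colf B c))\<^sup>2 \<le> (1 + g) * (nrm k (colf A c))\<^sup>2"
    unfolding ip_self by (simp add: algebra_simps power2_eq_square)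
  then show "(nrm k (colf B c))\<^sup>2 \<le> (sqrt (1 + g) * nrm k (colf A c))\<^sup>2"
    using assms(3) by (simp add: power_mult_distrib)
qed (use assms in auto)

text \<open>The second perturbation is relative to norms in \<open>B\<close>, which exceed those in
  \<open>A\<close> by at most sqrt (1 + g). Growth factors therefore multiply, and repeated steps
  give a power.\<close>

lemma gram_close_trans:
  assumes AB: "gram_close k N g A B" and BC: "gram_close k N g' B C" and g: "0 \<le> g" "0 \<le> g'"
  shows "gram_close k N ((1 + g) * (1 + g') - 1) A C"
  unfolding gram_close_def
proof (intro allI impI)
  fix c d assume c: "c < N" and d: "d < N"
  define X where "X = nrm k (colf A c) * nrm k (colf A d)"
  have "nrm k (colf B c) * nrm k (colf B d) \<le> (sqrt (1 + g) * nrm k (colf A c)) * (sqrt (1 + g) * nrm k (colf A d))"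
    by (intro mult_mono gram_close_nrm_le[OF AB] c d g) (use g in auto)
  also have "\<dots> = (sqrt (1 + g) * sqrt (1 + g)) * X" unfolding X_def by simp
  also have "\<dots> = (1 + g) * X" using g by simp
  finally have "g' * (nrm k (colf B c) * nrm k (colf B d)) \<le> g' * ((1 + g) * X)"
    using g by (intro mult_left_mono) auto
  moreover have "\<bar>ip k (colf C c) (colf C d) - ip k (colf B c) (colf B d)\<bar> \<le> g' * (nrm k (colf B c) * nrm k (colf B d))"
    using BC c d unfolding gram_close_def by blast
  moreover have "\<bar>ip k (colf B c) (colf B d) - ip k (colf A c) (colf A d)\<bar> \<le> g * X"
    using AB c d unfolding gram_close_def X_def by blast
  ultimately have "\<bar>ip k (colf C c) (colf C d) - ip k (colf A c) (colf A d)\<bar> \<le> g' * ((1 + g) * X) + g * X" by linarith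
  also have "\<dots> = ((1 + g) * (1 + g') - 1) * X" by (simp add: algebra_simps)
  finally show "\<bar>ip k (colf C c) (colf C d) - ip k (colf A c) (colf A d)\<bar> \<le> ((1 + g) * (1 + g') - 1) * (nrm k (colf A c) * nrm k (colf A d))"
    unfolding X_def .
qed

lemma gram_close_refl: "gram_close k N 0 A A"
  unfolding gram_close_def by simp

lemma gram_close_mono: "gram_close k N g A B \<Longrightarrow> g \<le> g' \<Longrightarrow> gram_close k N g' A B"
  unfolding gram_close_def by (meson mult_right_mono mult_nonneg_nonneg nrm_nonneg order.trans)

lemma sum_split_pair:
  fixes f :: "nat \<Rightarrow> real"
  assumes "p < k" "i < k" "p \<noteq> i"
  shows "(\<Sum>a<k. f a) = f p + f i + (\<Sum>a\<in>{..<k} - {p, i}. f a)"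
proof -
  have "(\<Sum>a<k. f a) = f p + (\<Sum>a\<in>{..<k} - {p}. f a)"
    using assms by (intro sum.remove) auto
  also have "(\<Sum>a\<in>{..<k} - {p}. f a) = f i + (\<Sum>a\<in>{..<k} - {p} - {i}. f a)"
    using assms by (intro sum.remove) auto
  also have "{..<k} - {p} - {i} = {..<k} - {p, i}" by auto
  finally show ?thesis by simp
qed

section \<open>A single rotation and a full elimination step\<close>

definition rotate_pair :: "nat \<Rightarrow> nat \<Rightarrow> real \<Rightarrow> real \<Rightarrow> (nat \<Rightarrow> real) \<Rightarrow> nat \<Rightarrow> real" where
  "rotate_pair p i c s f a =
     (if a = p then c * f p + s * f i else if a = i then c * f i - s * f p else f a)"

lemma rotate_pair_ip:
  assumes "p < k" "i < k" "p \<noteq> i" "c\<^sup>2 + s\<^sup>2 = 1"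
  shows "ip k (rotate_pair p i c s f) (rotate_pair p i c s g) = ip k f g"
proof -
  have "(c * f p + s * f i) * (c * g p + s * g i) + (c * f i - s * f p) * (c * g i - s * g p)
    = (c\<^sup>2 + s\<^sup>2) * (f p * g p + f i * g i)"
    by (simp add: algebra_simps power2_eq_square)
  also have "\<dots> = f p * g p + f i * g i" using assms by simp
  finally show ?thesis
    unfolding ip_def sum_split_pair[OF assms(1-3)] using assms(3) by (simp add: rotate_pair_def)
qed

text \<open>8 u from a coefficient and u from the product give 10 u once their cross term is
  absorbed. Two such products are bounded by 2 Z, and the last rounding makes it 12 u * 2 Z.\<close>

lemma fl_rotation_entry:
  assumes F: "fl_arithmetic u F" "u \<le> 1/10^4"
    and c: "rounded (8 * u) c c'" "\<bar>c\<bar> \<le> 1" and s: "rounded (8 * u) s s'" "\<bar>s\<bar> \<le> 1"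
    and b: "\<bar>b1\<bar> \<le> Z" "\<bar>b2\<bar> \<le> Z"
  shows "\<bar>fl_add F (fl_mul F c' b1) (fl_mul F s' b2) - (c * b1 + s * b2)\<bar> \<le> 24 * u * Z"
    and "\<bar>fl_sub F (fl_mul F c' b1) (fl_mul F s' b2) - (c * b1 - s * b2)\<bar> \<le> 24 * u * Z"
proof -
  have u: "0 \<le> u" by (rule fl_arithmeticD(6)[OF F(1)])
  have uu: "u * u \<le> 1/10^4 * u" using F(2) u by (intro mult_right_mono) auto
  have prod: "\<bar>fl_mul F x' b - x * b\<bar> \<le> 10 * u * Z" "\<bar>x * b\<bar> \<le> Z"
    if x: "rounded (8 * u) x x'" "\<bar>x\<bar> \<le> 1" and b: "\<bar>b\<bar> \<le> Z" for x x' b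
  proof -
    have "rounded (8 * u + 0 + 8 * u * 0) (x * b) (x' * b)"
      by (rule rounded_mult[OF x(1) rounded_refl]) simp
    from rounded_trans[OF this fl_arithmeticD(3)[OF F(1)]]
    have "rounded (10 * u) (x * b) (fl_mul F x' b)"
      by (rule rounded_mono) (use uu u in simp)
    from roundedD[OF this] have 1: "\<bar>fl_mul F x' b - x * b\<bar> \<le> 10 * u * \<bar>x * b\<bar>" .
    have "\<bar>x\<bar> * \<bar>b\<bar> \<le> 1 * Z" using x b by (intro mult_mono) auto
    then show "\<bar>x * b\<bar> \<le> Z" by (simp add: abs_mult)
    then have "10 * u * \<bar>x * b\<bar> \<le> 10 * u * Z" using u by (intro mult_left_mono) auto
    then show "\<bar>fl_mul F x' b - x * b\<bar> \<le> 10 * u * Z" using 1 by linarith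
  qed
  note p1 = prod[OF c b(1)] and p2 = prod[OF s b(2)]
  have "\<bar>fl_mul F c' b1 + fl_mul F s' b2 - (c * b1 + s * b2)\<bar> \<le> 10 * u * (2 * Z)"
    "\<bar>c * b1 + s * b2\<bar> \<le> 2 * Z" using p1 p2 by linarith+
  from rounded_step[OF this fl_arithmeticD(1)[OF F(1)]]
  show "\<bar>fl_add F (fl_mul F c' b1) (fl_mul F s' b2) - (c * b1 + s * b2)\<bar> \<le> 24 * u * Z"
    using F u by simp
  have "\<bar>fl_mul F c' b1 - fl_mul F s' b2 - (c * b1 - s * b2)\<bar> \<le> 10 * u * (2 * Z)"
    "\<bar>c * b1 - s * b2\<bar> \<le> 2 * Z" using p1 p2 by linarith+
  from rounded_step[OF this fl_arithmeticD(2)[OF F(1)]]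
  show "\<bar>fl_sub F (fl_mul F c' b1) (fl_mul F s' b2) - (c * b1 - s * b2)\<bar> \<le> 24 * u * Z"
    using F u by simp
qed

lemma fl_hypot_rounded:
  assumes F: "fl_arithmetic u F" "u \<le> 1/10^4"
  shows "rounded (5 * u) (sqrt (x\<^sup>2 + y\<^sup>2)) (fl_sqrt F (fl_add F (fl_mul F x x) (fl_mul F y y)))"
proof -
  have u: "0 \<le> u" by (rule fl_arithmeticD(6)[OF F(1)])
  have uu: "u * u \<le> 1/10^4 * u" using F(2) u by (intro mult_right_mono) auto
  have "rounded u (x * x + y * y) (fl_mul F x x + fl_mul F y y)"
    by (rule rounded_add_same_sign) (use fl_arithmeticD(3)[OF F(1)] in auto)
  from rounded_trans[OF this fl_arithmeticD(1)[OF F(1)]]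
  have r: "rounded (3 * u) (x\<^sup>2 + y\<^sup>2) (fl_add F (fl_mul F x x) (fl_mul F y y))"
    unfolding power2_eq_square by (rule rounded_mono) (use u uu in simp)
  have "3 * u \<le> 1" "0 \<le> x\<^sup>2 + y\<^sup>2" using F by auto
  note s = rounded_sqrt[OF r this(2,1)]
  show ?thesis
    using rounded_trans[OF s(2) fl_arithmeticD(5)[OF F(1) s(1)]] by (rule rounded_mono) (use u uu in simp)
qed

lemma fl_div_rounded:
  assumes F: "fl_arithmetic u F" "u \<le> 1/10^4" and r: "rounded (5 * u) \<rho> \<rho>'" "\<rho> \<noteq> 0"
  shows "rounded (8 * u) (x / \<rho>) (fl_div F x \<rho>')"
proof -
  have u: "0 \<le> u" by (rule fl_arithmeticD(6)[OF F(1)])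
  have uu: "u * u \<le> 1/10^4 * u" using F(2) u by (intro mult_right_mono) auto
  have "5 * u \<le> 6 * u * (1 - 5 * u)" using uu u by (simp add: algebra_simps)
  then have "5 * u / (1 - 5 * u) \<le> 6 * u" using F by (simp add: pos_divide_le_eq)
  moreover have "rounded (0 + 5 * u / (1 - 5 * u) + 0 * (5 * u / (1 - 5 * u))) (x / \<rho>) (x / \<rho>')"
    by (rule rounded_divide[OF rounded_refl r(1)]) (use F in auto)
  ultimately have "rounded (6 * u) (x / \<rho>) (x / \<rho>')" using rounded_mono by simp
  moreover have "\<rho>' \<noteq> 0" using rounded_0_iff[OF r(1)] r(2) F by simp
  ultimately have "rounded (6 * u + u + 6 * u * u) (x / \<rho>) (fl_div F x \<rho>')"
    using rounded_trans fl_arithmeticD(4)[OF F(1)] by blast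
  then show ?thesis by (rule rounded_mono) (use u uu in simp)
qed

text \<open>At most two entries per column change, each with error 24 u times the column norm. The
  column error 48 u gives 2 * 48 u plus a quadratic term for inner products.\<close>

lemma givens_rotation_gram:
  assumes B: "B \<in> carrier_mat k N" and t: "t < i" "i < k" "t < N" and F: "fl_arithmetic u F" "u \<le> 1/10^4"
    and up: "upper_upto t B"
  shows "gram_close k N (100 * u) B (givens_rotation F t i B)"
proof -
  have u: "0 \<le> u" by (rule fl_arithmeticD(6)[OF F(1)])
  have uu: "u * u \<le> 1/10^4 * u" using F(2) u by (intro mult_right_mono) auto
  define p where "p = i - 1"
  have p: "p < k" "p \<noteq> i" "t \<le> p" using t unfolding p_def by auto
  define x where "x = B $$ (p, t)"
  define y where "y = B $$ (i, t)"
  show ?thesis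
  proof (cases "y = 0")
    case True
    then have "givens_rotation F t i B = B" unfolding givens_rotation_def Let_def y_def by simp
    then show ?thesis using gram_close_mono[OF gram_close_refl, of "100 * u"] u by simp
  next
    case False
    define \<rho> where "\<rho> = sqrt (x\<^sup>2 + y\<^sup>2)"
    define \<rho>' where "\<rho>' = fl_sqrt F (fl_add F (fl_mul F x x) (fl_mul F y y))"
    have \<rho>: "0 < \<rho>" unfolding \<rho>_def using False by (simp add: sum_power2_gt_zero_iff)
    have r: "rounded (5 * u) \<rho> \<rho>'" unfolding \<rho>_def \<rho>'_def by (rule fl_hypot_rounded[OF F])
    define c where "c = x / \<rho>"
    define s where "s = y / \<rho>"
    define c' where "c' = fl_div F x \<rho>'"
    define s' where "s' = fl_div F y \<rho>'"
    have rc: "rounded (8 * u) c c'" and rs: "rounded (8 * u) s s'"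
      unfolding c_def c'_def s_def s'_def using fl_div_rounded[OF F r] \<rho> by auto
    have "x\<^sup>2 + y\<^sup>2 = \<rho>\<^sup>2" unfolding \<rho>_def by simp
    moreover have "c\<^sup>2 + s\<^sup>2 = (x\<^sup>2 + y\<^sup>2) / \<rho>\<^sup>2" unfolding c_def s_def by (simp add: power_divide add_divide_distrib)
    ultimately have cs: "c\<^sup>2 + s\<^sup>2 = 1" using \<rho> by simp
    have "c\<^sup>2 \<le> 1\<^sup>2" "s\<^sup>2 \<le> 1\<^sup>2" unfolding one_power2 using cs zero_le_power2[of c] zero_le_power2[of s] by linarith+
    then have c1: "\<bar>c\<bar> \<le> 1" and s1: "\<bar>s\<bar> \<le> 1" by (simp_all only: abs_le_square_iff[symmetric] abs_one)
    \<comment> \<open>The exact rotation also annihilates this entry, so storing 0 introduces no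
      error.\<close>
    have cysx: "c * y - s * x = 0" unfolding c_def s_def by simp
    define B' where "B' = givens_rotation F t i B"
    have B'_idx: "B' $$ (a, l) = (if l < t \<or> a \<notin> {p, i} then B $$ (a,l)
           else if a = p then fl_add F (fl_mul F c' (B $$ (p, l))) (fl_mul F s' (B $$ (i, l)))
           else if l = t then 0
           else fl_sub F (fl_mul F c' (B $$ (i, l))) (fl_mul F s' (B $$ (p, l))))" if "a < k" "l < N" for a l
      using that B False
      unfolding B'_def givens_rotation_def Let_def p_def[symmetric] x_def[symmetric] y_def[symmetric]
        \<rho>'_def[symmetric] c'_def[symmetric] s'_def[symmetric] by simp
    define H where "H l = rotate_pair p i c s (colf B l)" for l
    have H_ip: "ip k (H l) (H l') = ip k (colf B l) (colf B l')" for l l'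
      unfolding H_def by (rule rotate_pair_ip[OF p(1) t(2) p(2) cs])
    have H_nrm: "nrm k (H l) = nrm k (colf B l)" for l
      unfolding nrm_eq_sqrt_ip H_ip ..
    have err: "nrm k (\<lambda>a. colf B' l a - H l a) \<le> 48 * u * nrm k (colf B l)" if l: "l < N" for l
    proof -
      define Z where "Z = nrm k (colf B l)"
      have Z: "\<bar>B $$ (p, l)\<bar> \<le> Z" "\<bar>B $$ (i, l)\<bar> \<le> Z"
        using abs_le_nrm[OF p(1), of "colf B l"] abs_le_nrm[OF t(2), of "colf B l"] unfolding Z_def colf_def by auto
      then have Z0: "0 \<le> 24 * u * Z" using u by auto
      have e: "\<bar>colf B' l a - H l a\<bar> \<le> 24 * u * Z" if a: "a \<in> {p, i}" for a
      proof (cases "l < t")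
        case True
        then have "B $$ (p, l) = 0" "B $$ (i, l) = 0" using up B p t unfolding upper_upto_def by auto
        then show ?thesis using Z0 True l a p t by (auto simp: H_def rotate_pair_def colf_def B'_idx)
      next
        case False
        show ?thesis
        proof (cases "a = p")
          case True
          then show ?thesis using fl_rotation_entry(1)[OF F rc c1 rs s1 Z] False l p
            by (simp add: H_def rotate_pair_def colf_def B'_idx)
        next
          case ap: False
          then have ai: "a = i" using a by simp
          show ?thesis
          proof (cases "l = t")
            case True
            then show ?thesis using cysx Z0 p t ai
              by (simp add: H_def rotate_pair_def colf_def B'_idx x_def y_def)
          next
            case False
            then show ?thesis using fl_rotation_entry(2)[OF F rc c1 rs s1 Z(2,1)] \<open>\<not> l < t\<close> l p t ai
              by (simp add: H_def rotate_pair_def colf_def B'_idx)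
          qed
        qed
      qed
      have z: "colf B' l a - H l a = 0" if "a < k" "a \<noteq> p" "a \<noteq> i" for a
        using that l by (simp add: H_def rotate_pair_def colf_def B'_idx)
      have "nrm k (\<lambda>a. colf B' l a - H l a) \<le> (\<Sum>a<k. \<bar>colf B' l a - H l a\<bar>)"
        unfolding nrm_def by (rule L2_set_le_sum_abs)
      also have "\<dots> = \<bar>colf B' l p - H l p\<bar> + \<bar>colf B' l i - H l i\<bar>"
        unfolding sum_split_pair[OF p(1) t(2) p(2)] using z by simp
      also have "\<dots> \<le> 24 * u * Z + 24 * u * Z" using e by (intro add_mono) auto
      finally show ?thesis unfolding Z_def by simp
    qed
    have "2 * (48 * u) + (48 * u)\<^sup>2 \<le> 100 * u"
      using uu u by (simp add: power2_eq_square)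
    then have "(2 * (48 * u) + (48 * u)\<^sup>2) * (nrm k (colf B c) * nrm k (colf B d)) \<le> 100 * u * (nrm k (colf B c) * nrm k (colf B d))" for c d
      by (intro mult_right_mono) auto
    moreover have "0 \<le> 48 * u" using u by simp
    ultimately show ?thesis
      unfolding gram_close_def B'_def[symmetric]
      by (intro allI impI) (rule order.trans[OF gram_perturb[OF H_ip H_nrm H_nrm err err]])
  qed
qed

lemma givens_rotation_upper:
  assumes B: "B \<in> carrier_mat k N" and t: "t < i" "i < k" "t < N"
    and up: "upper_upto t B" and z: "\<And>a. i < a \<Longrightarrow> a < k \<Longrightarrow> B $$ (a, t) = 0"
  shows "givens_rotation F t i B \<in> carrier_mat k N" "upper_upto t (givens_rotation F t i B)"
    "i \<le> a \<Longrightarrow> a < k \<Longrightarrow> givens_rotation F t i B $$ (a, t) = 0"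
proof -
  have "\<exists>f g. givens_rotation F t i B = (if B $$ (i, t) = 0 then B else mat k N (\<lambda>(a, l).
    if l < t \<or> a \<notin> {i - 1, i} then B $$ (a, l) else if a = i - 1 then f l else if l = t then 0 else g l))"
    unfolding givens_rotation_def Let_def carrier_matD[OF B] by (intro exI) (rule refl)
  then obtain f g where *: "givens_rotation F t i B = (if B $$ (i, t) = 0 then B else mat k N (\<lambda>(a, l).
    if l < t \<or> a \<notin> {i - 1, i} then B $$ (a, l) else if a = i - 1 then f l else if l = t then 0 else g l))"
    by blast
  show "givens_rotation F t i B \<in> carrier_mat k N" unfolding * using B by simp
  show "upper_upto t (givens_rotation F t i B)" unfolding * upper_upto_def using B up t by (auto simp: upper_upto_def)
  show "i \<le> a \<Longrightarrow> a < k \<Longrightarrow> givens_rotation F t i B $$ (a, t) = 0"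
    unfolding * using t z by (cases "a = i") auto
qed


lemma givens_step_gram:
  assumes B: "B \<in> carrier_mat k N" and t: "t < k" "t < N" and F: "fl_arithmetic u F" "u \<le> 1/10^4"
    and up: "upper_upto t B"
  shows "givens_step F t B \<in> carrier_mat k N \<and> upper_upto (Suc t) (givens_step F t B) \<and>
    gram_close k N ((1 + 100 * u) ^ k - 1) B (givens_step F t B)"
proof -
  have u: "0 \<le> u" by (rule fl_arithmeticD(6)[OF F(1)])
  \<comment> \<open>\<open>foldr\<close> over an ascending list treats the bottom row first, like
    \<open>fold\<close> over the reversed list, and allows a downward induction on the topmost row
    \<open>j\<close> eliminated so far.\<close>
  define G where "G j = foldr (givens_rotation F t) [j..<k] B" for j
  have "G j \<in> carrier_mat k N \<and> upper_upto t (G j) \<and> (\<forall>a<k. j \<le> a \<longrightarrow> G j $$ (a, t) = 0) \<and>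
      gram_close k N ((1 + 100 * u) ^ (k - j) - 1) B (G j)" if "Suc t \<le> j" "j \<le> k" for j
    using that(2,1)
  proof (induction j rule: inc_induct)
    case base
    then show ?case using B up gram_close_refl by (simp add: G_def)
  next
    case (step j)
    then have IH: "G (Suc j) \<in> carrier_mat k N" "upper_upto t (G (Suc j))"
      "\<And>a. j < a \<Longrightarrow> a < k \<Longrightarrow> G (Suc j) $$ (a, t) = 0"
      "gram_close k N ((1 + 100 * u) ^ (k - Suc j) - 1) B (G (Suc j))" by auto
    have tj: "t < j" "j < k" using step by auto
    have G: "G j = givens_rotation F t j (G (Suc j))"
      unfolding G_def using tj by (simp add: upt_conv_Cons)
    have "gram_close k N ((1 + ((1 + 100 * u) ^ (k - Suc j) - 1)) * (1 + 100 * u) - 1) B (G j)"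
      unfolding G
      by (rule gram_close_trans[OF IH(4) givens_rotation_gram[OF IH(1) tj t(2) F IH(2)]]) (use u in auto)
    moreover have "(1 + 100 * u) ^ (k - j) = (1 + 100 * u) ^ (k - Suc j) * (1 + 100 * u)"
      using tj by (simp flip: power_Suc2 add: Suc_diff_Suc)
    ultimately show ?case
      using givens_rotation_upper[OF IH(1) tj t(2) IH(2,3)] unfolding G by simp
  qed
  from this[of "Suc t"] t have *: "G (Suc t) \<in> carrier_mat k N" "upper_upto t (G (Suc t))"
    "\<And>a. a < k \<Longrightarrow> t < a \<Longrightarrow> G (Suc t) $$ (a, t) = 0"
    "gram_close k N ((1 + 100 * u) ^ (k - Suc t) - 1) B (G (Suc t))" by auto
  have "givens_step F t B = G (Suc t)"
    unfolding givens_step_def G_def using B by (simp add: foldr_conv_fold)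
  moreover have "upper_upto (Suc t) (G (Suc t))"
    using *(1,2,3) unfolding upper_upto_def by (auto simp: less_Suc_eq)
  moreover have "(1 + 100 * u) ^ (k - Suc t) \<le> (1 + 100 * u) ^ k"
    using u by (intro power_increasing) auto
  ultimately show ?thesis using *(1) gram_close_mono[OF *(4)] by auto
qed

section \<open>Triangularization by either method\<close>

text \<open>One bound serves both methods: at most k rotations of 100 u each, or one reflection of
  500 k u, which Bernoulli's inequality places below (1 + 500 u)^k - 1.\<close>

lemma qr_step_gram:
  assumes B: "B \<in> carrier_mat k N" and t: "t < k" "t < N" and F: "fl_arithmetic u F" "real k * u \<le> 1/10^4"
    and up: "upper_upto t B"
  shows "qr_step solver F t B \<in> carrier_mat k N \<and> upper_upto (Suc t) (qr_step solver F t B) \<and>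
    gram_close k N ((1 + 500 * u) ^ k - 1) B (qr_step solver F t B)"
proof (cases solver)
  case Givens
  have u: "0 \<le> u" by (rule fl_arithmeticD(6)[OF F(1)])
  have "1 * u \<le> real k * u" using t u by (intro mult_right_mono) auto
  then have "u \<le> 1/10^4" using F by simp
  moreover have "(1 + 100 * u) ^ k \<le> (1 + 500 * u) ^ k" using u by (intro power_mono) auto
  then have "(1 + 100 * u) ^ k - 1 \<le> (1 + 500 * u) ^ k - 1" by simp
  ultimately show ?thesis
    using givens_step_gram[OF B t F(1) _ up] gram_close_mono unfolding Givens qr_step.simps by blast
next
  case Householder
  have u: "0 \<le> u" by (rule fl_arithmeticD(6)[OF F(1)])
  have "1 + real k * (500 * u) \<le> (1 + 500 * u) ^ k" using u by (intro Bernoulli_inequality) auto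
  then have "500 * (real k * u) \<le> (1 + 500 * u) ^ k - 1" by simp
  then show ?thesis
    using householder_step_gram[OF B t F(1) order.refl F(2) up] householder_step_upper[OF B t F up] gram_close_mono
    unfolding Householder qr_step.simps by blast
qed

lemma qr_fold_gram:
  assumes A: "A \<in> carrier_mat k N" and n: "n \<le> k" "n \<le> N" and F: "fl_arithmetic u F" "real k * u \<le> 1/10^4"
  shows "fold (qr_step solver F) [0..<n] A \<in> carrier_mat k N \<and> upper_upto n (fold (qr_step solver F) [0..<n] A) \<and>
    gram_close k N ((1 + 500 * u) ^ (k * n) - 1) A (fold (qr_step solver F) [0..<n] A)"
  using n
proof (induction n)
  case 0
  then show ?case using A by (simp add: upper_upto_def gram_close_refl)
next
  case (Suc n)
  have u: "0 \<le> u" by (rule fl_arithmeticD(6)[OF F(1)])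
  define C where "C = fold (qr_step solver F) [0..<n] A"
  have C: "C \<in> carrier_mat k N" "upper_upto n C" "gram_close k N ((1 + 500 * u) ^ (k * n) - 1) A C"
    using Suc unfolding C_def by auto
  have n: "n < k" "n < N" using Suc by auto
  note D = qr_step_gram[OF C(1) n F C(2), of solver]
  have "gram_close k N ((1 + ((1 + 500 * u) ^ (k * n) - 1)) * (1 + ((1 + 500 * u) ^ k - 1)) - 1) A (qr_step solver F n C)"
    by (rule gram_close_trans[OF C(3)]) (use D u in auto)
  then have "gram_close k N ((1 + 500 * u) ^ (k * Suc n) - 1) A (qr_step solver F n C)"
    by (simp add: power_add mult.commute)
  then show ?case using D by (simp add: C_def)
qed

section \<open>Back substitution\<close>

text \<open>Each term costs two roundings, of the product and of the subtraction, hence the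
  exponent. Cancellation may occur, so the bound is relative to the absolute values and not to the
  result.\<close>

lemma foldl_fl_sub_mul:
  assumes F: "fl_arithmetic u F"
  shows "\<bar>foldl (\<lambda>r l. fl_sub F r (fl_mul F (a l) (y l))) c ls - (c - (\<Sum>l\<leftarrow>ls. a l * y l))\<bar>
    \<le> ((1 + u) ^ (2 * length ls) - 1) * (\<bar>c\<bar> + (\<Sum>l\<leftarrow>ls. \<bar>a l\<bar> * \<bar>y l\<bar>))"
proof (induction ls rule: rev_induct)
  case (snoc l ls)
  have u: "0 \<le> u" by (rule fl_arithmeticD(6)[OF F])
  define g where "g = (1 + u) ^ (2 * length ls)"
  define A where "A = \<bar>c\<bar> + (\<Sum>l\<leftarrow>ls. \<bar>a l\<bar> * \<bar>y l\<bar>)"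
  define E where "E = c - (\<Sum>l\<leftarrow>ls. a l * y l)"
  define r where "r = foldl (\<lambda>r l. fl_sub F r (fl_mul F (a l) (y l))) c ls"
  define x where "x = a l * y l"
  define x' where "x' = fl_mul F (a l) (y l)"
  have IH: "\<bar>r - E\<bar> \<le> (g - 1) * A" using snoc unfolding r_def E_def g_def A_def .
  have g1: "1 \<le> g" unfolding g_def using u by simp
  have x': "\<bar>x' - x\<bar> \<le> u * \<bar>x\<bar>" unfolding x_def x'_def by (rule roundedD[OF fl_arithmeticD(3)[OF F]])
  have "\<bar>\<Sum>l\<leftarrow>ls. a l * y l\<bar> \<le> (\<Sum>l\<leftarrow>ls. \<bar>a l\<bar> * \<bar>y l\<bar>)"
    using sum_list_abs[of "map (\<lambda>l. a l * y l) ls"] by (simp add: comp_def abs_mult)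
  then have EA: "\<bar>E\<bar> \<le> A" unfolding E_def A_def by linarith
  have "\<bar>r - x'\<bar> \<le> ((g - 1) * A + A) + (u * \<bar>x\<bar> + \<bar>x\<bar>)" using IH x' EA by linarith
  then have "u * \<bar>r - x'\<bar> \<le> u * (((g - 1) * A + A) + (u * \<bar>x\<bar> + \<bar>x\<bar>))" using u by (rule mult_left_mono)
  moreover have "\<bar>fl_sub F r x' - (r - x')\<bar> \<le> u * \<bar>r - x'\<bar>" by (rule roundedD[OF fl_arithmeticD(2)[OF F]])
  ultimately have "\<bar>fl_sub F r x' - (E - x)\<bar> \<le> u * (((g - 1) * A + A) + (u * \<bar>x\<bar> + \<bar>x\<bar>)) + (g - 1) * A + u * \<bar>x\<bar>"
    using IH x' by linarith
  also have "\<dots> = (g * (1 + u) - 1) * A + ((1 + u)\<^sup>2 - 1) * \<bar>x\<bar>"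
    by (simp add: algebra_simps power2_eq_square)
  also have "\<dots> \<le> (g * (1 + u)\<^sup>2 - 1) * A + (g * (1 + u)\<^sup>2 - 1) * \<bar>x\<bar>"
  proof (intro add_mono mult_right_mono)
    show "g * (1 + u) - 1 \<le> g * (1 + u)\<^sup>2 - 1" using u g1 by (simp add: power2_eq_square algebra_simps)
    show "(1 + u)\<^sup>2 - 1 \<le> g * (1 + u)\<^sup>2 - 1" using mult_right_mono[OF g1, of "(1 + u)\<^sup>2"] by simp
  qed (use EA in auto)
  also have "g * (1 + u)\<^sup>2 = (1 + u) ^ (2 * length (ls @ [l]))"
    unfolding g_def power_add[symmetric] by simp
  also have "((1 + u) ^ (2 * length (ls @ [l])) - 1) * A + ((1 + u) ^ (2 * length (ls @ [l])) - 1) * \<bar>x\<bar>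
      = ((1 + u) ^ (2 * length (ls @ [l])) - 1) * (A + \<bar>a l\<bar> * \<bar>y l\<bar>)"
    by (simp only: x_def abs_mult distrib_left)
  finally show ?case unfolding r_def x'_def E_def A_def x_def by (simp add: algebra_simps)
qed simp

text \<open>Residuals are tracked instead of forward errors. The computed unknowns are inserted into
  the equation, so the error of one row does not feed into the next and no condition number of
  \<open>U\<close> appears.\<close>

lemma back_subst_last_error:
  fixes U :: "real mat" and c :: "real vec"
  assumes F: "fl_arithmetic u F" and U: "\<And>j. j < n \<Longrightarrow> U $$ (j, j) \<noteq> 0" and d: "d \<le> n"
  defines "ys \<equiv> back_subst_last F U c n d"
  shows "length ys = d \<and> (\<forall>j\<in>{n - d..<n}.
    \<bar>c $ j - (\<Sum>l=j..<n. U $$ (j, l) * ys ! (l - (n - d)))\<bar>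
      \<le> ((1 + u) ^ (2 * n) - 1) * (\<bar>c $ j\<bar> + (\<Sum>l=j..<n. \<bar>U $$ (j, l)\<bar> * \<bar>ys ! (l - (n - d))\<bar>)))"
  using d unfolding ys_def
proof (induction d)
  case (Suc d)
  have u: "0 \<le> u" by (rule fl_arithmeticD(6)[OF F])
  define ys where "ys = back_subst_last F U c n d"
  define j where "j = n - Suc d"
  have j: "j < n" "n - d = Suc j" using Suc.prems unfolding j_def by auto
  define r where "r = foldl (\<lambda>r l. fl_sub F r (fl_mul F (U $$ (j,l)) (ys ! (l - Suc j)))) (c $ j) [Suc j..<n]"
  define y where "y = fl_div F r (U $$ (j,j))"
  have len: "length ys = d" using Suc unfolding ys_def by simp
  have eq: "back_subst_last F U c n (Suc d) = y # ys"
    unfolding back_subst_last.simps Let_def ys_def[symmetric] j_def[symmetric] r_def[symmetric] y_def ..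
  have nth: "(y # ys) ! (l - j) = ys ! (l - Suc j)" if "Suc j \<le> l" for l
    using that by (simp add: nth_Cons' )
  show ?case unfolding eq j_def[symmetric]
  proof (intro conjI ballI)
    fix i assume i: "i \<in> {j..<n}"
    show "\<bar>c $ i - (\<Sum>l=i..<n. U $$ (i, l) * (y # ys) ! (l - j))\<bar>
      \<le> ((1 + u) ^ (2 * n) - 1) * (\<bar>c $ i\<bar> + (\<Sum>l=i..<n. \<bar>U $$ (i, l)\<bar> * \<bar>(y # ys) ! (l - j)\<bar>))"
    proof (cases "i = j")
      case False
      then have "i \<in> {Suc j..<n}" using i by auto
      moreover have "(\<Sum>l=i..<n. U $$ (i, l) * (y # ys) ! (l - j)) = (\<Sum>l=i..<n. U $$ (i, l) * ys ! (l - Suc j))"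
        "(\<Sum>l=i..<n. \<bar>U $$ (i, l)\<bar> * \<bar>(y # ys) ! (l - j)\<bar>) = (\<Sum>l=i..<n. \<bar>U $$ (i, l)\<bar> * \<bar>ys ! (l - Suc j)\<bar>)"
        using False i by (auto intro!: sum.cong simp: nth)
      ultimately show ?thesis using Suc unfolding ys_def[symmetric] j by auto
    next
      case True
      define A where "A = \<bar>c $ j\<bar> + (\<Sum>l=Suc j..<n. \<bar>U $$ (j, l)\<bar> * \<bar>ys ! (l - Suc j)\<bar>)"
      define E where "E = c $ j - (\<Sum>l=Suc j..<n. U $$ (j, l) * ys ! (l - Suc j))"
      define g where "g = (1 + u) ^ (2 * (n - Suc j))"
      have rE: "\<bar>r - E\<bar> \<le> (g - 1) * A"
        using foldl_fl_sub_mul[OF F, of "\<lambda>l. U $$ (j, l)" "\<lambda>l. ys ! (l - Suc j)" "c $ j" "[Suc j..<n]"]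
        unfolding r_def E_def A_def g_def by (simp add: interv_sum_list_conv_sum_set_nat)
      have "\<bar>\<Sum>l=Suc j..<n. U $$ (j, l) * ys ! (l - Suc j)\<bar> \<le> (\<Sum>l=Suc j..<n. \<bar>U $$ (j, l)\<bar> * \<bar>ys ! (l - Suc j)\<bar>)"
        by (rule order.trans[OF sum_abs]) (simp add: abs_mult)
      then have EA: "\<bar>E\<bar> \<le> A" unfolding E_def A_def by linarith
      have "\<bar>y - r / U $$ (j, j)\<bar> \<le> u * \<bar>r / U $$ (j, j)\<bar>"
        unfolding y_def by (rule roundedD[OF fl_arithmeticD(4)[OF F U[OF j(1)]]])
      \<comment> \<open>Multiplying by the pivot turns the error of the division into a
        residual.\<close>
      then have "\<bar>U $$ (j, j)\<bar> * \<bar>y - r / U $$ (j, j)\<bar> \<le> \<bar>U $$ (j, j)\<bar> * (u * \<bar>r / U $$ (j, j)\<bar>)"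
        by (rule mult_left_mono) simp
      then have "\<bar>U $$ (j, j) * y - r\<bar> \<le> u * \<bar>r\<bar>"
        using U[OF j(1)] by (simp add: abs_mult[symmetric] right_diff_distrib)
      moreover have "u * \<bar>r\<bar> \<le> u * (g * A)" using rE EA u by (intro mult_left_mono) (auto simp: algebra_simps)
      ultimately have "\<bar>E - U $$ (j, j) * y\<bar> \<le> (g - 1) * A + u * (g * A)" using rE by linarith
      also have "\<dots> = (g * (1 + u) - 1) * A" by (simp add: algebra_simps)
      also have "\<dots> \<le> ((1 + u) ^ (2 * n) - 1) * A"
      proof (intro mult_right_mono diff_right_mono)
        \<comment> \<open>Two roundings for each of the n - j - 1 terms and one for the
          division.\<close>
        have "g * (1 + u) = (1 + u) ^ (2 * (n - Suc j) + 1)" unfolding g_def by simp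
        also have "\<dots> \<le> (1 + u) ^ (2 * n)" using u j by (intro power_increasing) auto
        finally show "g * (1 + u) \<le> (1 + u) ^ (2 * n)" .
      qed (use EA in auto)
      also have "\<dots> \<le> ((1 + u) ^ (2 * n) - 1) * (A + \<bar>U $$ (j, j)\<bar> * \<bar>y\<bar>)"
        using u by (intro mult_left_mono) auto
      also have "A + \<bar>U $$ (j, j)\<bar> * \<bar>y\<bar> = \<bar>c $ j\<bar> + (\<Sum>l=j..<n. \<bar>U $$ (j, l)\<bar> * \<bar>(y # ys) ! (l - j)\<bar>)"
        unfolding sum.atLeast_Suc_lessThan[OF j(1)] A_def by (simp add: nth)
      also have "E - U $$ (j, j) * y = c $ j - (\<Sum>l=j..<n. U $$ (j, l) * (y # ys) ! (l - j))"
        unfolding sum.atLeast_Suc_lessThan[OF j(1)] E_def by (simp add: nth)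
      finally show ?thesis unfolding True .
    qed
  qed (simp add: len)
qed simp

lemma back_subst_error:
  fixes U :: "real mat" and c :: "real vec"
  assumes F: "fl_arithmetic u F" and U: "\<And>j. j < n \<Longrightarrow> U $$ (j, j) \<noteq> 0"
  defines "y \<equiv> vec_of_list (back_subst_last F U c n n)"
  shows "dim_vec y = n"
    and "j < n \<Longrightarrow> \<bar>c $ j - (\<Sum>l=j..<n. U $$ (j, l) * y $ l)\<bar>
      \<le> ((1 + u) ^ (2 * n) - 1) * (\<bar>c $ j\<bar> + (\<Sum>l=j..<n. \<bar>U $$ (j, l)\<bar> * \<bar>y $ l\<bar>))"
  using back_subst_last_error[OF F U order.refl, where c = c] unfolding y_def by (auto simp: vec_of_list_index)

section \<open>Least squares\<close>

lemma triangular_solve: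
  fixes B :: "nat \<Rightarrow> nat \<Rightarrow> real"
  assumes "\<And>c. c < j \<Longrightarrow> B c c \<noteq> 0" "\<And>a c. c < j \<Longrightarrow> c < a \<Longrightarrow> a < j \<Longrightarrow> B c a = 0"
  shows "\<exists>y. \<forall>a<j. (\<Sum>c<j. y c * B c a) = b a"
  using assms
proof (induction j arbitrary: b)
  case (Suc j)
  define z where "z = b j / B j j"
  obtain y where y: "\<And>a. a < j \<Longrightarrow> (\<Sum>c<j. y c * B c a) = b a - z * B j a"
    using Suc.IH[of "\<lambda>a. b a - z * B j a"] Suc.prems by auto
  have "(\<Sum>c<j. y c * B c j) = 0" using Suc.prems(2)[of _ j] by (intro sum.neutral) auto
  then have "(\<Sum>c<Suc j. (y(j := z)) c * B c a) = b a" if "a < Suc j" for a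
    using that y[of a] Suc.prems(1)[of j] by (cases "a = j") (auto simp: z_def)
  then show ?case by blast
qed simp

text \<open>At the first vanishing diagonal entry, column \<open>j\<close> depends on the earlier
  columns, whose leading triangle is invertible. The coefficient 1 at \<open>j\<close> keeps the
  kernel vector away from 0.\<close>

lemma singular_triangular_kernel:
  fixes B :: "nat \<Rightarrow> nat \<Rightarrow> real"
  assumes up: "\<And>a c. c < n \<Longrightarrow> c < a \<Longrightarrow> a < k \<Longrightarrow> B c a = 0" and j: "j < n" "n \<le> k" "B j j = 0"
  shows "\<exists>y. 1 \<le> nrm n y \<and> (\<forall>a<k. (\<Sum>c<n. y c * B c a) = 0)"
  using j
proof (induction j rule: less_induct)
  case (less j)
  show ?case
  proof (cases "\<exists>i<j. B i i = 0")
    case True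
    then show ?thesis using less by force
  next
    case False
    then obtain y where y: "\<And>a. a < j \<Longrightarrow> (\<Sum>c<j. y c * B c a) = - B j a"
      using triangular_solve[of j B "\<lambda>a. - B j a"] up less.prems by auto
    define z where "z c = (if c < j then y c else if c = j then 1 else 0)" for c
    have "(\<Sum>c<n. z c * B c a) = (\<Sum>c<Suc j. z c * B c a)" for a
      using less.prems by (intro sum.mono_neutral_right) (auto simp: z_def)
    then have *: "(\<Sum>c<n. z c * B c a) = (\<Sum>c<j. y c * B c a) + B j a" for a
      by (simp add: z_def)
    have "(\<Sum>c<n. z c * B c a) = 0" if "a < k" for a
    proof (cases "a < j")
      case True
      then show ?thesis using * y by simp
    next
      case False
      then have "(\<Sum>c<j. y c * B c a) = 0" using up[of _ a] that less.prems by (intro sum.neutral) auto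
      moreover have "B j a = 0" using False up[of j a] that less.prems by (cases "a = j") auto
      ultimately show ?thesis using * by simp
    qed
    moreover have "1 \<le> nrm n z" using abs_le_nrm[of j n z] less.prems by (simp add: z_def)
    ultimately show ?thesis by blast
  qed
qed

lemma ip_lincomb:
  "ip k (\<lambda>a. \<Sum>c<n. y c * f c a) (\<lambda>a. \<Sum>d<n. z d * g d a) = (\<Sum>c<n. \<Sum>d<n. y c * z d * ip k (f c) (g d))"
  by (simp add: ip_sum_left ip_sum_right ip_scale_left ip_scale_right sum_distrib_left mult.assoc)

text \<open>The lower entries of \<open>b'\<close> drop out because the columns of \<open>B\<close>
  vanish there, so back substitution residuals in the first n rows suffice. Near-orthonormality of
  \<open>a\<close> enters twice: a kernel vector of \<open>B\<close> would be almost one of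
  \<open>a\<close>, which excludes zero pivots, and testing the residual with A r bounds
  \<open>r\<close>.\<close>

lemma least_squares_residual:
  fixes a B :: "nat \<Rightarrow> nat \<Rightarrow> real" and b b' r :: "nat \<Rightarrow> real"
  assumes n: "n \<le> k" "1 \<le> n"
    and near: "\<And>y. 9/10 * (nrm n y)\<^sup>2 \<le> (nrm k (\<lambda>i. \<Sum>c<n. y c * a c i))\<^sup>2"
      "\<And>y. (nrm k (\<lambda>i. \<Sum>c<n. y c * a c i))\<^sup>2 \<le> 11/10 * (nrm n y)\<^sup>2"
    and gram: "\<And>c d. c < n \<Longrightarrow> d < n \<Longrightarrow> \<bar>ip k (B c) (B d) - ip k (a c) (a d)\<bar> \<le> \<delta> * (nrm k (a c) * nrm k (a d))"
      "\<And>c. c < n \<Longrightarrow> \<bar>ip k (B c) b' - ip k (a c) b\<bar> \<le> \<delta> * (nrm k (a c) * nrm k b)"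
      "(nrm k b')\<^sup>2 \<le> (1 + \<delta>) * (nrm k b)\<^sup>2"
    and up: "\<And>i c. c < n \<Longrightarrow> c < i \<Longrightarrow> i < k \<Longrightarrow> B c i = 0"
    and \<delta>: "0 \<le> \<delta>" "real n * \<delta> \<le> 1/1000"
  shows "\<And>j. j < n \<Longrightarrow> B j j \<noteq> 0"
    and "(\<And>j. j < n \<Longrightarrow> \<bar>b' j - (\<Sum>l=j..<n. B l j * r l)\<bar> \<le> \<delta> * (\<bar>b' j\<bar> + (\<Sum>l=j..<n. \<bar>B l j\<bar> * \<bar>r l\<bar>)))
      \<Longrightarrow> nrm n r \<le> 6/5 * nrm k b \<and>
        nrm n (\<lambda>c. ip k (a c) (\<lambda>i. b i - (\<Sum>d<n. r d * a d i))) \<le> 6 * real n * \<delta> * nrm k b"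
proof -
  have "1 * \<delta> \<le> real n * \<delta>" using n \<delta> by (intro mult_right_mono) auto
  then have \<delta>1: "\<delta> \<le> 1/1000" using \<delta> by simp
  have sq: "x \<le> y" if "x\<^sup>2 \<le> y\<^sup>2" "0 \<le> y" for x y :: real using that by (rule power2_le_imp_le)
  have na: "nrm k (a c) \<le> 21/20" if "c < n" for c
  proof (rule sq)
    define y where "y d = (if d = c then 1 else 0 :: real)" for d
    have "(\<Sum>d<n. y d * a d i) = a c i" for i
      using that by (simp add: y_def if_distrib[of "\<lambda>z. z * _"] cong: if_cong)
    moreover have "nrm n y = 1"
      using that by (simp add: nrm_eq_sqrt_ip ip_def y_def if_distrib[of "\<lambda>z. z * _"] cong: if_cong)
    ultimately have "(nrm k (a c))\<^sup>2 \<le> 11/10" using near(2)[of y] by simp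
    then show "(nrm k (a c))\<^sup>2 \<le> (21/20)\<^sup>2" by (simp add: power2_eq_square)
  qed simp
  have nB: "nrm k (B c) \<le> 11/10" if "c < n" for c
  proof (rule sq)
    have "(nrm k (B c))\<^sup>2 \<le> (1 + \<delta>) * (nrm k (a c))\<^sup>2"
      using gram(1)[OF that that] unfolding ip_self power2_eq_square by (simp add: algebra_simps)
    also have "\<dots> \<le> (1 + 1/1000) * (21/20)\<^sup>2"
      using \<delta>1 na[OF that] by (intro mult_mono power_mono) auto
    finally show "(nrm k (B c))\<^sup>2 \<le> (11/10)\<^sup>2" by (simp add: power2_eq_square)
  qed simp
  have nb': "nrm k b' \<le> 21/20 * nrm k b"
  proof (rule sq)
    have "(nrm k b')\<^sup>2 \<le> (1 + \<delta>) * (nrm k b)\<^sup>2" by (rule gram)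
    also have "\<dots> \<le> (21/20)\<^sup>2 * (nrm k b)\<^sup>2" using \<delta>1 by (intro mult_right_mono) (auto simp: power2_eq_square)
    finally show "(nrm k b')\<^sup>2 \<le> (21/20 * nrm k b)\<^sup>2" unfolding power_mult_distrib .
  qed simp
  show "B j j \<noteq> 0" if "j < n" for j
  proof
    assume "B j j = 0"
    from singular_triangular_kernel[of n k B, OF up that n(1) this]
    obtain y where y: "1 \<le> nrm n y" "\<And>i. i < k \<Longrightarrow> (\<Sum>c<n. y c * B c i) = 0" by blast
    have "ip k (\<lambda>i. \<Sum>c<n. y c * B c i) (\<lambda>i. \<Sum>c<n. y c * B c i) = 0"
      unfolding ip_def using y(2) by simp
    then have 0: "(\<Sum>c<n. \<Sum>d<n. y c * y d * ip k (B c) (B d)) = 0" unfolding ip_lincomb .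
    define R where "R = (\<Sum>c<n. \<bar>y c\<bar>)"
    have "(nrm k (\<lambda>i. \<Sum>c<n. y c * a c i))\<^sup>2 = (\<Sum>c<n. \<Sum>d<n. y c * y d * (ip k (a c) (a d) - ip k (B c) (B d)))"
      unfolding ip_self[symmetric] ip_lincomb using 0 by (simp add: right_diff_distrib sum_subtractf)
    also have "\<dots> \<le> (\<Sum>c<n. \<Sum>d<n. \<bar>y c\<bar> * \<bar>y d\<bar> * (2 * \<delta>))"
    proof (intro sum_mono)
      fix c d assume cd: "c \<in> {..<n}" "d \<in> {..<n}"
      have "\<bar>ip k (a c) (a d) - ip k (B c) (B d)\<bar> \<le> \<delta> * (nrm k (a c) * nrm k (a d))"
        using gram(1)[of c d] cd by (simp add: abs_minus_commute)
      also have "\<dots> \<le> \<delta> * ((21/20) * (21/20))"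
        using na cd \<delta> by (intro mult_left_mono mult_mono) auto
      also have "\<dots> \<le> 2 * \<delta>" using \<delta> by simp
      finally have *: "\<bar>ip k (a c) (a d) - ip k (B c) (B d)\<bar> \<le> 2 * \<delta>" .
      have "y c * y d * (ip k (a c) (a d) - ip k (B c) (B d)) \<le> \<bar>y c * y d * (ip k (a c) (a d) - ip k (B c) (B d))\<bar>" by simp
      also have "\<dots> = \<bar>y c\<bar> * \<bar>y d\<bar> * \<bar>ip k (a c) (a d) - ip k (B c) (B d)\<bar>" by (simp add: abs_mult)
      also have "\<dots> \<le> \<bar>y c\<bar> * \<bar>y d\<bar> * (2 * \<delta>)" using * by (intro mult_left_mono) auto
      finally show "y c * y d * (ip k (a c) (a d) - ip k (B c) (B d)) \<le> \<bar>y c\<bar> * \<bar>y d\<bar> * (2 * \<delta>)" .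
    qed
    also have "\<dots> = 2 * \<delta> * R\<^sup>2"
      unfolding R_def power2_eq_square sum_product sum_distrib_left sum_distrib_right by (simp add: algebra_simps)
    also have "\<dots> \<le> 2 * \<delta> * (sqrt (real n) * nrm n y)\<^sup>2"
      unfolding R_def using sum_abs_le_nrm[of y n] \<delta> by (intro mult_left_mono power_mono) (auto intro: sum_nonneg)
    also have "\<dots> = 2 * (real n * \<delta>) * (nrm n y)\<^sup>2" by (simp add: power_mult_distrib)
    also have "\<dots> \<le> 2 * (1/1000) * (nrm n y)\<^sup>2" using \<delta> by (intro mult_right_mono mult_left_mono) auto
    finally have "9/10 * (nrm n y)\<^sup>2 \<le> 2 * (1/1000) * (nrm n y)\<^sup>2" using near(1)[of y] by linarith
    moreover have "1 \<le> (nrm n y)\<^sup>2" using y(1) by simp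
    ultimately show False by simp
  qed
  assume bs: "\<And>j. j < n \<Longrightarrow> \<bar>b' j - (\<Sum>l=j..<n. B l j * r l)\<bar> \<le> \<delta> * (\<bar>b' j\<bar> + (\<Sum>l=j..<n. \<bar>B l j\<bar> * \<bar>r l\<bar>))"
  define R where "R = (\<Sum>c<n. \<bar>r c\<bar>)"
  have R0: "0 \<le> R" unfolding R_def by (auto intro: sum_nonneg)
  define \<beta> where "\<beta> = nrm k b"
  have \<beta>0: "0 \<le> \<beta>" unfolding \<beta>_def by simp
  define e where "e j = b' j - (\<Sum>d<n. r d * B d j)" for j
  have ne: "nrm n e \<le> \<delta> * (21/20 * \<beta> + 11/10 * R)"
  proof -
    have "nrm n e \<le> nrm n (\<lambda>j. \<delta> * (\<bar>b' j\<bar> + (\<Sum>l<n. \<bar>r l\<bar> * \<bar>B l j\<bar>)))"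
    proof (rule nrm_mono)
      fix j assume j: "j < n"
      have "(\<Sum>d<n. r d * B d j) = (\<Sum>l=j..<n. B l j * r l)"
        using up[of _ j] j n by (intro sum.mono_neutral_cong_right) auto
      then have "\<bar>e j\<bar> \<le> \<delta> * (\<bar>b' j\<bar> + (\<Sum>l=j..<n. \<bar>B l j\<bar> * \<bar>r l\<bar>))"
        using bs[OF j] unfolding e_def by simp
      also have "(\<Sum>l=j..<n. \<bar>B l j\<bar> * \<bar>r l\<bar>) = (\<Sum>l=j..<n. \<bar>r l\<bar> * \<bar>B l j\<bar>)" by (simp add: mult.commute)
      also have "\<dots> \<le> (\<Sum>l<n. \<bar>r l\<bar> * \<bar>B l j\<bar>)" by (intro sum_mono2) auto
      finally show "\<bar>e j\<bar> \<le> \<delta> * (\<bar>b' j\<bar> + (\<Sum>l<n. \<bar>r l\<bar> * \<bar>B l j\<bar>))" using \<delta> by (simp add: mult_left_mono)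
    qed
    also have "\<dots> \<le> \<delta> * (nrm n b' + nrm n (\<lambda>j. \<Sum>l<n. \<bar>r l\<bar> * \<bar>B l j\<bar>))"
      unfolding nrm_scale using nrm_add_le[of n "\<lambda>j. \<bar>b' j\<bar>" "\<lambda>j. \<Sum>l<n. \<bar>r l\<bar> * \<bar>B l j\<bar>"] \<delta>
      by (simp add: nrm_abs mult_left_mono)
    also have "nrm n (\<lambda>j. \<Sum>l<n. \<bar>r l\<bar> * \<bar>B l j\<bar>) \<le> 11/10 * (\<Sum>l<n. \<bar>\<bar>r l\<bar>\<bar>)"
    proof (rule nrm_lincomb_le)
      show "nrm n (\<lambda>j. \<bar>B c j\<bar>) \<le> 11/10" if "c < n" for c
        unfolding nrm_abs using nB[OF that] nrm_prefix_le[OF n(1), of "B c"] by linarith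
    qed
    also have "nrm n b' \<le> 21/20 * \<beta>" unfolding \<beta>_def using nb' nrm_prefix_le[OF n(1), of b'] by linarith
    finally show ?thesis using \<delta> unfolding R_def by (simp add: mult_left_mono)
  qed
  define f where "f c = ip k (a c) (\<lambda>i. b i - (\<Sum>d<n. r d * a d i))" for c
  have f_bound: "\<bar>f c\<bar> \<le> 5/2 * \<delta> * (\<beta> + R)" if c: "c < n" for c
  proof -
    have f: "f c = ip k (a c) b - (\<Sum>d<n. r d * ip k (a c) (a d))"
      unfolding f_def by (simp add: ip_diff_right ip_sum_right ip_scale_right)
    define h where "h = ip k (B c) b' - (\<Sum>d<n. r d * ip k (B c) (B d))"
    have "h = ip k (B c) e" unfolding h_def e_def by (simp add: ip_diff_right ip_sum_right ip_scale_right)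
    also have "\<dots> = ip n (B c) e"
      unfolding ip_def using up[OF c] n c by (intro sum.mono_neutral_right) auto
    also have "\<bar>\<dots>\<bar> \<le> nrm n (B c) * nrm n e" by (rule ip_abs_le)
    also have "\<dots> \<le> 11/10 * (\<delta> * (21/20 * \<beta> + 11/10 * R))"
      using ne nB[OF c] nrm_prefix_le[OF n(1), of "B c"] by (intro mult_mono) auto
    finally have h: "\<bar>h\<bar> \<le> 11/10 * (\<delta> * (21/20 * \<beta> + 11/10 * R))" .
    have "\<bar>f c - h\<bar> = \<bar>(ip k (a c) b - ip k (B c) b') + (\<Sum>d<n. r d * (ip k (B c) (B d) - ip k (a c) (a d)))\<bar>"
      unfolding f h_def by (simp add: right_diff_distrib sum_subtractf)
    also have "\<dots> \<le> \<bar>ip k (a c) b - ip k (B c) b'\<bar> + (\<Sum>d<n. \<bar>r d * (ip k (B c) (B d) - ip k (a c) (a d))\<bar>)"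
      by (rule order.trans[OF abs_triangle_ineq]) (simp add: sum_abs)
    also have "(\<Sum>d<n. \<bar>r d * (ip k (B c) (B d) - ip k (a c) (a d))\<bar>) \<le> (\<Sum>d<n. \<bar>r d\<bar> * (\<delta> * (21/20 * (21/20))))"
    proof (rule sum_mono)
      fix d assume "d \<in> {..<n}"
      then have "\<bar>ip k (B c) (B d) - ip k (a c) (a d)\<bar> \<le> \<delta> * (nrm k (a c) * nrm k (a d))"
        using gram(1)[OF c] by simp
      also have "\<dots> \<le> \<delta> * (21/20 * (21/20))"
        using na c \<open>d \<in> _\<close> \<delta> by (intro mult_left_mono mult_mono) auto
      finally show "\<bar>r d * (ip k (B c) (B d) - ip k (a c) (a d))\<bar> \<le> \<bar>r d\<bar> * (\<delta> * (21/20 * (21/20)))"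
        unfolding abs_mult by (rule mult_left_mono) simp
    qed
    also have "\<dots> = R * (\<delta> * (21/20 * (21/20)))" unfolding R_def sum_distrib_right ..
    also have "\<bar>ip k (a c) b - ip k (B c) b'\<bar> \<le> \<delta> * (21/20 * \<beta>)"
    proof -
      have "\<delta> * (nrm k (a c) * nrm k b) \<le> \<delta> * (21/20 * \<beta>)"
        unfolding \<beta>_def using na[OF c] \<delta> by (intro mult_left_mono mult_right_mono) auto
      then show ?thesis using gram(2)[OF c] by (simp add: abs_minus_commute)
    qed
    finally have "\<bar>f c\<bar> \<le> 11/10 * (\<delta> * (21/20 * \<beta> + 11/10 * R)) + (\<delta> * (21/20 * \<beta>) + R * (\<delta> * (21/20 * (21/20))))"
      using h by linarith
    \<comment> \<open>The coefficients are 11/10 * 21/20 + 21/20 = 2.205 for \<beta> and (11/10)^2 +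
      (21/20)^2 = 2.3125 for R.\<close>
    also have "\<dots> \<le> 5/2 * \<delta> * (\<beta> + R)"
    proof -
      have "0 \<le> \<delta> * \<beta>" "0 \<le> \<delta> * R" using \<delta> \<beta>0 R0 by auto
      then show ?thesis by (simp add: algebra_simps)
    qed
    finally show ?thesis .
  qed
  define \<rho> where "\<rho> = nrm n r"
  have \<rho>0: "0 \<le> \<rho>" unfolding \<rho>_def by simp
  have s: "1 \<le> sqrt (real n)" "sqrt (real n) * sqrt (real n) = real n" using n by auto
  have nf: "nrm n f \<le> 5/2 * (real n * \<delta>) * (\<beta> + \<rho>)"
  proof -
    have "nrm n f \<le> sqrt (real n) * (5/2 * \<delta> * (\<beta> + R))" by (rule nrm_le_sqrt_mult) (rule f_bound)
    also have "\<dots> \<le> sqrt (real n) * (5/2 * \<delta> * (sqrt (real n) * \<beta> + sqrt (real n) * \<rho>))"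
    proof (intro mult_left_mono add_mono)
      show "\<beta> \<le> sqrt (real n) * \<beta>" using s \<beta>0 by (simp add: mult_le_cancel_right1)
      show "R \<le> sqrt (real n) * \<rho>" unfolding R_def \<rho>_def by (rule sum_abs_le_nrm)
    qed (use \<delta> in auto)
    also have "\<dots> = 5/2 * ((sqrt (real n) * sqrt (real n)) * \<delta>) * (\<beta> + \<rho>)" by (simp add: algebra_simps)
    finally show ?thesis unfolding s .
  qed
  have "5/2 * (real n * \<delta>) * (\<beta> + \<rho>) \<le> 5/2 * (1/1000) * (\<beta> + \<rho>)"
    using \<delta> \<beta>0 \<rho>0 by (intro mult_right_mono mult_left_mono) auto
  then have nf': "nrm n f \<le> 1/400 * (\<beta> + \<rho>)" using nf by linarith
  have \<rho>: "\<rho> \<le> 6/5 * \<beta>"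
  proof (cases "\<rho> = 0")
    case False
    define Ar where "Ar i = (\<Sum>d<n. r d * a d i)" for i
    have nAr: "nrm k Ar \<le> 21/20 * \<rho>"
    proof (rule sq)
      have "(nrm k Ar)\<^sup>2 \<le> 11/10 * \<rho>\<^sup>2" unfolding Ar_def \<rho>_def by (rule near)
      also have "\<dots> \<le> (21/20)\<^sup>2 * \<rho>\<^sup>2" by (intro mult_right_mono) (auto simp: power2_eq_square)
      finally show "(nrm k Ar)\<^sup>2 \<le> (21/20 * \<rho>)\<^sup>2" unfolding power_mult_distrib .
    qed (use \<rho>0 in auto)
    \<comment> \<open>Pairing the normal-equation residual \<open>f\<close> with \<open>r\<close>
      gives \<parallel>A r\<parallel>^2 = <A r, b> - <r, f>. With \<parallel>f\<parallel> \<le>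
      (\<beta> + \<rho>) / 400 this becomes 359 \<rho> \<le> 421 \<beta>.\<close>
    have "ip n r f = ip k Ar (\<lambda>i. b i - Ar i)"
      unfolding Ar_def ip_sum_left ip_scale_left ip_def[of n] f_def ..
    also have "\<dots> = ip k Ar b - (nrm k Ar)\<^sup>2" by (simp add: ip_diff_right ip_self)
    finally have "(nrm k Ar)\<^sup>2 = ip k Ar b - ip n r f" by simp
    also have "\<dots> \<le> nrm k Ar * \<beta> + \<rho> * nrm n f"
      using ip_abs_le[of k Ar b] ip_abs_le[of n r f] unfolding \<beta>_def \<rho>_def by linarith
    also have "\<dots> \<le> 21/20 * \<rho> * \<beta> + \<rho> * (1/400 * (\<beta> + \<rho>))"
      using nAr nf' \<rho>0 \<beta>0 by (intro add_mono mult_right_mono mult_left_mono) auto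
    also have "\<dots> = \<rho> * (21/20 * \<beta> + 1/400 * (\<beta> + \<rho>))" by (simp add: field_simps)
    finally have "9/10 * \<rho>\<^sup>2 \<le> \<rho> * (21/20 * \<beta> + 1/400 * (\<beta> + \<rho>))"
      using near(1)[of r] unfolding Ar_def[symmetric] \<rho>_def[symmetric] by linarith
    then have "\<rho> * (9/10 * \<rho>) \<le> \<rho> * (21/20 * \<beta> + 1/400 * (\<beta> + \<rho>))" by (simp add: power2_eq_square)
    then have "9/10 * \<rho> \<le> 21/20 * \<beta> + 1/400 * (\<beta> + \<rho>)" using False \<rho>0 by simp
    then have "359 * \<rho> \<le> 421 * \<beta>" by (simp add: field_simps)
    then show ?thesis using \<beta>0 by simp
  qed (use \<beta>0 in simp)
  have "nrm n f \<le> 5/2 * (real n * \<delta>) * (\<beta> + 6/5 * \<beta>)"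
    using nf \<rho> \<delta> by (meson add_left_mono mult_left_mono mult_nonneg_nonneg of_nat_0_le_iff order.trans zero_le_divide_iff zero_le_numeral)
  moreover have "0 \<le> real n * \<delta> * \<beta>" using \<delta> \<beta>0 by simp
  ultimately have "nrm n f \<le> 6 * real n * \<delta> * \<beta>" by (simp add: algebra_simps)
  then show "nrm n r \<le> 6/5 * nrm k b \<and>
        nrm n (\<lambda>c. ip k (a c) (\<lambda>i. b i - (\<Sum>d<n. r d * a d i))) \<le> 6 * real n * \<delta> * nrm k b"
    using \<rho> unfolding \<rho>_def \<beta>_def f_def by simp
qed


text \<open>1000 k n u is 2 (k n) (500 u), the linearized growth over n elimination steps. The same
  \<delta> also dominates the back substitution error 4 n u.\<close>

lemma fl_least_squares_residual:
  assumes A: "A \<in> carrier_mat k n" and b: "dim_vec b = k" and n: "n \<le> k" "1 \<le> n"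
    and F: "fl_arithmetic u F" "real k * u \<le> 1/10^4"
    and \<delta>: "1000 * real k * real n * u \<le> \<delta>" "real n * \<delta> \<le> 1/1000"
    and near: "\<And>y. 9/10 * (nrm n y)\<^sup>2 \<le> (nrm k (\<lambda>i. \<Sum>c<n. y c * colf A c i))\<^sup>2"
      "\<And>y. (nrm k (\<lambda>i. \<Sum>c<n. y c * colf A c i))\<^sup>2 \<le> 11/10 * (nrm n y)\<^sup>2"
    and r_def: "r = fl_least_squares solver F A b"
  shows "nrm n (\<lambda>i. r $ i) \<le> 6/5 * nrm k (\<lambda>i. b $ i)"
    and "nrm n (\<lambda>c. ip k (colf A c) (\<lambda>i. b $ i - (\<Sum>d<n. r $ d * colf A d i))) \<le> 6 * real n * \<delta> * nrm k (\<lambda>i. b $ i)"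
proof -
  have u: "0 \<le> u" by (rule fl_arithmeticD(6)[OF F(1)])
  have "0 \<le> 1000 * real k * real n * u" using u by simp
  then have \<delta>0: "0 \<le> \<delta>" using \<delta> by linarith
  have "1 * \<delta> \<le> real n * \<delta>" using n \<delta>0 by (intro mult_right_mono) auto
  then have \<delta>1: "\<delta> \<le> 1/1000" using \<delta> by simp
  define M where "M = mat_of_cols k (cols A @ [b])"
  have M: "M \<in> carrier_mat k (n + 1)" unfolding M_def using A by auto
  have len: "length (cols A) = n" using A by simp
  have Ma: "colf M c i = colf A c i" if "c < n" "i < k" for c i
    unfolding M_def colf_def using that A len by (simp add: mat_of_cols_index nth_append)
  have Mb: "colf M n i = b $ i" if "i < k" for i
    unfolding M_def colf_def using that len by (simp add: mat_of_cols_index nth_append)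
  define B where "B = fold (qr_step solver F) [0..<n] M"
  have B: "B \<in> carrier_mat k (n + 1)" "upper_upto n B" "gram_close k (n + 1) ((1 + 500 * u) ^ (k * n) - 1) M B"
    using qr_fold_gram[OF M n(1) _ F, of solver] unfolding B_def by auto
  have "(1 + 500 * u) ^ (k * n) - 1 \<le> 2 * real (k * n) * (500 * u)"
    by (rule one_plus_power_le) (use u \<delta> \<delta>1 in auto)
  also have "\<dots> \<le> \<delta>" using \<delta>(1) by (simp add: mult.assoc)
  finally have gc: "gram_close k (n + 1) \<delta> M B" using gram_close_mono[OF B(3)] by blast
  have ipa: "ip k (colf M c) (colf M d) = ip k (colf A c) (colf A d)" if "c < n" "d < n" for c d
    by (rule ip_cong) (use that Ma in auto)
  have na: "nrm k (colf M c) = nrm k (colf A c)" if "c < n" for c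
    by (rule nrm_cong) (use that Ma in auto)
  have ipb: "ip k (colf M c) (colf M n) = ip k (colf A c) (\<lambda>i. b $ i)" if "c < n" for c
    by (rule ip_cong) (use that Ma Mb in auto)
  have nb: "nrm k (colf M n) = nrm k (\<lambda>i. b $ i)"
    by (rule nrm_cong) (use Mb in auto)
  have gram: "\<bar>ip k (colf B c) (colf B d) - ip k (colf A c) (colf A d)\<bar> \<le> \<delta> * (nrm k (colf A c) * nrm k (colf A d))"
    if "c < n" "d < n" for c d
    using gc[unfolded gram_close_def, rule_format, of c d] that by (simp add: ipa na)
  have gramb: "\<bar>ip k (colf B c) (colf B n) - ip k (colf A c) (\<lambda>i. b $ i)\<bar> \<le> \<delta> * (nrm k (colf A c) * nrm k (\<lambda>i. b $ i))"
    if "c < n" for c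
    using gc[unfolded gram_close_def, rule_format, of c n] that by (simp add: ipb na nb)
  have grambb: "(nrm k (colf B n))\<^sup>2 \<le> (1 + \<delta>) * (nrm k (\<lambda>i. b $ i))\<^sup>2"
    using gc[unfolded gram_close_def, rule_format, of n n]
    by (simp add: ip_self nb power2_eq_square[symmetric] algebra_simps)
  have up: "colf B c i = 0" if "c < n" "c < i" "i < k" for i c
    using B(1,2) that unfolding upper_upto_def colf_def by auto
  note res = least_squares_residual[of n k "colf A" "colf B" \<delta> "colf B n" "\<lambda>i. b $ i",
      OF n near gram gramb grambb up \<delta>0 \<delta>(2)]
  have diag: "B $$ (j, j) \<noteq> 0" if "j < n" for j
  proof -
    have "colf B j j \<noteq> 0" by (rule res(1)) (use that in auto)
    then show ?thesis by (simp add: colf_def)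
  qed
  have r: "r = vec_of_list (back_subst_last F B (col B n) n n)"
    unfolding r_def fl_least_squares_def Let_def B_def M_def using A by simp
  have bs\<delta>: "(1 + u) ^ (2 * n) - 1 \<le> \<delta>"
  proof -
    have "real (2 * n) * u \<le> 1000 * real k * real n * u" using n u by (intro mult_right_mono) auto
    then have *: "2 * (real (2 * n) * u) \<le> 2 * (1000 * real k * real n * u)" "real (2 * n) * u \<le> \<delta>" using \<delta> by linarith+
    have "(1 + u) ^ (2 * n) - 1 \<le> 2 * real (2 * n) * u"
      by (rule one_plus_power_le) (use u * \<delta>1 in auto)
    also have "\<dots> = 4 * real n * u" by simp
    also have "\<dots> \<le> 1000 * real k * real n * u" using n u by (intro mult_right_mono) auto
    finally show ?thesis using \<delta> by linarith
  qed
  have bsub: "\<bar>col B n $ j - (\<Sum>l=j..<n. B $$ (j, l) * r $ l)\<bar>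
      \<le> ((1 + u) ^ (2 * n) - 1) * (\<bar>col B n $ j\<bar> + (\<Sum>l=j..<n. \<bar>B $$ (j, l)\<bar> * \<bar>r $ l\<bar>))" if "j < n" for j
    unfolding r by (rule back_subst_error(2)[OF F(1) _ that]) (rule diag)
  have bs: "\<bar>colf B n j - (\<Sum>l=j..<n. colf B l j * r $ l)\<bar> \<le> \<delta> * (\<bar>colf B n j\<bar> + (\<Sum>l=j..<n. \<bar>colf B l j\<bar> * \<bar>r $ l\<bar>))"
    if j: "j < n" for j
  proof -
    have c: "col B n $ j = colf B n j" using B(1) j n unfolding colf_def by auto
    have "((1 + u) ^ (2 * n) - 1) * (\<bar>colf B n j\<bar> + (\<Sum>l=j..<n. \<bar>colf B l j\<bar> * \<bar>r $ l\<bar>))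
        \<le> \<delta> * (\<bar>colf B n j\<bar> + (\<Sum>l=j..<n. \<bar>colf B l j\<bar> * \<bar>r $ l\<bar>))"
      by (rule mult_right_mono) (use bs\<delta> in \<open>auto intro!: add_nonneg_nonneg sum_nonneg\<close>)
    then show ?thesis using bsub[OF j] unfolding c unfolding colf_def by linarith
  qed
  have "nrm n (\<lambda>i. r $ i) \<le> 6/5 * nrm k (\<lambda>i. b $ i) \<and>
    nrm n (\<lambda>c. ip k (colf A c) (\<lambda>i. b $ i - (\<Sum>d<n. r $ d * colf A d i))) \<le> 6 * real n * \<delta> * nrm k (\<lambda>i. b $ i)"
    by (rule res(2)[where r = "\<lambda>i. r $ i"]) (use bs in auto)
  then show "nrm n (\<lambda>i. r $ i) \<le> 6/5 * nrm k (\<lambda>i. b $ i)"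
    and "nrm n (\<lambda>c. ip k (colf A c) (\<lambda>i. b $ i - (\<Sum>d<n. r $ d * colf A d i))) \<le> 6 * real n * \<delta> * nrm k (\<lambda>i. b $ i)"
    by auto
qed

section \<open>Perturbed embeddings\<close>

definition apply_rows :: "nat \<Rightarrow> (nat \<Rightarrow> nat \<Rightarrow> real) \<Rightarrow> (nat \<Rightarrow> real) \<Rightarrow> nat \<Rightarrow> real" where
  "apply_rows n A x a = (\<Sum>j<n. A a j * x j)"

lemma apply_rows_cong: "(\<And>j. j < n \<Longrightarrow> x j = y j) \<Longrightarrow> apply_rows n A x = apply_rows n A y"
  unfolding apply_rows_def by (intro ext sum.cong) auto

lemma apply_rows_add: "apply_rows n A (\<lambda>j. x j + y j) a = apply_rows n A x a + apply_rows n A y a"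
  unfolding apply_rows_def by (simp add: distrib_left sum.distrib)

lemma apply_rows_diff: "apply_rows n A (\<lambda>j. x j - y j) a = apply_rows n A x a - apply_rows n A y a"
  unfolding apply_rows_def by (simp add: right_diff_distrib sum_subtractf)

lemma apply_rows_scale: "apply_rows n A (\<lambda>j. c * x j) a = c * apply_rows n A x a"
  unfolding apply_rows_def by (simp add: sum_distrib_left mult.left_commute)

lemma apply_rows_sum: "apply_rows n A (\<lambda>j. \<Sum>c\<in>C. x c j) a = (\<Sum>c\<in>C. apply_rows n A (x c) a)"
  unfolding apply_rows_def by (simp add: sum_distrib_left sum.swap[of _ C])

lemma apply_rows_lincomb: "apply_rows n A (\<lambda>j. \<Sum>c<i. z c * x c j) a = (\<Sum>c<i. z c * apply_rows n A (x c) a)"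
  by (simp add: apply_rows_sum apply_rows_scale)

text \<open>Of the six cross terms the linear ones contribute 2 + 9/4, the quadratic ones little
  since \<tau> \<le> 6/1000: at most 4.3 \<tau> in all. Passing from the norms of \<open>X\<close>,
  \<open>Y\<close> to those of \<open>x\<close>, \<open>y\<close> costs (1 - \<tau>)^2, which the
  larger factor 6 absorbs together with its effect on \<epsilon>.\<close>

lemma embedding_perturb:
  fixes X Y E E' :: "nat \<Rightarrow> real"
  defines "x \<equiv> \<lambda>j. X j + E j" and "y \<equiv> \<lambda>j. Y j + E' j"
  assumes emb: "\<bar>ip n X Y - ip k TX TY\<bar> \<le> \<epsilon> * nrm n X * nrm n Y"
    and TX: "nrm k TX \<le> 9/8 * nrm n X" and TY: "nrm k TY \<le> 9/8 * nrm n Y"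
    and E: "nrm n E \<le> \<tau> * nrm n X" "nrm k TE \<le> \<tau> * nrm n X"
    and E': "nrm n E' \<le> \<tau> * nrm n Y" "nrm k TE' \<le> \<tau> * nrm n Y"
    and \<epsilon>: "0 \<le> \<epsilon>" "\<epsilon> \<le> 1/4" and \<tau>: "0 \<le> \<tau>" "\<tau> \<le> 6/1000"
  shows "\<bar>ip n x y - ip k (\<lambda>a. TX a + TE a) (\<lambda>a. TY a + TE' a)\<bar> \<le> (\<epsilon> + 6 * \<tau>) * nrm n x * nrm n y"
proof -
  define P where "P = nrm n X * nrm n Y"
  have P: "0 \<le> P" unfolding P_def by simp
  have "\<bar>ip n X E'\<bar> \<le> nrm n X * (\<tau> * nrm n Y)" "\<bar>ip n E Y\<bar> \<le> (\<tau> * nrm n X) * nrm n Y"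
    "\<bar>ip n E E'\<bar> \<le> (\<tau> * nrm n X) * (\<tau> * nrm n Y)" "\<bar>ip k TX TE'\<bar> \<le> (9/8 * nrm n X) * (\<tau> * nrm n Y)"
    "\<bar>ip k TE TY\<bar> \<le> (\<tau> * nrm n X) * (9/8 * nrm n Y)" "\<bar>ip k TE TE'\<bar> \<le> (\<tau> * nrm n X) * (\<tau> * nrm n Y)"
    by (rule ip_abs_le_mult[OF order.refl E'(1)] ip_abs_le_mult[OF E(1) order.refl] ip_abs_le_mult[OF E(1) E'(1)]
        ip_abs_le_mult[OF TX E'(2)] ip_abs_le_mult[OF E(2) TY] ip_abs_le_mult[OF E(2) E'(2)])+
  then have b: "\<bar>ip n X E'\<bar> \<le> \<tau> * P" "\<bar>ip n E Y\<bar> \<le> \<tau> * P" "\<bar>ip n E E'\<bar> \<le> \<tau> * \<tau> * P"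
    "\<bar>ip k TX TE'\<bar> \<le> 9/8 * (\<tau> * P)" "\<bar>ip k TE TY\<bar> \<le> 9/8 * (\<tau> * P)" "\<bar>ip k TE TE'\<bar> \<le> \<tau> * \<tau> * P"
    unfolding P_def by (simp_all add: mult_ac)
  have tt: "\<tau> * \<tau> * P \<le> 6/1000 * (\<tau> * P)"
    using mult_right_mono[OF \<tau>(2), of "\<tau> * P"] \<tau> P by (simp add: mult.assoc)
  have \<tau>P: "0 \<le> \<tau> * P" using \<tau> P by simp
  have "ip n x y - ip k (\<lambda>a. TX a + TE a) (\<lambda>a. TY a + TE' a) = (ip n X Y - ip k TX TY)
      + (ip n X E' + ip n E Y + ip n E E') - (ip k TX TE' + ip k TE TY + ip k TE TE')"
    unfolding x_def y_def ip_add_left ip_add_right by simp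
  moreover have "\<bar>ip n X Y - ip k TX TY\<bar> \<le> \<epsilon> * P" using emb unfolding P_def by (simp add: mult.assoc)
  ultimately have 1: "\<bar>ip n x y - ip k (\<lambda>a. TX a + TE a) (\<lambda>a. TY a + TE' a)\<bar> \<le> \<epsilon> * P + 43/10 * (\<tau> * P)"
    using b tt \<tau>P unfolding abs_le_iff by (intro conjI) linarith+
  have "nrm n X \<le> nrm n x + nrm n E" "nrm n Y \<le> nrm n y + nrm n E'"
    using nrm_diff_le[of n x E] nrm_diff_le[of n y E'] unfolding x_def y_def by simp_all
  then have "nrm n X * (1 - \<tau>) \<le> nrm n x" "nrm n Y * (1 - \<tau>) \<le> nrm n y"
    using E E' by (simp_all add: algebra_simps)
  then have "(nrm n X * (1 - \<tau>)) * (nrm n Y * (1 - \<tau>)) \<le> nrm n x * nrm n y"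
    using \<tau> by (intro mult_mono) auto
  then have 2: "P * (1 - \<tau>)\<^sup>2 \<le> nrm n x * nrm n y" unfolding P_def by (simp add: power2_eq_square algebra_simps)
  have "\<epsilon> + 43/10 * \<tau> \<le> (\<epsilon> + 6 * \<tau>) * (1 - \<tau>)\<^sup>2"
  proof -
    have "(1 - \<tau>)\<^sup>2 = 1 - 2 * \<tau> + \<tau>\<^sup>2" by (simp add: power2_eq_square algebra_simps)
    then have "1 - 2 * \<tau> \<le> (1 - \<tau>)\<^sup>2" by simp
    then have "(\<epsilon> + 6 * \<tau>) * (1 - 2 * \<tau>) \<le> (\<epsilon> + 6 * \<tau>) * (1 - \<tau>)\<^sup>2"
      using \<epsilon> \<tau> by (intro mult_left_mono) auto
    moreover have "(\<epsilon> + 6 * \<tau>) * (1 - 2 * \<tau>) = \<epsilon> + 6 * \<tau> - 2 * (\<epsilon> * \<tau>) - 12 * (\<tau> * \<tau>)" by (simp add: algebra_simps)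
    moreover have "\<epsilon> * \<tau> \<le> 1/4 * \<tau>" "\<tau> * \<tau> \<le> 6/1000 * \<tau>" by (rule mult_right_mono; fact)+
    ultimately show ?thesis using \<tau> by linarith
  qed
  then have "(\<epsilon> + 43/10 * \<tau>) * P \<le> ((\<epsilon> + 6 * \<tau>) * (1 - \<tau>)\<^sup>2) * P" using P by (rule mult_right_mono)
  also have "\<dots> = (\<epsilon> + 6 * \<tau>) * (P * (1 - \<tau>)\<^sup>2)" by simp
  also have "\<dots> \<le> (\<epsilon> + 6 * \<tau>) * (nrm n x * nrm n y)" using 2 \<epsilon> \<tau> by (intro mult_left_mono) auto
  finally show ?thesis using 1 by (simp add: algebra_simps)
qed

text \<open>Columns are added one at a time, so only inner products with earlier columns matter,
  which is what Gram-Schmidt controls. Column \<open>j\<close> adds a cross term of at most 2 |y j|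
  \<theta> \<parallel>y\<parallel>, and summing these costs sqrt i.\<close>

lemma near_orthonormal:
  fixes s :: "nat \<Rightarrow> nat \<Rightarrow> real"
  assumes "\<And>c. c < i \<Longrightarrow> \<bar>(nrm k (s c))\<^sup>2 - 1\<bar> \<le> \<alpha>"
    and "\<And>c. c < i \<Longrightarrow> nrm c (\<lambda>d. ip k (s d) (s c)) \<le> \<theta>"
    and "0 \<le> \<theta>"
  shows "\<bar>(nrm k (\<lambda>a. \<Sum>c<i. y c * s c a))\<^sup>2 - (nrm i y)\<^sup>2\<bar> \<le> (\<alpha> + 2 * \<theta> * sqrt (real i)) * (nrm i y)\<^sup>2"
proof -
  define Y where "Y = nrm i y"
  have step: "\<bar>(nrm k (\<lambda>a. \<Sum>c<j. y c * s c a))\<^sup>2 - (nrm j y)\<^sup>2\<bar> \<le> \<alpha> * (nrm j y)\<^sup>2 + 2 * \<theta> * Y * (\<Sum>c<j. \<bar>y c\<bar>)" if "j \<le> i" for j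
    using that
  proof (induction j)
    case 0
    then show ?case by (simp add: ip_self[symmetric] ip_def)
  next
    case (Suc j)
    define S where "S a = (\<Sum>c<j. y c * s c a)" for a
    have n: "(nrm (Suc j) y)\<^sup>2 = (nrm j y)\<^sup>2 + (y j)\<^sup>2" unfolding ip_self[symmetric] ip_def by (simp add: power2_eq_square)
    have "(nrm k (\<lambda>a. \<Sum>c<Suc j. y c * s c a))\<^sup>2 = ip k (\<lambda>a. S a + y j * s j a) (\<lambda>a. S a + y j * s j a)"
      unfolding ip_self[symmetric] S_def by simp
    also have "\<dots> = (nrm k S)\<^sup>2 + 2 * (y j * ip k S (s j)) + (y j)\<^sup>2 * (nrm k (s j))\<^sup>2"
      unfolding ip_add_left ip_add_right ip_scale_left ip_scale_right ip_commute[of k "s j" S]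
      by (simp add: ip_self power2_eq_square)
    finally have eq: "(nrm k (\<lambda>a. \<Sum>c<Suc j. y c * s c a))\<^sup>2 - (nrm (Suc j) y)\<^sup>2
      = ((nrm k S)\<^sup>2 - (nrm j y)\<^sup>2) + 2 * (y j * ip k S (s j)) + (y j)\<^sup>2 * ((nrm k (s j))\<^sup>2 - 1)"
      unfolding n by (simp add: algebra_simps)
    have "ip k S (s j) = ip j y (\<lambda>d. ip k (s d) (s j))"
      unfolding S_def ip_sum_left ip_scale_left ip_def[of j] ..
    also have "\<bar>\<dots>\<bar> \<le> nrm j y * nrm j (\<lambda>d. ip k (s d) (s j))" by (rule ip_abs_le)
    also have "\<dots> \<le> Y * \<theta>"
      unfolding Y_def using Suc.prems assms by (intro mult_mono nrm_prefix_le) auto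
    finally have "\<bar>y j\<bar> * \<bar>ip k S (s j)\<bar> \<le> \<bar>y j\<bar> * (Y * \<theta>)" by (intro mult_left_mono) auto
    then have a: "\<bar>y j * ip k S (s j)\<bar> \<le> \<bar>y j\<bar> * (Y * \<theta>)" by (simp add: abs_mult)
    have "(y j)\<^sup>2 * \<bar>(nrm k (s j))\<^sup>2 - 1\<bar> \<le> (y j)\<^sup>2 * \<alpha>" using assms(1)[of j] Suc.prems by (intro mult_left_mono) auto
    then have b: "\<bar>(y j)\<^sup>2 * ((nrm k (s j))\<^sup>2 - 1)\<bar> \<le> (y j)\<^sup>2 * \<alpha>" by (simp add: abs_mult)
    have c: "\<bar>(nrm k S)\<^sup>2 - (nrm j y)\<^sup>2\<bar> \<le> \<alpha> * (nrm j y)\<^sup>2 + 2 * \<theta> * Y * (\<Sum>c<j. \<bar>y c\<bar>)"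
      using Suc unfolding S_def by simp
    have "\<bar>(nrm k (\<lambda>a. \<Sum>c<Suc j. y c * s c a))\<^sup>2 - (nrm (Suc j) y)\<^sup>2\<bar>
      \<le> (\<alpha> * (nrm j y)\<^sup>2 + 2 * \<theta> * Y * (\<Sum>c<j. \<bar>y c\<bar>)) + 2 * (\<bar>y j\<bar> * (Y * \<theta>)) + (y j)\<^sup>2 * \<alpha>"
      unfolding eq using a b c by linarith
    also have "\<dots> = \<alpha> * (nrm (Suc j) y)\<^sup>2 + 2 * \<theta> * Y * (\<Sum>c<Suc j. \<bar>y c\<bar>)"
      unfolding n by (simp add: algebra_simps)
    finally show ?case .
  qed
  have "2 * \<theta> * Y * (\<Sum>c<i. \<bar>y c\<bar>) \<le> 2 * \<theta> * Y * (sqrt (real i) * Y)"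
    unfolding Y_def using assms(3) by (intro mult_left_mono sum_abs_le_nrm) auto
  then show ?thesis using step[of i] unfolding Y_def by (simp add: algebra_simps power2_eq_square)
qed

text \<open>A matrix and its transpose have the same norm: for y = S^T e one has
  \<parallel>y\<parallel>^2 = <S y, e> \<le> 21/20 \<parallel>y\<parallel>
  \<parallel>e\<parallel>.\<close>

lemma nrm_transpose_le:
  fixes s :: "nat \<Rightarrow> nat \<Rightarrow> real"
  assumes "\<And>y. (nrm k (\<lambda>a. \<Sum>c<i. y c * s c a))\<^sup>2 \<le> 11/10 * (nrm i y)\<^sup>2"
  shows "nrm i (\<lambda>c. ip k (s c) e) \<le> 21/20 * nrm k e"
proof -
  define y where "y c = ip k (s c) e" for c
  have "(nrm k (\<lambda>a. \<Sum>c<i. y c * s c a))\<^sup>2 \<le> 11/10 * (nrm i y)\<^sup>2" by (rule assms)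
  also have "\<dots> \<le> (21/20)\<^sup>2 * (nrm i y)\<^sup>2" by (intro mult_right_mono) (auto simp: power2_eq_square)
  finally have "nrm k (\<lambda>a. \<Sum>c<i. y c * s c a) \<le> 21/20 * nrm i y"
    unfolding power_mult_distrib[symmetric] by (rule power2_le_imp_le) simp
  moreover have "(nrm i y)\<^sup>2 = ip k (\<lambda>a. \<Sum>c<i. y c * s c a) e"
    unfolding ip_self[symmetric] ip_sum_left ip_scale_left ip_def[of i] y_def ..
  ultimately have "(nrm i y)\<^sup>2 \<le> 21/20 * nrm i y * nrm k e"
    using ip_abs_le[of k "\<lambda>a. \<Sum>c<i. y c * s c a" e] mult_right_mono[of "nrm k (\<lambda>a. \<Sum>c<i. y c * s c a)" "21/20 * nrm i y" "nrm k e"]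
    by simp
  then have "nrm i y * nrm i y \<le> nrm i y * (21/20 * nrm k e)" by (simp add: power2_eq_square algebra_simps)
  then have "nrm i y \<le> 21/20 * nrm k e" using nrm_nonneg[of i y] by (cases "nrm i y = 0") auto
  then show ?thesis unfolding y_def .
qed

section \<open>The perturbed Gram-Schmidt recurrence\<close>

text \<open>The stability argument freed of floating point. \<open>u\<close> is the coarse roundoff,
  and errors of the fine arithmetic appear as fractions of it; \<sigma> and M stand for the extreme
  singular values of W. \<open>ls\<close> is conditional because the solver analysis presupposes
  near-orthonormal sketches; the induction supplies that premise column by column.\<close>

locale perturbed_rgs =
  fixes m n k :: nat and w q q' p s s' r :: "nat \<Rightarrow> nat \<Rightarrow> real" and \<rho> :: "nat \<Rightarrow> real"
    and A :: "nat \<Rightarrow> nat \<Rightarrow> real" and u \<epsilon> \<sigma> M :: real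
  assumes m: "1 \<le> m" and u0: "0 \<le> u" and \<sigma>: "0 < \<sigma>" and \<sigma>M: "\<sigma> \<le> M"
    and u_le: "u * (real m)\<^sup>2 * M \<le> \<sigma> / 1000"
    and \<epsilon>: "0 \<le> \<epsilon>" "\<epsilon> \<le> 1/4"
    and w_le: "\<And>i. i < m \<Longrightarrow> nrm n (w i) \<le> M"
    and w_ge: "\<And>x. \<sigma> * nrm m x \<le> nrm n (\<lambda>j. \<Sum>c<m. x c * w c j)"
    and emb: "\<And>x y. \<bar>ip n (\<lambda>j. \<Sum>c<m. x c * w c j) (\<lambda>j. \<Sum>c<m. y c * w c j)
      - ip k (apply_rows n A (\<lambda>j. \<Sum>c<m. x c * w c j)) (apply_rows n A (\<lambda>j. \<Sum>c<m. y c * w c j))\<bar>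
      \<le> \<epsilon> * nrm n (\<lambda>j. \<Sum>c<m. x c * w c j) * nrm n (\<lambda>j. \<Sum>c<m. y c * w c j)"
    and p: "\<And>i. i < m \<Longrightarrow> nrm k (\<lambda>a. p i a - apply_rows n A (w i) a) \<le> u / 40 * nrm n (w i)"
    and ls: "\<And>i. i < m \<Longrightarrow>
      (\<And>y. 9/10 * (nrm i y)\<^sup>2 \<le> (nrm k (\<lambda>a. \<Sum>c<i. y c * s c a))\<^sup>2) \<Longrightarrow>
      (\<And>y. (nrm k (\<lambda>a. \<Sum>c<i. y c * s c a))\<^sup>2 \<le> 11/10 * (nrm i y)\<^sup>2) \<Longrightarrow>
      nrm i (r i) \<le> 6/5 * nrm k (p i) \<and>
      nrm i (\<lambda>c. ip k (s c) (\<lambda>a. p i a - (\<Sum>d<i. r i d * s d a))) \<le> u * sqrt m * nrm k (p i)"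
    and q': "\<And>i. i < m \<Longrightarrow> nrm n (\<lambda>j. q' i j - (w i j - (\<Sum>c<i. r i c * q c j)))
        \<le> 5/4 * u * (nrm n (w i) + real m * (\<Sum>c<i. \<bar>r i c\<bar> * nrm n (q c)))"
    and Aq': "\<And>i. i < m \<Longrightarrow> nrm k (apply_rows n A (\<lambda>j. q' i j - (w i j - (\<Sum>c<i. r i c * q c j))))
        \<le> 5/4 * u * (nrm n (w i) + real m * (\<Sum>c<i. \<bar>r i c\<bar> * nrm n (q c)))"
    and s': "\<And>i. i < m \<Longrightarrow> nrm k (\<lambda>a. s' i a - apply_rows n A (q' i) a) \<le> u / 40 * nrm n (q' i)"
    and \<rho>: "\<And>i. i < m \<Longrightarrow> \<bar>\<rho> i - nrm k (s' i)\<bar> \<le> u / 100 * nrm k (s' i)"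
    and s: "\<And>i. i < m \<Longrightarrow> 0 < \<rho> i \<Longrightarrow> nrm k (\<lambda>a. s i a - s' i a / \<rho> i) \<le> u / 100 * (nrm k (s' i) / \<rho> i)"
    and q: "\<And>i. i < m \<Longrightarrow> 0 < \<rho> i \<Longrightarrow> nrm n (\<lambda>j. q i j - q' i j / \<rho> i) \<le> u / 100 * (nrm n (q' i) / \<rho> i)"
    and Aq: "\<And>i. i < m \<Longrightarrow> 0 < \<rho> i \<Longrightarrow> nrm k (apply_rows n A (\<lambda>j. q i j - q' i j / \<rho> i)) \<le> u / 50 * (nrm n (q' i) / \<rho> i)"
begin

abbreviation T :: "(nat \<Rightarrow> real) \<Rightarrow> nat \<Rightarrow> real" where "T \<equiv> apply_rows n A"

section \<open>Error quantities and consequences of the bound on the roundoff\<close>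

definition F :: "nat \<Rightarrow> nat \<Rightarrow> real" where
  "F c j = \<rho> c * q c j + (\<Sum>d<c. r c d * q d j) - w c j"

text \<open>\<Phi> is to bound the columns of \<open>F\<close> and their sketches, and \<tau> =
  \<Phi> sqrt m / \<sigma> the size of F a relative to W a. \<theta> is to bound the inner products
  of a sketch with the earlier ones; its division by \<sigma> comes from normalizing by \<rho> \<ge>
  \<sigma> / 2.\<close>

definition \<Phi> :: real where "\<Phi> = 6 * (u * (real m * sqrt m)) * M"
definition \<tau> :: real where "\<tau> = 6 * u * (real m)\<^sup>2 * M / \<sigma>"
definition \<theta> :: real where "\<theta> = 20 * (u * (real m * sqrt m)) * M / \<sigma>"

lemma M0: "0 < M" using \<sigma> \<sigma>M by simp

lemma sqrt_m: "1 \<le> sqrt (real m)" "sqrt (real m) * sqrt (real m) = real m"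
  using m by auto

lemma u_m2_le: "u * (real m)\<^sup>2 \<le> 1/1000"
proof -
  have "u * (real m)\<^sup>2 * \<sigma> \<le> u * (real m)\<^sup>2 * M" using u0 \<sigma>M by (intro mult_left_mono) auto
  then have "u * (real m)\<^sup>2 * \<sigma> \<le> 1/1000 * \<sigma>" using u_le by simp
  then show ?thesis using \<sigma> by (simp only: mult_le_cancel_right_pos)
qed

lemma sqrt_m_le: "sqrt (real m) \<le> real m"
  using mult_left_mono[OF sqrt_m(1), of "sqrt (real m)"] sqrt_m by simp

lemma u_mm_le: "u * (real m * sqrt m) \<le> 1/1000"
proof -
  have "u * (real m * sqrt m) \<le> u * (real m)\<^sup>2"
    using u0 sqrt_m_le by (simp add: power2_eq_square mult_left_mono)
  then show ?thesis using u_m2_le by linarith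
qed

lemma one_le_mm: "1 \<le> real m * sqrt m" "sqrt m \<le> real m * sqrt m"
proof -
  show "sqrt m \<le> real m * sqrt m" using m mult_right_mono[of 1 "real m" "sqrt (real m)"] by simp
  then show "1 \<le> real m * sqrt m" using sqrt_m by linarith
qed

lemma u_le_mm: "u \<le> u * (real m * sqrt m)" "u * sqrt m \<le> u * (real m * sqrt m)"
  using mult_left_mono[OF one_le_mm(1) u0] mult_left_mono[OF one_le_mm(2) u0] by simp_all

lemma u_small: "u \<le> 1/1000" "u * real m \<le> 1/1000"
proof -
  show "u \<le> 1/1000" using u_le_mm u_mm_le by linarith
  have "u * (real m * 1) \<le> u * (real m * sqrt m)" using u0 sqrt_m by (intro mult_left_mono) auto
  then show "u * real m \<le> 1/1000" using u_mm_le by simp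
qed

lemma \<tau>: "0 \<le> \<tau>" "\<tau> \<le> 6/1000"
proof -
  show "0 \<le> \<tau>" unfolding \<tau>_def using u0 \<sigma> M0 by simp
  have "\<tau> = 6 * (u * (real m)\<^sup>2 * M) / \<sigma>" unfolding \<tau>_def by simp
  also have "\<dots> \<le> 6 * (\<sigma> / 1000) / \<sigma>" using u_le \<sigma> by (intro divide_right_mono mult_left_mono) auto
  finally show "\<tau> \<le> 6/1000" using \<sigma> by simp
qed

lemma \<theta>: "0 \<le> \<theta>" "2 * \<theta> * sqrt m \<le> 4/100"
proof -
  show "0 \<le> \<theta>" unfolding \<theta>_def using u0 \<sigma> M0 by simp
  have "2 * \<theta> * sqrt m = 40 * (u * (real m * (sqrt m * sqrt m)) * M) / \<sigma>" unfolding \<theta>_def by simp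
  also have "\<dots> = 40 * (u * (real m)\<^sup>2 * M) / \<sigma>" unfolding sqrt_m power2_eq_square ..
  also have "\<dots> \<le> 40 * (\<sigma> / 1000) / \<sigma>" using u_le \<sigma> by (intro divide_right_mono mult_left_mono) auto
  finally show "2 * \<theta> * sqrt m \<le> 4/100" using \<sigma> by simp
qed

text \<open>Padding the coefficients by zeros derives statements about the first \<open>i\<close>
  columns from the assumptions on all \<open>m\<close>.\<close>

lemma w_pad:
  assumes "i \<le> m"
  shows "(\<lambda>j. \<Sum>c<i. a c * w c j) = (\<lambda>j. \<Sum>c<m. (if c < i then a c else 0) * w c j)"
  using assms by (intro ext sum.mono_neutral_cong_left) auto

lemma w_ge_prefix:
  assumes "i \<le> m"
  shows "\<sigma> * nrm i a \<le> nrm n (\<lambda>j. \<Sum>c<i. a c * w c j)"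
proof -
  have "nrm i a = nrm i (\<lambda>c. if c < i then a c else 0)" by (rule nrm_cong) simp
  also have "\<dots> \<le> nrm m (\<lambda>c. if c < i then a c else 0)" by (rule nrm_prefix_le[OF assms])
  finally have "\<sigma> * nrm i a \<le> \<sigma> * nrm m (\<lambda>c. if c < i then a c else 0)" using \<sigma> by (intro mult_left_mono) auto
  also have "\<dots> \<le> nrm n (\<lambda>j. \<Sum>c<i. a c * w c j)" unfolding w_pad[OF assms] by (rule w_ge)
  finally show ?thesis .
qed

lemma emb_prefix:
  assumes "i \<le> m"
  shows "\<bar>ip n (\<lambda>j. \<Sum>c<i. a c * w c j) (\<lambda>j. \<Sum>c<i. b c * w c j)
      - ip k (T (\<lambda>j. \<Sum>c<i. a c * w c j)) (T (\<lambda>j. \<Sum>c<i. b c * w c j))\<bar>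
      \<le> \<epsilon> * nrm n (\<lambda>j. \<Sum>c<i. a c * w c j) * nrm n (\<lambda>j. \<Sum>c<i. b c * w c j)"
  unfolding w_pad[OF assms] by (rule emb)

lemma T_w_le:
  assumes "i \<le> m"
  shows "nrm k (T (\<lambda>j. \<Sum>c<i. a c * w c j)) \<le> 9/8 * nrm n (\<lambda>j. \<Sum>c<i. a c * w c j)"
proof (rule power2_le_imp_le)
  define X where "X = (\<lambda>j. \<Sum>c<i. a c * w c j)"
  have "\<bar>(nrm n X)\<^sup>2 - (nrm k (T X))\<^sup>2\<bar> \<le> \<epsilon> * (nrm n X)\<^sup>2"
    using emb_prefix[OF assms, of a a] unfolding X_def[symmetric] ip_self by (simp add: power2_eq_square mult.assoc)
  also have "\<dots> \<le> 1/4 * (nrm n X)\<^sup>2" using \<epsilon> by (intro mult_right_mono) auto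
  finally have "(nrm k (T X))\<^sup>2 \<le> 5/4 * (nrm n X)\<^sup>2" by linarith
  also have "\<dots> \<le> (9/8)\<^sup>2 * (nrm n X)\<^sup>2" by (intro mult_right_mono) (auto simp: power2_eq_square)
  finally show "(nrm k (T X))\<^sup>2 \<le> (9/8 * nrm n X)\<^sup>2" unfolding power_mult_distrib .
qed simp

lemma T_w_single_le:
  assumes "i < m"
  shows "nrm k (T (w i)) \<le> 9/8 * nrm n (w i)"
proof -
  have "(\<lambda>j. \<Sum>c<m. (if c = i then 1 else 0) * w c j) = w i"
    using assms by (auto simp: if_distrib[of "\<lambda>z. z * _"] cong: if_cong)
  then show ?thesis using T_w_le[OF order.refl, of "\<lambda>c. if c = i then 1 else 0"] by simp
qed

context
  fixes i :: nat and G :: "nat \<Rightarrow> nat \<Rightarrow> real"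
  assumes i: "i \<le> m" and G: "\<And>c. c < i \<Longrightarrow> nrm n (G c) \<le> \<Phi>" and TG: "\<And>c. c < i \<Longrightarrow> nrm k (T (G c)) \<le> \<Phi>"
begin

text \<open>\<open>G\<close> is arbitrary because two perturbations occur: \<open>F\<close> itself
  for the final embedding, and \<open>F\<close> with its last column replaced by the projection
  error for a vector that is not yet normalized.\<close>

lemma perturbation_le:
  "nrm n (\<lambda>j. \<Sum>c<i. a c * G c j) \<le> \<tau> * nrm n (\<lambda>j. \<Sum>c<i. a c * w c j)"
  "nrm k (T (\<lambda>j. \<Sum>c<i. a c * G c j)) \<le> \<tau> * nrm n (\<lambda>j. \<Sum>c<i. a c * w c j)"
proof -
  have \<Phi>0: "0 \<le> \<Phi>" unfolding \<Phi>_def using u0 M0 by simp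
  have "sqrt (real i) \<le> sqrt (real m)" using i by simp
  then have "sqrt (real i) * nrm i a \<le> sqrt (real m) * nrm i a" by (intro mult_right_mono) auto
  then have "\<Phi> * (\<Sum>c<i. \<bar>a c\<bar>) \<le> \<Phi> * (sqrt (real m) * nrm i a)"
    using sum_abs_le_nrm[of a i] \<Phi>0 by (intro mult_left_mono) auto
  also have "\<dots> = 6 * (u * (real m * (sqrt m * sqrt m))) * M * nrm i a" unfolding \<Phi>_def by simp
  also have "\<dots> = 6 * u * (real m)\<^sup>2 * M * nrm i a" unfolding sqrt_m power2_eq_square by simp
  also have "\<dots> = \<tau> * (\<sigma> * nrm i a)" unfolding \<tau>_def using \<sigma> by simp
  also have "\<dots> \<le> \<tau> * nrm n (\<lambda>j. \<Sum>c<i. a c * w c j)" using w_ge_prefix[OF i] \<tau> by (intro mult_left_mono) auto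
  finally have *: "\<Phi> * (\<Sum>c<i. \<bar>a c\<bar>) \<le> \<tau> * nrm n (\<lambda>j. \<Sum>c<i. a c * w c j)" .
  show "nrm n (\<lambda>j. \<Sum>c<i. a c * G c j) \<le> \<tau> * nrm n (\<lambda>j. \<Sum>c<i. a c * w c j)"
    by (rule order.trans[OF nrm_lincomb_le *]) (rule G)
  have "T (\<lambda>j. \<Sum>c<i. a c * G c j) = (\<lambda>b. \<Sum>c<i. a c * T (G c) b)" by (intro ext apply_rows_lincomb)
  then show "nrm k (T (\<lambda>j. \<Sum>c<i. a c * G c j)) \<le> \<tau> * nrm n (\<lambda>j. \<Sum>c<i. a c * w c j)"
    using order.trans[OF nrm_lincomb_le *, of k "\<lambda>c. T (G c)"] TG by simp
qed

lemma perturbed_embedding: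
  fixes a b :: "nat \<Rightarrow> real"
  defines "x \<equiv> \<lambda>j. \<Sum>c<i. a c * (w c j + G c j)" and "y \<equiv> \<lambda>j. \<Sum>c<i. b c * (w c j + G c j)"
  shows "\<bar>ip n x y - ip k (T x) (T y)\<bar> \<le> (\<epsilon> + 6 * \<tau>) * nrm n x * nrm n y"
proof -
  have x: "x = (\<lambda>j. (\<Sum>c<i. a c * w c j) + (\<Sum>c<i. a c * G c j))"
    unfolding x_def by (simp add: distrib_left sum.distrib)
  have y: "y = (\<lambda>j. (\<Sum>c<i. b c * w c j) + (\<Sum>c<i. b c * G c j))"
    unfolding y_def by (simp add: distrib_left sum.distrib)
  have T: "T (\<lambda>j. X j + Y j) = (\<lambda>a. T X a + T Y a)" for X Y by (intro ext apply_rows_add)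
  show ?thesis unfolding x y T
    by (rule embedding_perturb[OF emb_prefix[OF i] T_w_le[OF i] T_w_le[OF i]
          perturbation_le perturbation_le \<epsilon> \<tau>])
qed

text \<open>As \<epsilon> + 6 \<tau> < 3/10, the squared norms of a vector and of its sketch agree
  up to 30 percent. The lower singular value bound of W survives up to the factor 1 -
  \<tau>.\<close>

lemma perturbed_norm:
  fixes a :: "nat \<Rightarrow> real"
  defines "x \<equiv> \<lambda>j. \<Sum>c<i. a c * (w c j + G c j)"
  shows "nrm n x \<le> 5/4 * nrm k (T x)" "nrm k (T x) \<le> 6/5 * nrm n x" "99/100 * (\<sigma> * nrm i a) \<le> nrm n x"
proof -
  have "\<bar>(nrm n x)\<^sup>2 - (nrm k (T x))\<^sup>2\<bar> \<le> (\<epsilon> + 6 * \<tau>) * (nrm n x)\<^sup>2"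
    using perturbed_embedding[of a a] unfolding x_def[symmetric] ip_self by (simp add: power2_eq_square mult.assoc)
  also have "\<dots> \<le> 3/10 * (nrm n x)\<^sup>2" using \<epsilon> \<tau> by (intro mult_right_mono) auto
  finally have *: "7/10 * (nrm n x)\<^sup>2 \<le> (nrm k (T x))\<^sup>2" "(nrm k (T x))\<^sup>2 \<le> 13/10 * (nrm n x)\<^sup>2"
    unfolding abs_le_iff by linarith+
  show "nrm n x \<le> 5/4 * nrm k (T x)"
  proof (rule power2_le_imp_le)
    have "(5/4)\<^sup>2 * (nrm k (T x))\<^sup>2 \<ge> (5/4)\<^sup>2 * (7/10 * (nrm n x)\<^sup>2)" using * by (intro mult_left_mono) auto
    then show "(nrm n x)\<^sup>2 \<le> (5/4 * nrm k (T x))\<^sup>2" unfolding power_mult_distrib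
      by (rule order.trans[rotated]) (simp add: power2_eq_square)
  qed simp
  show "nrm k (T x) \<le> 6/5 * nrm n x"
  proof (rule power2_le_imp_le)
    show "(nrm k (T x))\<^sup>2 \<le> (6/5 * nrm n x)\<^sup>2" unfolding power_mult_distrib
      by (rule order.trans[OF *(2)]) (simp add: power2_eq_square)
  qed simp
  have "x = (\<lambda>j. (\<Sum>c<i. a c * w c j) + (\<Sum>c<i. a c * G c j))"
    unfolding x_def by (simp add: distrib_left sum.distrib)
  then have "nrm n (\<lambda>j. \<Sum>c<i. a c * w c j) \<le> nrm n x + nrm n (\<lambda>j. \<Sum>c<i. a c * G c j)"
    using nrm_diff_le[of n x "\<lambda>j. \<Sum>c<i. a c * G c j"] by simp
  also have "\<dots> \<le> nrm n x + \<tau> * nrm n (\<lambda>j. \<Sum>c<i. a c * w c j)" using perturbation_le by simp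
  also have "\<dots> \<le> nrm n x + 6/1000 * nrm n (\<lambda>j. \<Sum>c<i. a c * w c j)"
    using \<tau> by (intro add_left_mono mult_right_mono) auto
  finally have "99/100 * nrm n (\<lambda>j. \<Sum>c<i. a c * w c j) \<le> nrm n x"
    using nrm_nonneg[of n "\<lambda>j. \<Sum>c<i. a c * w c j"] by linarith
  then show "99/100 * (\<sigma> * nrm i a) \<le> nrm n x" using w_ge_prefix[OF i, of a] by linarith
qed

end

section \<open>Induction over the columns\<close>

text \<open>The clauses only hold jointly: near-orthonormal sketches bound the coefficients, these
  and the bounds on \<open>q\<close> bound \<open>F\<close>, and the bounds on \<open>F\<close> give
  the embedding that bounds the next \<open>q\<close>.\<close>

definition invar :: "nat \<Rightarrow> bool" where
  "invar i \<longleftrightarrow> (\<forall>c<i. 0 < \<rho> c \<and> nrm n (q c) \<le> 2 \<and> nrm k (\<lambda>a. s c a - T (q c) a) \<le> u / 10 \<and>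
     \<bar>(nrm k (s c))\<^sup>2 - 1\<bar> \<le> 1/100 \<and> nrm c (\<lambda>d. ip k (s d) (s c)) \<le> \<theta> \<and>
     nrm n (F c) \<le> \<Phi> \<and> nrm k (T (F c)) \<le> \<Phi>)"

text \<open>\<open>QR = W + F\<close> with \<open>R\<close> invertible, so the columns of \<open>Q\<close> and of \<open>W + F\<close> span the same space.\<close>

lemma span_q:
  assumes "\<And>c. c < i \<Longrightarrow> \<rho> c \<noteq> 0"
  shows "\<exists>a. \<forall>j. (\<Sum>c<i. z c * q c j) = (\<Sum>c<i. a c * (w c j + F c j))"
  using assms
proof (induction i arbitrary: z)
  case (Suc i)
  define t where "t = z i / \<rho> i"
  obtain a where a: "\<And>j. (\<Sum>c<i. (z c - t * r i c) * q c j) = (\<Sum>c<i. a c * (w c j + F c j))"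
    using Suc.IH[of "\<lambda>c. z c - t * r i c"] Suc.prems by auto
  have "(\<Sum>c<Suc i. z c * q c j) = (\<Sum>c<Suc i. (a(i := t)) c * (w c j + F c j))" for j
  proof -
    have z: "z i = t * \<rho> i" unfolding t_def using Suc.prems[of i] by simp
    have "(\<Sum>c<Suc i. z c * q c j) = (\<Sum>c<i. (z c - t * r i c) * q c j) + t * ((\<Sum>c<i. r i c * q c j) + \<rho> i * q i j)"
      by (simp add: z left_diff_distrib sum_subtractf sum_distrib_left distrib_left mult.assoc)
    also have "(\<Sum>c<i. r i c * q c j) + \<rho> i * q i j = w i j + F i j" unfolding F_def by simp
    finally show ?thesis by (simp add: a)
  qed
  then show ?case by blast
qed simp

lemma invar_near_orthonormal:
  assumes "invar i" "i \<le> m"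
  shows "9/10 * (nrm i y)\<^sup>2 \<le> (nrm k (\<lambda>a. \<Sum>c<i. y c * s c a))\<^sup>2"
    and "(nrm k (\<lambda>a. \<Sum>c<i. y c * s c a))\<^sup>2 \<le> 11/10 * (nrm i y)\<^sup>2"
proof -
  have "2 * \<theta> * sqrt (real i) \<le> 2 * \<theta> * sqrt (real m)"
    using assms(2) \<theta> by (intro mult_left_mono) auto
  then have "1/100 + 2 * \<theta> * sqrt (real i) \<le> 1/10" using \<theta> by linarith
  then have "(1/100 + 2 * \<theta> * sqrt (real i)) * (nrm i y)\<^sup>2 \<le> 1/10 * (nrm i y)\<^sup>2"
    by (rule mult_right_mono) simp
  moreover have "\<bar>(nrm k (\<lambda>a. \<Sum>c<i. y c * s c a))\<^sup>2 - (nrm i y)\<^sup>2\<bar> \<le> (1/100 + 2 * \<theta> * sqrt (real i)) * (nrm i y)\<^sup>2"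
    by (rule near_orthonormal) (use assms \<theta> in \<open>auto simp: invar_def\<close>)
  ultimately show "9/10 * (nrm i y)\<^sup>2 \<le> (nrm k (\<lambda>a. \<Sum>c<i. y c * s c a))\<^sup>2"
    and "(nrm k (\<lambda>a. \<Sum>c<i. y c * s c a))\<^sup>2 \<le> 11/10 * (nrm i y)\<^sup>2"
    unfolding abs_le_iff by linarith+
qed

lemma invar_step:
  assumes inv: "invar i" and i: "i < m"
  shows "invar (Suc i)"
proof -
  define \<omega> where "\<omega> = nrm n (w i)"
  have \<omega>: "0 \<le> \<omega>" "\<omega> \<le> M" unfolding \<omega>_def using w_le[OF i] by auto
  \<comment> \<open>The unit in which all errors of this column are measured; 6 L \<le> \<Phi>
    because \<omega> \<le> M.\<close>
  define L where "L = u * (real m * sqrt m) * \<omega>"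
  have L: "u * \<omega> \<le> L" "u * sqrt m * \<omega> \<le> L" "0 \<le> L" "L \<le> 1/1000 * \<omega>"
    unfolding L_def using mult_right_mono[OF u_le_mm(1) \<omega>(1)] mult_right_mono[OF u_le_mm(2) \<omega>(1)]
      mult_right_mono[OF u_mm_le \<omega>(1)] \<omega> u0 by simp_all
  have nq: "nrm n (q c) \<le> 2" and sTq: "nrm k (\<lambda>a. s c a - T (q c) a) \<le> u / 10"
    and F1: "nrm n (F c) \<le> \<Phi>" and F2: "nrm k (T (F c)) \<le> \<Phi>" and \<rho>0: "\<rho> c \<noteq> 0" if "c < i" for c
    using inv that unfolding invar_def by fastforce+
  have np: "nrm k (p i) \<le> 113/100 * \<omega>"
  proof -
    have "nrm k (p i) \<le> nrm k (T (w i)) + u / 40 * \<omega>"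
      using nrm_le_add_diff[of k "p i" "T (w i)"] p[OF i] unfolding \<omega>_def by linarith
    moreover have "u / 40 * \<omega> \<le> 1/1000 * \<omega>" using u_small u0 \<omega> by (intro mult_right_mono) auto
    ultimately show ?thesis using T_w_single_le[OF i] \<omega> unfolding \<omega>_def by linarith
  qed
  note near = invar_near_orthonormal[OF inv less_imp_le[OF i]]
  from ls[OF i near] have r1: "nrm i (r i) \<le> 6/5 * nrm k (p i)"
    and f1: "nrm i (\<lambda>c. ip k (s c) (\<lambda>a. p i a - (\<Sum>d<i. r i d * s d a))) \<le> u * sqrt m * nrm k (p i)" by auto
  have nr: "nrm i (r i) \<le> 14/10 * \<omega>" using r1 np \<omega> by linarith
  have f: "nrm i (\<lambda>c. ip k (s c) (\<lambda>a. p i a - (\<Sum>d<i. r i d * s d a))) \<le> 113/100 * L"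
  proof -
    have "u * sqrt m * nrm k (p i) \<le> u * sqrt m * (113/100 * \<omega>)" using np u0 by (intro mult_left_mono) auto
    then show ?thesis using f1 L by linarith
  qed
  define R where "R = (\<Sum>c<i. \<bar>r i c\<bar>)"
  have R: "R \<le> 14/10 * (sqrt m * \<omega>)"
  proof -
    have "R \<le> sqrt (real i) * nrm i (r i)" unfolding R_def by (rule sum_abs_le_nrm)
    also have "\<dots> \<le> sqrt m * (14/10 * \<omega>)" using nr i by (intro mult_mono) auto
    finally show ?thesis by simp
  qed
  define Qr where "Qr = (\<lambda>j. \<Sum>c<i. r i c * q c j)"
  have nQr: "nrm n Qr \<le> 28/10 * (sqrt m * \<omega>)"
    using nrm_lincomb_le[of i n q 2 "r i"] nq R unfolding Qr_def R_def by fastforce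
  \<comment> \<open>475/100 = 5/4 * (1 + 28/10), from \<parallel>q c\<parallel> \<le> 2 and \<Sum>
    |r i c| \<le> 14/10 sqrt m \<omega>. The order m^(3/2) arises here: one factor m from the
    assumptions and sqrt m from the sum.\<close>
  have bnd: "5/4 * u * (nrm n (w i) + real m * (\<Sum>c<i. \<bar>r i c\<bar> * nrm n (q c))) \<le> 475/100 * L"
  proof -
    have "(\<Sum>c<i. \<bar>r i c\<bar> * nrm n (q c)) \<le> (\<Sum>c<i. \<bar>r i c\<bar> * 2)"
      using nq by (intro sum_mono mult_left_mono) auto
    also have "\<dots> = 2 * R" unfolding R_def by (simp add: sum_distrib_left mult.commute)
    also have "\<dots> \<le> 28/10 * (sqrt m * \<omega>)" using R by linarith
    finally have "real m * (\<Sum>c<i. \<bar>r i c\<bar> * nrm n (q c)) \<le> real m * (28/10 * (sqrt m * \<omega>))"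
      by (intro mult_left_mono) auto
    then have "u * (nrm n (w i) + real m * (\<Sum>c<i. \<bar>r i c\<bar> * nrm n (q c))) \<le> u * (\<omega> + real m * (28/10 * (sqrt m * \<omega>)))"
      unfolding \<omega>_def using u0 by (intro mult_left_mono) auto
    also have "\<dots> = u * \<omega> + 28/10 * L" unfolding L_def by (simp add: algebra_simps)
    finally show ?thesis using L by linarith
  qed
  define \<Delta> where "\<Delta> = (\<lambda>j. q' i j - (w i j - Qr j))"
  have \<Delta>: "nrm n \<Delta> \<le> 475/100 * L" "nrm k (T \<Delta>) \<le> 475/100 * L"
    using q'[OF i] Aq'[OF i] bnd unfolding \<Delta>_def Qr_def by linarith+
  have L\<Phi>: "6 * L \<le> \<Phi>"
  proof -
    have "u * (real m * sqrt m) * \<omega> \<le> u * (real m * sqrt m) * M" using \<omega> u0 by (intro mult_left_mono) auto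
    then show ?thesis unfolding L_def \<Phi>_def by simp
  qed
  have q'_eq: "q' i j = w i j - Qr j + \<Delta> j" for j unfolding \<Delta>_def by simp
  have nq': "nrm n (q' i) \<le> 4 * (sqrt m * \<omega>)"
  proof -
    have "nrm n (q' i) \<le> nrm n (\<lambda>j. w i j - Qr j) + nrm n \<Delta>"
      using nrm_add_le[of n "\<lambda>j. w i j - Qr j" \<Delta>] unfolding q'_eq[symmetric] .
    moreover have "nrm n (\<lambda>j. w i j - Qr j) \<le> \<omega> + nrm n Qr"
      unfolding \<omega>_def by (rule nrm_diff_le)
    moreover have "1 * \<omega> \<le> sqrt m * \<omega>" using sqrt_m \<omega> by (intro mult_right_mono) auto
    ultimately show ?thesis using nQr \<Delta> L by linarith
  qed
  text \<open>The vector before normalization is \<open>(W + G) a\<close> with last coefficient 1, so it is not small.\<close>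
  define G where "G = F(i := \<Delta>)"
  have G: "nrm n (G c) \<le> \<Phi>" "nrm k (T (G c)) \<le> \<Phi>" if "c < Suc i" for c
    using that F1[of c] F2[of c] \<Delta> L\<Phi> L unfolding G_def by (auto simp: less_Suc_eq)
  obtain a where a: "\<And>j. Qr j = (\<Sum>c<i. a c * (w c j + F c j))"
    using span_q[of i "r i"] \<rho>0 unfolding Qr_def by blast
  define b where "b c = (if c = i then 1 else - a c)" for c
  have q'b: "q' i = (\<lambda>j. \<Sum>c<Suc i. b c * (w c j + G c j))"
    unfolding q'_eq a b_def G_def by (auto simp: sum_negf)
  have "1 \<le> nrm (Suc i) b" using abs_le_nrm[of i "Suc i" b] by (simp add: b_def)
  have "Suc i \<le> m" using i by simp
  have pn1: "nrm n (q' i) \<le> 5/4 * nrm k (T (q' i))" and pn3: "99/100 * (\<sigma> * nrm (Suc i) b) \<le> nrm n (q' i)"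
    unfolding q'b by (rule perturbed_norm[OF \<open>Suc i \<le> m\<close>]; use G in auto)+
  have "\<sigma> * 1 \<le> \<sigma> * nrm (Suc i) b" using \<open>1 \<le> nrm (Suc i) b\<close> \<sigma> by (intro mult_left_mono) auto
  then have q'_ge: "99/100 * \<sigma> \<le> nrm n (q' i)" using pn3 by linarith
  define \<xi> where "\<xi> = nrm n (q' i)"
  have \<xi>0: "0 \<le> \<xi>" unfolding \<xi>_def by simp
  have u\<xi>: "u * \<xi> \<le> 1/1000 * \<xi>" using u_small \<xi>0 by (intro mult_right_mono) auto
  define \<eta> where "\<eta> = nrm k (s' i)"
  have \<eta>0: "0 \<le> \<eta>" unfolding \<eta>_def by simp
  have u\<eta>: "u * \<eta> \<le> 1/1000 * \<eta>" using u_small \<eta>0 by (intro mult_right_mono) auto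
  have s'T: "nrm k (\<lambda>a. s' i a - T (q' i) a) \<le> u / 40 * \<xi>" unfolding \<xi>_def by (rule s'[OF i])
  \<comment> \<open>The sketch of q' has norm at least 4/5 \<parallel>q'\<parallel>; the rest is
    lost to rounding. This carries the lower bound on q' over to the normalizer \<rho>.\<close>
  have \<eta>\<xi>: "78/100 * \<xi> \<le> \<eta>"
  proof -
    have "nrm k (T (q' i)) \<le> \<eta> + nrm k (\<lambda>a. T (q' i) a - s' i a)" unfolding \<eta>_def by (rule nrm_le_add_diff)
    then have "nrm k (T (q' i)) \<le> \<eta> + u / 40 * \<xi>" using s'T by (subst (asm) nrm_diff_commute) linarith
    then show ?thesis using pn1 u\<xi> \<xi>0 unfolding \<xi>_def[symmetric] by linarith
  qed
  have \<rho>\<eta>: "\<bar>\<rho> i - \<eta>\<bar> \<le> u / 100 * \<eta>" unfolding \<eta>_def by (rule \<rho>[OF i])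
  have \<eta>\<sigma>: "3/4 * \<sigma> \<le> \<eta>" using \<eta>\<xi> q'_ge \<sigma> unfolding \<xi>_def by linarith
  have \<rho>_ge: "99/100 * \<eta> \<le> \<rho> i" using \<rho>\<eta> u\<eta> \<eta>0 unfolding abs_le_iff by linarith
  then have \<rho>_pos: "0 < \<rho> i" and \<rho>\<sigma>: "\<sigma> / 2 \<le> \<rho> i" using \<eta>\<sigma> \<sigma> by linarith+
  define \<zeta> where "\<zeta> = \<eta> / \<rho> i"
  have \<zeta>: "\<bar>\<zeta> - 1\<bar> \<le> u / 50"
  proof -
    have "\<zeta> - 1 = (\<eta> - \<rho> i) / \<rho> i" unfolding \<zeta>_def using \<rho>_pos by (simp add: field_simps)
    then have "\<bar>\<zeta> - 1\<bar> = \<bar>\<rho> i - \<eta>\<bar> / \<rho> i" using \<rho>_pos by (simp add: abs_divide abs_minus_commute)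
    also have "\<dots> \<le> (u / 50 * \<rho> i) / \<rho> i"
    proof (intro divide_right_mono)
      have "u * (99/100 * \<eta>) \<le> u * \<rho> i" using \<rho>_ge u0 by (intro mult_left_mono) auto
      moreover have "0 \<le> u * \<eta>" using u0 \<eta>0 by simp
      ultimately show "\<bar>\<rho> i - \<eta>\<bar> \<le> u / 50 * \<rho> i" using \<rho>\<eta> by linarith
    qed (use \<rho>_pos in auto)
    finally show ?thesis using \<rho>_pos by simp
  qed
  have \<zeta>_le: "\<zeta> \<le> 101/100" using \<zeta> u_small unfolding abs_le_iff by linarith
  \<comment> \<open>\<chi> is the norm of the new column before the rounding of its division. Since
    it is the sketch that is normalized, only 13/10 is available instead of 1.\<close>
  define \<chi> where "\<chi> = \<xi> / \<rho> i"
  have \<chi>: "0 \<le> \<chi>" "\<chi> \<le> 13/10"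
  proof -
    show "0 \<le> \<chi>" unfolding \<chi>_def using \<xi>0 \<rho>_pos by simp
    have "\<xi> \<le> 13/10 * \<rho> i" using \<eta>\<xi> \<rho>_ge \<xi>0 by linarith
    then show "\<chi> \<le> 13/10" unfolding \<chi>_def using \<rho>_pos by (simp add: pos_divide_le_eq)
  qed
  have scale: "nrm n (\<lambda>j. x j / \<rho> i) = nrm n x / \<rho> i" for n x
    using nrm_scale[of n "1 / \<rho> i" x] \<rho>_pos by simp
  have u\<chi>: "u * \<chi> \<le> 13/10 * u" using mult_left_mono[OF \<chi>(2) u0] by simp
  have u\<zeta>: "u * \<zeta> \<le> 101/100 * u" using mult_left_mono[OF \<zeta>_le u0] by simp
  have q_err: "nrm n (\<lambda>j. q i j - q' i j / \<rho> i) \<le> u / 100 * \<chi>"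
    unfolding \<chi>_def \<xi>_def by (rule q[OF i \<rho>_pos])
  have Tq_err: "nrm k (T (\<lambda>j. q i j - q' i j / \<rho> i)) \<le> u / 50 * \<chi>"
    unfolding \<chi>_def \<xi>_def by (rule Aq[OF i \<rho>_pos])
  have s_err: "nrm k (\<lambda>a. s i a - s' i a / \<rho> i) \<le> u / 100 * \<zeta>"
    unfolding \<zeta>_def \<eta>_def by (rule s[OF i \<rho>_pos])
  have c1: "nrm n (q i) \<le> 2"
  proof -
    have "nrm n (q i) \<le> nrm n (\<lambda>j. q' i j / \<rho> i) + u / 100 * \<chi>"
      using nrm_le_add_diff[of n "q i" "\<lambda>j. q' i j / \<rho> i"] q_err by linarith
    also have "nrm n (\<lambda>j. q' i j / \<rho> i) = \<chi>" unfolding scale \<chi>_def \<xi>_def ..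
    finally show ?thesis using \<chi> u\<chi> u_small by linarith
  qed
  have c2: "nrm k (\<lambda>a. s i a - T (q i) a) \<le> u / 10"
  proof -
    have eq: "s i a - T (q i) a = (s i a - s' i a / \<rho> i) + ((s' i a - T (q' i) a) / \<rho> i - T (\<lambda>j. q i j - q' i j / \<rho> i) a)" for a
    proof -
      have "T (\<lambda>j. q i j - q' i j / \<rho> i) a = T (q i) a - T (q' i) a / \<rho> i"
        using apply_rows_scale[of n A "1 / \<rho> i" "q' i" a] by (simp add: apply_rows_diff)
      then show ?thesis by (simp add: diff_divide_distrib)
    qed
    have "nrm k (\<lambda>a. s i a - T (q i) a) = nrm k (\<lambda>a. (s i a - s' i a / \<rho> i) + ((s' i a - T (q' i) a) / \<rho> i - T (\<lambda>j. q i j - q' i j / \<rho> i) a))"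
      by (rule nrm_cong) (rule eq)
    also have "\<dots> \<le> u / 100 * \<zeta> + (nrm k (\<lambda>a. (s' i a - T (q' i) a) / \<rho> i) + u / 50 * \<chi>)"
      by (rule order.trans[OF nrm_add_le add_mono[OF s_err order.trans[OF nrm_diff_le add_left_mono[OF Tq_err]]]])
    also have "nrm k (\<lambda>a. (s' i a - T (q' i) a) / \<rho> i) \<le> u / 40 * \<chi>"
      unfolding scale \<chi>_def using divide_right_mono[OF s'T, of "\<rho> i"] \<rho>_pos by simp
    finally show ?thesis using u\<chi> u\<zeta> u0 by linarith
  qed
  have c3: "\<bar>(nrm k (s i))\<^sup>2 - 1\<bar> \<le> 1/100"
  proof -
    have n: "nrm k (\<lambda>a. s' i a / \<rho> i) = \<zeta>" unfolding scale \<zeta>_def \<eta>_def ..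
    have "nrm k (s i) \<le> \<zeta> + u / 100 * \<zeta>"
      using nrm_le_add_diff[of k "s i" "\<lambda>a. s' i a / \<rho> i"] s_err n by linarith
    moreover have "\<zeta> \<le> nrm k (s i) + u / 100 * \<zeta>"
      using nrm_le_add_diff[of k "\<lambda>a. s' i a / \<rho> i" "s i"] s_err n by (subst (asm) nrm_diff_commute) linarith
    ultimately have "\<bar>nrm k (s i) - 1\<bar> \<le> 1/1000" using \<zeta> u\<zeta> u_small unfolding abs_le_iff by linarith
    moreover from this have "\<bar>nrm k (s i) + 1\<bar> \<le> 3" unfolding abs_le_iff by linarith
    ultimately have "\<bar>nrm k (s i) - 1\<bar> * \<bar>nrm k (s i) + 1\<bar> \<le> 1/1000 * 3" by (intro mult_mono) auto
    then show ?thesis unfolding abs_mult[symmetric] by (simp add: power2_eq_square algebra_simps)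
  qed
  \<comment> \<open>The column of \<open>F\<close> has two sources. Since \<rho> \<chi> =
    \<parallel>q'\<parallel>, the normalization part is at most 8/100 L even after sketching, so the
    projection part \<Delta> dominates and the total stays below 6 L.\<close>
  have F_eq: "F i j = \<rho> i * (q i j - q' i j / \<rho> i) + \<Delta> j" for j
    unfolding F_def \<Delta>_def Qr_def using \<rho>_pos by (simp add: right_diff_distrib)
  have \<rho>\<chi>: "u * (\<rho> i * \<chi>) \<le> 4 * L"
  proof -
    have "\<rho> i * \<chi> = \<xi>" unfolding \<chi>_def using \<rho>_pos by simp
    then have "u * (\<rho> i * \<chi>) \<le> u * (4 * (sqrt m * \<omega>))" using nq' u0 unfolding \<xi>_def by (intro mult_left_mono) auto
    then show ?thesis using L by simp
  qed
  have c4: "nrm n (F i) \<le> \<Phi>"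
  proof -
    have "nrm n (F i) \<le> nrm n (\<lambda>j. \<rho> i * (q i j - q' i j / \<rho> i)) + nrm n \<Delta>"
      using nrm_add_le[of n "\<lambda>j. \<rho> i * (q i j - q' i j / \<rho> i)" \<Delta>] unfolding F_eq[symmetric] .
    also have "nrm n (\<lambda>j. \<rho> i * (q i j - q' i j / \<rho> i)) \<le> \<rho> i * (u / 100 * \<chi>)"
      unfolding nrm_scale using q_err \<rho>_pos by (simp add: mult_left_mono)
    finally show ?thesis using \<rho>\<chi> \<Delta> L\<Phi> L by (simp add: algebra_simps)
  qed
  have c5: "nrm k (T (F i)) \<le> \<Phi>"
  proof -
    have "T (F i) = (\<lambda>a. \<rho> i * T (\<lambda>j. q i j - q' i j / \<rho> i) a + T \<Delta> a)"
      unfolding F_eq apply_rows_scale[symmetric] apply_rows_add[symmetric] ..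
    then have "nrm k (T (F i)) \<le> nrm k (\<lambda>a. \<rho> i * T (\<lambda>j. q i j - q' i j / \<rho> i) a) + nrm k (T \<Delta>)"
      using nrm_add_le by simp
    also have "nrm k (\<lambda>a. \<rho> i * T (\<lambda>j. q i j - q' i j / \<rho> i) a) \<le> \<rho> i * (u / 50 * \<chi>)"
      unfolding nrm_scale using Tq_err \<rho>_pos by (simp add: mult_left_mono)
    finally show ?thesis using \<rho>\<chi> \<Delta> L\<Phi> L by (simp add: algebra_simps)
  qed
  have c6: "nrm i (\<lambda>d. ip k (s d) (s i)) \<le> \<theta>"
  proof -
    \<comment> \<open>\<open>g\<close> is the least-squares residual, almost orthogonal to the
      earlier sketches by the solver bound. The deviation \<open>e\<close> of s' from it collects
      two sketching errors, the drift between \<open>s c\<close> and the sketch of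
      \<open>q c\<close>, and the sketched projection error.\<close>
    define g where "g = (\<lambda>a. p i a - (\<Sum>d<i. r i d * s d a))"
    define e where "e = (\<lambda>a. s' i a - g a)"
    define d where "d = (\<lambda>a. s i a - s' i a / \<rho> i)"
    have TQ: "T (q' i) a = T (w i) a - (\<Sum>c<i. r i c * T (q c) a) + T \<Delta> a" for a
      unfolding q'_eq apply_rows_add apply_rows_diff Qr_def apply_rows_lincomb ..
    have "e a = ((s' i a - T (q' i) a) - (p i a - T (w i) a)) + ((\<Sum>c<i. r i c * (s c a - T (q c) a)) + T \<Delta> a)" for a
      unfolding e_def g_def TQ by (simp add: right_diff_distrib sum_subtractf)
    then have "nrm k e = nrm k (\<lambda>a. ((s' i a - T (q' i) a) - (p i a - T (w i) a)) + ((\<Sum>c<i. r i c * (s c a - T (q c) a)) + T \<Delta> a))"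
      by (intro nrm_cong) simp
    also have "\<dots> \<le> (u / 40 * \<xi> + u / 40 * \<omega>) + (u / 10 * R + 475/100 * L)"
    proof -
      have "nrm k (\<lambda>a. \<Sum>c<i. r i c * (s c a - T (q c) a)) \<le> u / 10 * R"
        unfolding R_def by (rule nrm_lincomb_le) (rule sTq)
      note R_le = this
      show ?thesis
        by (rule order.trans[OF nrm_add_le add_mono[OF order.trans[OF nrm_diff_le add_mono[OF s'T p[OF i, folded \<omega>_def]]]
              order.trans[OF nrm_add_le add_mono[OF R_le \<Delta>(2)]]]])
    qed
    also have "\<dots> \<le> 51/10 * L"
    proof -
      have "u * \<xi> \<le> u * (4 * (sqrt m * \<omega>))" using nq' u0 unfolding \<xi>_def by (intro mult_left_mono) auto
      moreover have "u * R \<le> u * (14/10 * (sqrt m * \<omega>))" using R u0 by (intro mult_left_mono) auto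
      ultimately have "u * \<xi> \<le> 4 * L" "u * R \<le> 14/10 * L" using L by linarith+
      then show ?thesis using L by linarith
    qed
    finally have e: "nrm k e \<le> 51/10 * L" .
    have S_s': "nrm i (\<lambda>c. ip k (s c) (s' i)) \<le> 66/10 * L"
    proof -
      have "nrm i (\<lambda>c. ip k (s c) (s' i)) = nrm i (\<lambda>c. ip k (s c) g + ip k (s c) e)"
        unfolding ip_add_right[symmetric] e_def by simp
      also have "\<dots> \<le> nrm i (\<lambda>c. ip k (s c) g) + 21/20 * nrm k e"
        by (rule order.trans[OF nrm_add_le add_left_mono[OF nrm_transpose_le]]) (rule near)
      finally show ?thesis using e f L unfolding g_def by linarith
    qed
    have "nrm i (\<lambda>c. ip k (s c) (s i)) = nrm i (\<lambda>c. ip k (s c) (s' i) / \<rho> i + ip k (s c) d)"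
    proof (rule nrm_cong)
      fix c
      have "ip k (s c) (\<lambda>a. 1 / \<rho> i * s' i a) = 1 / \<rho> i * ip k (s c) (s' i)" by (rule ip_scale_right)
      then show "ip k (s c) (s i) = ip k (s c) (s' i) / \<rho> i + ip k (s c) d"
        unfolding d_def ip_diff_right by simp
    qed
    also have "\<dots> \<le> nrm i (\<lambda>c. ip k (s c) (s' i)) / \<rho> i + 21/20 * nrm k d"
      by (rule order.trans[OF nrm_add_le add_mono[OF eq_refl[OF scale] nrm_transpose_le]]) (rule near)
    \<comment> \<open>Dividing by \<rho> \<ge> \<sigma> / 2 brings the condition number into the
      loss of orthogonality. Of \<theta>, 66/100 is reserved for this term and 34/100 for the
      rounding of the normalization.\<close>
    also have "\<dots> \<le> 66/10 * L / (\<sigma> / 2) + 21/20 * (u / 100 * \<zeta>)"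
      using S_s' \<rho>\<sigma> \<sigma> L s_err unfolding d_def by (intro add_mono frac_le mult_left_mono) auto
    also have "66/10 * L / (\<sigma> / 2) \<le> 66/100 * \<theta>"
    proof -
      have "u * (real m * sqrt m) * \<omega> \<le> u * (real m * sqrt m) * M" using \<omega> u0 by (intro mult_left_mono) auto
      then have "L / \<sigma> \<le> u * (real m * sqrt m) * M / \<sigma>" unfolding L_def using \<sigma> by (intro divide_right_mono) auto
      then have "132/10 * (L / \<sigma>) \<le> 132/10 * (u * (real m * sqrt m) * M / \<sigma>)" by (rule mult_left_mono) simp
      then show ?thesis unfolding \<theta>_def by (simp add: mult_ac)
    qed
    also have "21/20 * (u / 100 * \<zeta>) \<le> 34/100 * \<theta>"
    proof -
      have "u * 1 \<le> u * (real m * sqrt m) * (M / \<sigma>)"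
        using u_le_mm \<sigma>M \<sigma> u0 by (subst (1) mult_1_right[symmetric]) (intro mult_mono, auto)
      then have "20 * u \<le> \<theta>" unfolding \<theta>_def by simp
      then show ?thesis using u\<zeta> u0 by linarith
    qed
    finally show ?thesis by linarith
  qed
  show ?thesis
    using inv \<rho>_pos c1 c2 c3 c4 c5 c6 unfolding invar_def by (auto simp: less_Suc_eq)
qed

lemma invar: "i \<le> m \<Longrightarrow> invar i"
proof (induction i)
  case 0
  then show ?case by (simp add: invar_def)
next
  case (Suc i)
  then show ?case by (intro invar_step) auto
qed

text \<open>36 = 6 * 6: the embedding of W + F loses 6 \<tau>, and \<tau> itself carries the factor
  6.\<close>

lemma embedding_Q:
  "\<bar>ip n (\<lambda>j. \<Sum>c<m. y c * q c j) (\<lambda>j. \<Sum>c<m. z c * q c j)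
      - ip k (T (\<lambda>j. \<Sum>c<m. y c * q c j)) (T (\<lambda>j. \<Sum>c<m. z c * q c j))\<bar>
    \<le> (\<epsilon> + 36 * u * (real m)\<^sup>2 * M / \<sigma>) * nrm n (\<lambda>j. \<Sum>c<m. y c * q c j) * nrm n (\<lambda>j. \<Sum>c<m. z c * q c j)"
proof -
  have inv: "\<rho> c \<noteq> 0" "nrm n (F c) \<le> \<Phi>" "nrm k (T (F c)) \<le> \<Phi>" if "c < m" for c
    using invar[OF order.refl] that unfolding invar_def by fastforce+
  obtain a where "\<And>j. (\<Sum>c<m. y c * q c j) = (\<Sum>c<m. a c * (w c j + F c j))"
    using span_q[of m y] inv(1) by blast
  then have a: "(\<lambda>j. \<Sum>c<m. y c * q c j) = (\<lambda>j. \<Sum>c<m. a c * (w c j + F c j))" by (rule ext)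
  obtain b where "\<And>j. (\<Sum>c<m. z c * q c j) = (\<Sum>c<m. b c * (w c j + F c j))"
    using span_q[of m z] inv(1) by blast
  then have b: "(\<lambda>j. \<Sum>c<m. z c * q c j) = (\<lambda>j. \<Sum>c<m. b c * (w c j + F c j))" by (rule ext)
  have "\<epsilon> + 36 * u * (real m)\<^sup>2 * M / \<sigma> = \<epsilon> + 6 * \<tau>" unfolding \<tau>_def by simp
  then show ?thesis unfolding a b
    by (simp only:) (rule perturbed_embedding; use inv in auto)
qed

end

section \<open>Extreme singular values\<close>

text \<open>A crude bound by the sum of all entries suffices, since only the existence of a finite
  constant matters.\<close>

lemma abs_bilinear_le:
  "\<bar>ip m x (apply_rows m B x)\<bar> \<le> (\<Sum>i<m. \<Sum>j<m. \<bar>B i j\<bar>) * (nrm m x)\<^sup>2"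
proof -
  have "ip m x (apply_rows m B x) = (\<Sum>i<m. \<Sum>j<m. B i j * (x i * x j))"
    unfolding ip_def apply_rows_def by (simp add: sum_distrib_left mult_ac)
  also have "\<bar>\<dots>\<bar> \<le> (\<Sum>i<m. \<Sum>j<m. \<bar>B i j\<bar> * (nrm m x)\<^sup>2)"
  proof (rule order.trans[OF sum_abs sum_mono], rule order.trans[OF sum_abs sum_mono])
    fix i j assume "i \<in> {..<m}" "j \<in> {..<m}"
    then have "\<bar>x i\<bar> * \<bar>x j\<bar> \<le> nrm m x * nrm m x" by (intro mult_mono abs_le_nrm) auto
    then show "\<bar>B i j * (x i * x j)\<bar> \<le> \<bar>B i j\<bar> * (nrm m x)\<^sup>2"
      by (simp add: abs_mult power2_eq_square mult_left_mono)
  qed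
  finally show ?thesis by (simp add: sum_distrib_right)
qed

lemma bilinear_symmetric:
  assumes "\<And>i j. i < m \<Longrightarrow> j < m \<Longrightarrow> N i j = N j i"
  shows "ip m x (apply_rows m N y) = ip m y (apply_rows m N x)"
proof -
  have "ip m x (apply_rows m N y) = (\<Sum>i<m. \<Sum>j<m. x i * (N i j * y j))"
    unfolding ip_def apply_rows_def by (simp add: sum_distrib_left)
  also have "\<dots> = (\<Sum>j<m. \<Sum>i<m. x i * (N i j * y j))" by (rule sum.swap)
  also have "\<dots> = (\<Sum>j<m. \<Sum>i<m. y j * (N j i * x i))"
    using assms by (intro sum.cong) (auto simp: mult_ac)
  also have "\<dots> = ip m y (apply_rows m N x)"
    unfolding ip_def apply_rows_def by (simp add: sum_distrib_left)
  finally show ?thesis .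
qed

text \<open>The quadratic t \<mapsto> form at x + t y is nonnegative, so its discriminant is not
  positive. For a = 0 it is affine, which forces the slope \<open>b\<close> to vanish.\<close>

lemma psd_cauchy_schwarz:
  assumes sym: "\<And>i j. i < m \<Longrightarrow> j < m \<Longrightarrow> N i j = N j i"
    and psd: "\<And>x. 0 \<le> ip m x (apply_rows m N x)"
  shows "(ip m x (apply_rows m N y))\<^sup>2 \<le> ip m x (apply_rows m N x) * ip m y (apply_rows m N y)"
proof -
  define a b c where "a = ip m y (apply_rows m N y)" and "b = ip m x (apply_rows m N y)"
    and "c = ip m x (apply_rows m N x)"
  have byx: "ip m y (apply_rows m N x) = ip m x (apply_rows m N y)" by (rule bilinear_symmetric) (rule sym)
  have q: "0 \<le> c + 2 * t * b + t\<^sup>2 * a" for t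
  proof -
    have "apply_rows m N (\<lambda>i. x i + t * y i) = (\<lambda>i. apply_rows m N x i + t * apply_rows m N y i)"
      by (intro ext) (simp add: apply_rows_add apply_rows_scale)
    then have "ip m (\<lambda>i. x i + t * y i) (apply_rows m N (\<lambda>i. x i + t * y i)) = c + 2 * t * b + t\<^sup>2 * a"
      using byx unfolding a_def[symmetric] b_def[symmetric] c_def[symmetric]
      by (simp add: a_def b_def c_def ip_add_left ip_add_right ip_scale_left ip_scale_right algebra_simps power2_eq_square)
    then show ?thesis using psd[of "\<lambda>i. x i + t * y i"] by simp
  qed
  have c: "0 \<le> c" unfolding c_def by (rule psd)
  have "b\<^sup>2 \<le> c * a"
  proof (cases "a = 0")
    case True
    have "b = 0"
    proof (rule ccontr)
      assume "b \<noteq> 0"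
      then have "0 \<le> c + 2 * (- (c + 1) / (2 * b)) * b" using q[of "- (c + 1) / (2 * b)"] True by simp
      also have "\<dots> = -1" using \<open>b \<noteq> 0\<close> by (simp add: field_simps)
      finally show False by simp
    qed
    then show ?thesis using True by simp
  next
    case False
    then have a: "0 < a" using psd[of y] unfolding a_def by simp
    have "0 \<le> a * (c + 2 * (- b / a) * b + (- b / a)\<^sup>2 * a)" using q[of "- b / a"] a by simp
    also have "\<dots> = c * a - b\<^sup>2" using a by (simp add: field_simps power2_eq_square)
    finally show ?thesis by simp
  qed
  then show ?thesis unfolding a_def b_def c_def .
qed

text \<open>An invertible positive semidefinite form is bounded away from 0 on the unit sphere; this
  replaces a compactness argument in showing that the extreme Rayleigh quotients are eigenvalues.\<close>

lemma invertible_psd_coercive: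
  assumes sym: "\<And>i j. i < m \<Longrightarrow> j < m \<Longrightarrow> N i j = N j i"
    and psd: "\<And>x. 0 \<le> ip m x (apply_rows m N x)"
    and inv: "\<And>x i. i < m \<Longrightarrow> apply_rows m N (apply_rows m B x) i = x i"
  shows "\<exists>C>0. \<forall>x. (nrm m x)\<^sup>2 \<le> C * ip m x (apply_rows m N x)"
proof (intro exI conjI allI)
  define C where "C = (\<Sum>i<m. \<Sum>j<m. \<bar>B i j\<bar>) + 1"
  show "0 < C" unfolding C_def by (intro add_nonneg_pos sum_nonneg) auto
  fix x
  \<comment> \<open>As N y = x, Cauchy-Schwarz at x and y reads \<parallel>x\<parallel>^4 \<le> <x,
    N x> <y, x>, and <y, x> is at most C \<parallel>x\<parallel>^2.\<close>
  define y where "y = apply_rows m B x"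
  have x: "ip m f (apply_rows m N y) = ip m f x" for f
    unfolding y_def by (rule ip_cong) (auto simp: inv)
  have "ip m y x = ip m x (apply_rows m B x)" unfolding y_def by (rule ip_commute)
  also have "\<dots> \<le> C * (nrm m x)\<^sup>2"
    using abs_bilinear_le[of m x B] zero_le_power2[of "nrm m x"] unfolding C_def distrib_right by linarith
  finally have yx: "ip m y x \<le> C * (nrm m x)\<^sup>2" .
  have "((nrm m x)\<^sup>2)\<^sup>2 \<le> ip m x (apply_rows m N x) * ip m y x"
    using psd_cauchy_schwarz[OF sym psd, of x y] unfolding x ip_self .
  also have "\<dots> \<le> ip m x (apply_rows m N x) * (C * (nrm m x)\<^sup>2)" using yx psd by (rule mult_left_mono)
  also have "\<dots> = (nrm m x)\<^sup>2 * (C * ip m x (apply_rows m N x))" by simp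
  finally have *: "(nrm m x)\<^sup>2 * (nrm m x)\<^sup>2 \<le> (nrm m x)\<^sup>2 * (C * ip m x (apply_rows m N x))"
    unfolding power2_eq_square[of "(nrm m x)\<^sup>2"] .
  show "(nrm m x)\<^sup>2 \<le> C * ip m x (apply_rows m N x)"
  proof (cases "nrm m x = 0")
    case True
    then show ?thesis using psd \<open>0 < C\<close> by simp
  next
    case False
    then have "0 < (nrm m x)\<^sup>2" by simp
    with * show ?thesis by (rule mult_left_le_imp_le)
  qed
qed

lemma mat_mult_vec_eq_apply_rows:
  fixes K :: "real mat"
  assumes "K \<in> carrier_mat n m" "i < n"
  shows "(K *\<^sub>v vec m x) $ i = apply_rows m (\<lambda>i j. K $$ (i, j)) x i"
  using assms by (simp add: apply_rows_def scalar_prod_def atLeast0LessThan)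

text \<open>\<open>e\<close> is a sign, so that K and -K are handled together; e * e = 1 makes e B
  inverse to e K.\<close>

lemma coercive_of_det_nonzero:
  fixes K :: "real mat" and e :: real
  assumes K: "K \<in> carrier_mat m m" "det K \<noteq> 0"
    and sym: "\<And>i j. i < m \<Longrightarrow> j < m \<Longrightarrow> K $$ (i, j) = K $$ (j, i)" and e: "e * e = 1"
    and psd: "\<And>x. 0 \<le> e * ip m x (apply_rows m (\<lambda>i j. K $$ (i, j)) x)"
  shows "\<exists>C>0. \<forall>x. (nrm m x)\<^sup>2 \<le> C * (e * ip m x (apply_rows m (\<lambda>i j. K $$ (i, j)) x))"
proof -
  obtain B where B: "B \<in> carrier_mat m m" "K * B = 1\<^sub>m m"
    using det_non_zero_imp_unit[OF K, of undefined] unfolding Units_def ring_mat_def by auto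
  define N where "N i j = e * K $$ (i, j)" for i j
  have N: "apply_rows m N x = (\<lambda>i. e * apply_rows m (\<lambda>i j. K $$ (i, j)) x i)" for x
    unfolding apply_rows_def N_def by (simp add: sum_distrib_left mult.assoc)
  have "apply_rows m (\<lambda>i j. K $$ (i, j)) (apply_rows m (\<lambda>i j. B $$ (i, j)) x) i = x i" if i: "i < m" for x i
  proof -
    have "(K *\<^sub>v (B *\<^sub>v vec m x)) $ i = vec m x $ i"
      using K B by (simp add: assoc_mult_mat_vec[symmetric, of K m m B m])
    moreover have "B *\<^sub>v vec m x = vec m (apply_rows m (\<lambda>i j. B $$ (i, j)) x)"
      using B mat_mult_vec_eq_apply_rows[OF B(1)] by (intro eq_vecI) auto
    ultimately show ?thesis using mat_mult_vec_eq_apply_rows[OF K(1) i] i by simp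
  qed
  then have inv: "apply_rows m N (apply_rows m (\<lambda>i j. e * B $$ (i, j)) x) i = x i" if "i < m" for x i
  proof -
    have "apply_rows m (\<lambda>i j. e * B $$ (i, j)) x = (\<lambda>i. e * apply_rows m (\<lambda>i j. B $$ (i, j)) x i)"
      unfolding apply_rows_def by (simp add: sum_distrib_left mult.assoc)
    then show ?thesis unfolding N using that e \<open>\<And>x i. i < m \<Longrightarrow> _ = x i\<close>
      by (simp add: apply_rows_scale mult.assoc[symmetric])
  qed
  have "\<exists>C>0. \<forall>x. (nrm m x)\<^sup>2 \<le> C * ip m x (apply_rows m N x)"
    by (rule invertible_psd_coercive[OF _ _ inv]) (use sym psd in \<open>auto simp: N_def N ip_scale_right\<close>)
  then show ?thesis unfolding N ip_scale_right .
qed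

section \<open>Singular values as extrema of Rayleigh quotients\<close>

definition lincomb_cols :: "real mat \<Rightarrow> (nat \<Rightarrow> real) \<Rightarrow> nat \<Rightarrow> real" where
  "lincomb_cols W x j = (\<Sum>c<dim_col W. x c * W $$ (j, c))"

lemma gram_char_matrix_form:
  fixes W :: "real mat"
  assumes W: "W \<in> carrier_mat n m"
  shows "ip m x (apply_rows m (\<lambda>i j. char_matrix (W\<^sup>T * W) e $$ (i, j)) x) = (nrm n (lincomb_cols W x))\<^sup>2 - e * (nrm m x)\<^sup>2"
proof -
  have idx: "char_matrix (W\<^sup>T * W) e $$ (i, j) = (\<Sum>l<n. W $$ (l, i) * W $$ (l, j)) - (if i = j then e else 0)"
    if "i < m" "j < m" for i j
    using that W by (simp add: char_matrix_def scalar_prod_def atLeast0LessThan)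
  have "apply_rows m (\<lambda>i j. char_matrix (W\<^sup>T * W) e $$ (i, j)) x i = (\<Sum>l<n. W $$ (l, i) * lincomb_cols W x l) - e * x i"
    if i: "i < m" for i
  proof -
    have "apply_rows m (\<lambda>i j. char_matrix (W\<^sup>T * W) e $$ (i, j)) x i
      = (\<Sum>j<m. \<Sum>l<n. W $$ (l, i) * W $$ (l, j) * x j) - (\<Sum>j<m. (if i = j then e else 0) * x j)"
      unfolding apply_rows_def using i by (simp add: idx left_diff_distrib sum_subtractf sum_distrib_right)
    also have "(\<Sum>j<m. (if i = j then e else 0) * x j) = e * x i"
      using i by (simp add: if_distrib[of "\<lambda>z. z * _"] cong: if_cong)
    also have "(\<Sum>j<m. \<Sum>l<n. W $$ (l, i) * W $$ (l, j) * x j) = (\<Sum>l<n. \<Sum>j<m. W $$ (l, i) * W $$ (l, j) * x j)"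
      by (rule sum.swap)
    also have "\<dots> = (\<Sum>l<n. W $$ (l, i) * lincomb_cols W x l)"
      unfolding lincomb_cols_def using W by (simp add: sum_distrib_left mult_ac)
    finally show ?thesis .
  qed
  then have "ip m x (apply_rows m (\<lambda>i j. char_matrix (W\<^sup>T * W) e $$ (i, j)) x)
    = ip m x (\<lambda>i. (\<Sum>l<n. W $$ (l, i) * lincomb_cols W x l) - e * x i)"
    by (intro ip_cong) auto
  also have "\<dots> = ip m x (\<lambda>i. \<Sum>l<n. W $$ (l, i) * lincomb_cols W x l) - e * (nrm m x)\<^sup>2"
    by (simp add: ip_diff_right ip_scale_right ip_self)
  also have "ip m x (\<lambda>i. \<Sum>l<n. W $$ (l, i) * lincomb_cols W x l) = (\<Sum>i<m. \<Sum>l<n. x i * (W $$ (l, i) * lincomb_cols W x l))"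
    unfolding ip_def by (simp add: sum_distrib_left)
  also have "\<dots> = (\<Sum>l<n. \<Sum>i<m. x i * (W $$ (l, i) * lincomb_cols W x l))" by (rule sum.swap)
  also have "\<dots> = (nrm n (lincomb_cols W x))\<^sup>2"
    unfolding ip_self[symmetric] ip_def using W by (simp add: lincomb_cols_def sum_distrib_right mult.assoc)
  finally show ?thesis .
qed

text \<open>e = 1 serves the infimum of the Rayleigh quotients and e = -1 the supremum. If \<mu>
  were no eigenvalue, the form of W^T W - \<mu> I would, up to sign, be coercive, contrary to the
  unit vectors that bring it arbitrarily close to 0.\<close>

lemma singular_value_of_extremal:
  fixes W :: "real mat"
  assumes W: "W \<in> carrier_mat n m" and e: "e * e = 1" and \<mu>: "0 \<le> \<mu>"
    and ext: "\<And>x. 0 \<le> e * ((nrm n (lincomb_cols W x))\<^sup>2 - \<mu> * (nrm m x)\<^sup>2)"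
    and near: "\<And>\<delta>. 0 < \<delta> \<Longrightarrow> \<exists>x. nrm m x = 1 \<and> e * ((nrm n (lincomb_cols W x))\<^sup>2 - \<mu>) < \<delta>"
  shows "sqrt \<mu> \<in> singular_values W"
proof -
  let ?K = "char_matrix (W\<^sup>T * W) \<mu>"
  have WW: "W\<^sup>T * W \<in> carrier_mat m m" using W by auto
  have K: "?K \<in> carrier_mat m m" using WW by simp
  have sym: "?K $$ (i, j) = ?K $$ (j, i)" if "i < m" "j < m" for i j
    using that W by (simp add: char_matrix_def scalar_prod_def mult.commute)
  have "det ?K = 0"
  proof (rule ccontr)
    assume "det ?K \<noteq> 0"
    from coercive_of_det_nonzero[OF K this sym e] ext
    obtain C where C: "C > 0" "\<And>x. (nrm m x)\<^sup>2 \<le> C * (e * ((nrm n (lincomb_cols W x))\<^sup>2 - \<mu> * (nrm m x)\<^sup>2))"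
      unfolding gram_char_matrix_form[OF W] by blast
    obtain x where x: "nrm m x = 1" "e * ((nrm n (lincomb_cols W x))\<^sup>2 - \<mu>) < 1 / C"
      using near[of "1 / C"] C by auto
    have "C * (e * ((nrm n (lincomb_cols W x))\<^sup>2 - \<mu>)) < C * (1 / C)" using x C by (intro mult_strict_left_mono) auto
    then show False using C(2)[of x] x C(1) by simp
  qed
  then have "eigenvalue (W\<^sup>T * W) \<mu>" unfolding eigenvalue_det[OF WW] .
  then show ?thesis unfolding singular_values_def using \<mu> by simp
qed

text \<open>\<open>Min\<close> and \<open>Max\<close> are meaningful only on finite sets; here the
  squares are roots of the characteristic polynomial.\<close>

lemma finite_singular_values:
  fixes W :: "real mat"
  assumes W: "W \<in> carrier_mat n m"
  shows "finite (singular_values W)"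
proof -
  have WW: "W\<^sup>T * W \<in> carrier_mat m m" using W by auto
  have "finite {e. poly (char_poly (W\<^sup>T * W)) e = 0}"
    by (rule poly_roots_finite) (use degree_monic_char_poly[OF WW] in auto)
  moreover have "singular_values W \<subseteq> sqrt ` {e. poly (char_poly (W\<^sup>T * W)) e = 0}"
  proof
    fix s assume "s \<in> singular_values W"
    then have "0 \<le> s" "poly (char_poly (W\<^sup>T * W)) (s\<^sup>2) = 0"
      unfolding singular_values_def eigenvalue_root_char_poly[OF WW] by auto
    then show "s \<in> sqrt ` {e. poly (char_poly (W\<^sup>T * W)) e = 0}" by (intro image_eqI[of _ _ "s\<^sup>2"]) auto
  qed
  ultimately show ?thesis using finite_surj by blast
qed

lemma lincomb_cols_scale: "lincomb_cols W (\<lambda>c. a * x c) = (\<lambda>j. a * lincomb_cols W x j)"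
  unfolding lincomb_cols_def by (simp add: sum_distrib_left mult.assoc)

lemma extreme_singular_values:
  fixes W :: "real mat"
  assumes W: "W \<in> carrier_mat n m" and m: "1 \<le> m"
  shows "Min (singular_values W) * nrm m x \<le> nrm n (lincomb_cols W x)"
    and "nrm n (lincomb_cols W x) \<le> Max (singular_values W) * nrm m x"
    and "0 \<le> Min (singular_values W)" and "Min (singular_values W) \<le> Max (singular_values W)"
proof -
  note fin = finite_singular_values[OF W]
  \<comment> \<open>The Rayleigh quotients of W^T W on the unit sphere. That infimum and supremum
    are approached is enough; that they are attained need not be known.\<close>
  define R where "R = (\<lambda>x. (nrm n (lincomb_cols W x))\<^sup>2) ` {x. nrm m x = 1}"
  have "nrm m (\<lambda>c. if c = 0 then 1 else 0) = 1"
    using m by (simp add: nrm_eq_sqrt_ip ip_def if_distrib[of "\<lambda>z. z * _"] cong: if_cong)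
  then have ne: "R \<noteq> {}" unfolding R_def by blast
  have lo: "bdd_below R" unfolding R_def by (rule bdd_belowI[of _ 0]) auto
  have up: "bdd_above R"
  proof (rule bdd_aboveI)
    fix v assume "v \<in> R"
    then obtain x where x: "nrm m x = 1" "v = (nrm n (lincomb_cols W x))\<^sup>2" unfolding R_def by auto
    have "v = ip m x (apply_rows m (\<lambda>i j. char_matrix (W\<^sup>T * W) 0 $$ (i, j)) x)"
      unfolding x gram_char_matrix_form[OF W] by simp
    also have "\<dots> \<le> (\<Sum>i<m. \<Sum>j<m. \<bar>char_matrix (W\<^sup>T * W) 0 $$ (i, j)\<bar>)"
      using abs_bilinear_le[of m x "\<lambda>i j. char_matrix (W\<^sup>T * W) 0 $$ (i, j)"] x(1) by simp
    finally show "v \<le> (\<Sum>i<m. \<Sum>j<m. \<bar>char_matrix (W\<^sup>T * W) 0 $$ (i, j)\<bar>)" .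
  qed
  have hom: "(nrm n (lincomb_cols W x))\<^sup>2 \<in> (\<lambda>v. v * (nrm m x)\<^sup>2) ` R" if "nrm m x \<noteq> 0" for x
  proof (rule image_eqI)
    let ?y = "\<lambda>c. inverse (nrm m x) * x c"
    have "nrm m ?y = 1" unfolding nrm_scale using that nrm_nonneg[of m x] by simp
    then show "(nrm n (lincomb_cols W ?y))\<^sup>2 \<in> R" unfolding R_def by blast
    show "(nrm n (lincomb_cols W x))\<^sup>2 = (nrm n (lincomb_cols W ?y))\<^sup>2 * (nrm m x)\<^sup>2"
      unfolding lincomb_cols_scale nrm_scale using that by (simp add: power_mult_distrib power_inverse)
  qed
  have zero: "nrm n (lincomb_cols W x) = 0" if "nrm m x = 0" for x
    using that W unfolding nrm_eq_0_iff lincomb_cols_def by simp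
  have Inf_le: "Inf R * (nrm m x)\<^sup>2 \<le> (nrm n (lincomb_cols W x))\<^sup>2" for x
    using hom[of x] zero[of x] cInf_lower[OF _ lo] by (cases "nrm m x = 0") (auto intro: mult_right_mono)
  have Sup_ge: "(nrm n (lincomb_cols W x))\<^sup>2 \<le> Sup R * (nrm m x)\<^sup>2" for x
    using hom[of x] zero[of x] cSup_upper[OF _ up] by (cases "nrm m x = 0") (auto intro: mult_right_mono)
  have Inf0: "0 \<le> Inf R" by (rule cInf_greatest[OF ne]) (auto simp: R_def)
  have "Inf R \<le> Sup R" by (rule cInf_le_cSup[OF ne up lo])
  then have Sup0: "0 \<le> Sup R" using Inf0 by simp
  have mi: "sqrt (Inf R) \<in> singular_values W"
  proof (rule singular_value_of_extremal[OF W, of 1])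
    fix \<delta> :: real assume "0 < \<delta>"
    then obtain v where "v \<in> R" "v < Inf R + \<delta>" using cInf_lessD[OF ne, of "Inf R + \<delta>"] by auto
    then show "\<exists>x. nrm m x = 1 \<and> 1 * ((nrm n (lincomb_cols W x))\<^sup>2 - Inf R) < \<delta>" unfolding R_def by fastforce
  qed (use Inf_le Inf0 in auto)
  have ma: "sqrt (Sup R) \<in> singular_values W"
  proof (rule singular_value_of_extremal[OF W, of "-1"])
    fix \<delta> :: real assume "0 < \<delta>"
    then obtain v where "v \<in> R" "Sup R - \<delta> < v" using less_cSupD[OF ne, of "Sup R - \<delta>"] by auto
    then show "\<exists>x. nrm m x = 1 \<and> -1 * ((nrm n (lincomb_cols W x))\<^sup>2 - Sup R) < \<delta>" unfolding R_def by fastforce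
  qed (use Sup_ge Sup0 in auto)
  show "Min (singular_values W) * nrm m x \<le> nrm n (lincomb_cols W x)"
  proof -
    have "sqrt (Inf R * (nrm m x)\<^sup>2) \<le> sqrt ((nrm n (lincomb_cols W x))\<^sup>2)" using Inf_le by (rule real_sqrt_le_mono)
    then have "sqrt (Inf R) * nrm m x \<le> nrm n (lincomb_cols W x)" by (simp add: real_sqrt_mult)
    moreover have "Min (singular_values W) * nrm m x \<le> sqrt (Inf R) * nrm m x"
      using Min_le[OF fin mi] by (rule mult_right_mono) simp
    ultimately show ?thesis by linarith
  qed
  show "nrm n (lincomb_cols W x) \<le> Max (singular_values W) * nrm m x"
  proof -
    have "sqrt ((nrm n (lincomb_cols W x))\<^sup>2) \<le> sqrt (Sup R * (nrm m x)\<^sup>2)" using Sup_ge by (rule real_sqrt_le_mono)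
    then have "nrm n (lincomb_cols W x) \<le> sqrt (Sup R) * nrm m x" by (simp add: real_sqrt_mult)
    moreover have "sqrt (Sup R) * nrm m x \<le> Max (singular_values W) * nrm m x"
      using Max_ge[OF fin ma] by (rule mult_right_mono) simp
    ultimately show ?thesis by linarith
  qed
  show "0 \<le> Min (singular_values W)"
    using Min_in[OF fin] mi unfolding singular_values_def by blast
  show "Min (singular_values W) \<le> Max (singular_values W)"
    using Min_le[OF fin mi] Max_ge[OF fin mi] by linarith
qed

section \<open>The computed RGS factor\<close>

lemma scalar_prod_eq_ip: "dim_vec v = n \<Longrightarrow> u \<bullet> v = ip n (\<lambda>i. u $ i) (\<lambda>i. v $ i)"
  by (simp add: scalar_prod_def ip_def atLeast0LessThan)

lemma l2_norm_eq_nrm: "dim_vec v = n \<Longrightarrow> l2_norm v = nrm n (\<lambda>i. v $ i)"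
  by (simp add: l2_norm_def nrm_eq_sqrt_ip scalar_prod_eq_ip)

lemma mult_mat_vec_nth:
  fixes B :: "real mat"
  assumes "B \<in> carrier_mat k n" "dim_vec x = n" "a < k"
  shows "(B *\<^sub>v x) $ a = apply_rows n (\<lambda>a j. B $$ (a, j)) (\<lambda>j. x $ j) a"
  using assms by (simp add: apply_rows_def scalar_prod_def atLeast0LessThan)

lemma l2_norm_mult_mat_vec:
  fixes B :: "real mat"
  assumes "B \<in> carrier_mat k n" "dim_vec x = n"
  shows "l2_norm (B *\<^sub>v x) = nrm k (apply_rows n (\<lambda>a j. B $$ (a, j)) (\<lambda>j. x $ j))"
proof -
  have "dim_vec (B *\<^sub>v x) = k" using assms by simp
  from l2_norm_eq_nrm[OF this] show ?thesis
    using nrm_cong[OF mult_mat_vec_nth[OF assms]] by simp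
qed

text \<open>The column space consists of all B x, so quantifying over the subspace becomes
  quantifying over coefficient functions.\<close>

lemma eps_embedding_mat_iff:
  fixes B \<Theta> :: "real mat"
  assumes B: "B \<in> carrier_mat n m" and \<Theta>: "\<Theta> \<in> carrier_mat k n"
  defines "A \<equiv> \<lambda>a j. \<Theta> $$ (a, j)"
  shows "eps_embedding_mat e \<Theta> B \<longleftrightarrow> e < 1 \<and> (\<forall>x y.
    \<bar>ip n (lincomb_cols B x) (lincomb_cols B y)
      - ip k (apply_rows n A (lincomb_cols B x)) (apply_rows n A (lincomb_cols B y))\<bar>
    \<le> e * nrm n (lincomb_cols B x) * nrm n (lincomb_cols B y))"
proof -
  interpret vec_space "TYPE(real)" n .
  have cs: "col_space B = range (\<lambda>x. vec n (lincomb_cols B x))"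
  proof -
    have mv: "B *\<^sub>v v = vec n (lincomb_cols B (\<lambda>c. v $ c))" if "v \<in> carrier_vec m" for v
      using that B by (intro eq_vecI) (auto simp: lincomb_cols_def scalar_prod_def atLeast0LessThan mult.commute)
    have "lincomb_cols B (\<lambda>c. vec m x $ c) = lincomb_cols B x" for x
      using B unfolding lincomb_cols_def by (intro ext sum.cong) auto
    then have "vec n (lincomb_cols B x) = B *\<^sub>v vec m x" for x by (simp add: mv)
    then show ?thesis unfolding col_space_eq[OF B] using B mv by fastforce
  qed
  have 1: "l2_norm (vec n f) = nrm n f" for f
    using l2_norm_eq_nrm[of "vec n f" n] nrm_cong[of n "\<lambda>i. vec n f $ i" f] by simp
  have 2: "vec n f \<bullet> vec n g = ip n f g" for f g
    using scalar_prod_eq_ip[of "vec n g" n "vec n f"] ip_cong[of n "\<lambda>i. vec n f $ i" f "\<lambda>i. vec n g $ i" g] by simp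
  have 3: "(\<Theta> *\<^sub>v vec n f) \<bullet> (\<Theta> *\<^sub>v vec n g) = ip k (apply_rows n A f) (apply_rows n A g)" for f g
  proof -
    have "(\<Theta> *\<^sub>v vec n f) \<bullet> (\<Theta> *\<^sub>v vec n g) = ip k (\<lambda>i. (\<Theta> *\<^sub>v vec n f) $ i) (\<lambda>i. (\<Theta> *\<^sub>v vec n g) $ i)"
      using \<Theta> by (intro scalar_prod_eq_ip) simp
    also have "\<dots> = ip k (apply_rows n A (\<lambda>j. vec n f $ j)) (apply_rows n A (\<lambda>j. vec n g $ j))"
      unfolding A_def by (intro ip_cong) (auto simp del: index_mult_mat_vec simp: mult_mat_vec_nth[OF \<Theta>])
    also have "\<dots> = ip k (apply_rows n A f) (apply_rows n A g)"
      by (intro arg_cong2[where f = "ip k"] apply_rows_cong) simp_all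
    finally show ?thesis .
  qed
  show ?thesis
    using B unfolding eps_embedding_mat_def eps_embedding_def by (auto simp: cs 1 2 3)
qed

section \<open>Rounding errors of the matrix and vector operations\<close>

text \<open>Cauchy-Schwarz bounds the error of each entry by a row norm, and the row norms combine
  to the Frobenius norm. With that norm of order sqrt n, a sketch has an error of order
  n^(3/2).\<close>

lemma fl_mat_vec_error:
  assumes F: "fl_arithmetic u F" and B: "B \<in> carrier_mat k n" and x: "dim_vec x = n" and n: "real n * u \<le> 1/100"
  shows "nrm k (\<lambda>a. fl_mat_vec F B x $ a - apply_rows n (\<lambda>a j. B $$ (a, j)) (\<lambda>j. x $ j) a)
    \<le> 2 * real n * u * frobenius_norm B * nrm n (\<lambda>j. x $ j)"
proof -
  have u: "0 \<le> u" by (rule fl_arithmeticD(6)[OF F])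
  define N where "N = nrm n (\<lambda>j. x $ j)"
  have "nrm k (\<lambda>a. fl_mat_vec F B x $ a - apply_rows n (\<lambda>a j. B $$ (a, j)) (\<lambda>j. x $ j) a)
    \<le> nrm k (\<lambda>a. (2 * real n * u * N) * nrm n (\<lambda>j. B $$ (a, j)))"
  proof (rule nrm_mono)
    fix a assume a: "a < k"
    have "apply_rows n (\<lambda>a j. B $$ (a, j)) (\<lambda>j. x $ j) a = (\<Sum>j<n. row B a $ j * x $ j)"
      unfolding apply_rows_def using B a by (intro sum.cong) auto
    then have "\<bar>fl_mat_vec F B x $ a - apply_rows n (\<lambda>a j. B $$ (a, j)) (\<lambda>j. x $ j) a\<bar>
      \<le> 2 * real n * u * (\<Sum>j<n. \<bar>row B a $ j * x $ j\<bar>)"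
      using fl_inner_error[OF F x n, of "row B a"] B a by (simp add: fl_mat_vec_def)
    also have "(\<Sum>j<n. \<bar>row B a $ j * x $ j\<bar>) = ip n (\<lambda>j. \<bar>B $$ (a, j)\<bar>) (\<lambda>j. \<bar>x $ j\<bar>)"
      unfolding ip_def using B a by (intro sum.cong) (auto simp: abs_mult)
    finally have 1: "\<bar>fl_mat_vec F B x $ a - apply_rows n (\<lambda>a j. B $$ (a, j)) (\<lambda>j. x $ j) a\<bar>
      \<le> 2 * real n * u * ip n (\<lambda>j. \<bar>B $$ (a, j)\<bar>) (\<lambda>j. \<bar>x $ j\<bar>)" .
    have "ip n (\<lambda>j. \<bar>B $$ (a, j)\<bar>) (\<lambda>j. \<bar>x $ j\<bar>) \<le> nrm n (\<lambda>j. B $$ (a, j)) * N"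
      using ip_abs_le[of n "\<lambda>j. \<bar>B $$ (a, j)\<bar>" "\<lambda>j. \<bar>x $ j\<bar>"] unfolding nrm_abs N_def by linarith
    then have "2 * real n * u * ip n (\<lambda>j. \<bar>B $$ (a, j)\<bar>) (\<lambda>j. \<bar>x $ j\<bar>) \<le> 2 * real n * u * (nrm n (\<lambda>j. B $$ (a, j)) * N)"
      using u by (intro mult_left_mono) auto
    then show "\<bar>fl_mat_vec F B x $ a - apply_rows n (\<lambda>a j. B $$ (a, j)) (\<lambda>j. x $ j) a\<bar>
      \<le> (2 * real n * u * N) * nrm n (\<lambda>j. B $$ (a, j))"
      using 1 by (simp add: mult_ac)
  qed
  also have "\<dots> = (2 * real n * u * N) * nrm k (\<lambda>a. nrm n (\<lambda>j. B $$ (a, j)))"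
    unfolding nrm_scale using u by (simp add: N_def)
  also have "nrm k (\<lambda>a. nrm n (\<lambda>j. B $$ (a, j))) = frobenius_norm B"
    unfolding frobenius_norm_def nrm_eq_sqrt_ip[of k] ip_def using B
    by (simp add: ip_self[of n, unfolded ip_def power2_eq_square, symmetric] power2_eq_square)
  finally show ?thesis unfolding N_def by (simp add: mult_ac)
qed

lemma fl_vec_div_error:
  assumes F: "fl_arithmetic u F" and x: "dim_vec x = k" and c: "0 < c"
  shows "nrm k (\<lambda>a. fl_vec_div F x c $ a - x $ a / c) \<le> u * (nrm k (\<lambda>a. x $ a) / c)"
proof -
  have u: "0 \<le> u" by (rule fl_arithmeticD(6)[OF F])
  have "nrm k (\<lambda>a. fl_vec_div F x c $ a - x $ a / c) \<le> nrm k (\<lambda>a. (u / c) * \<bar>x $ a\<bar>)"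
  proof (rule nrm_mono)
    fix a assume "a < k"
    then have "\<bar>fl_vec_div F x c $ a - x $ a / c\<bar> \<le> u * \<bar>x $ a / c\<bar>"
      using roundedD[OF fl_arithmeticD(4)[OF F, of c "x $ a"]] c x by (simp add: fl_vec_div_def)
    then show "\<bar>fl_vec_div F x c $ a - x $ a / c\<bar> \<le> (u / c) * \<bar>x $ a\<bar>" using c by simp
  qed
  also have "\<dots> = u * (nrm k (\<lambda>a. x $ a) / c)" unfolding nrm_scale nrm_abs using u c by simp
  finally show ?thesis .
qed

lemma first_cols_carrier: "B \<in> carrier_mat n m \<Longrightarrow> i \<le> m \<Longrightarrow> first_cols B i \<in> carrier_mat n i"
  by (auto simp: first_cols_def)

lemma first_cols_nth:
  "B \<in> carrier_mat n m \<Longrightarrow> i \<le> m \<Longrightarrow> a < n \<Longrightarrow> c < i \<Longrightarrow> first_cols B i $$ (a, c) = B $$ (a, c)"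
  by (simp add: first_cols_def mat_of_cols_index)


lemma powr_three_halves: "0 < x \<Longrightarrow> x powr (3/2) = x * sqrt x"
  using powr_add[of x 1 "1/2"] by (simp add: powr_half_sqrt)

theorem proposition3p6:
  fixes \<Theta> W P Q' S' S Q R :: "real mat"
    and n m k :: nat
    and u_crs u_fine \<epsilon> \<epsilon>\<^sub>0 :: real
    and crs fine :: fl_ops
    and solver :: ls_solver
  assumes "1 \<le> m" and "m \<le> k" and "k \<le> n"
    and "\<Theta> \<in> carrier_mat k n"
    and "W \<in> carrier_mat n m"
    and "0 < u_fine" and "u_fine \<le> u_crs" and "u_crs \<le> 0.01 / real m"
    and "fl_arithmetic u_crs crs"
    and "fl_arithmetic u_fine fine"
    and "rgs_run solver crs fine \<Theta> W P Q' S' S Q R"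
    and "u_crs \<le> 10 powi (-3) * inverse (cond W) * real m powi (-2)"
    and "u_fine \<le> inverse (100 * real m powr (1/2) * real n powr (3/2)
                   + 10 ^ 4 * real m powr (3/2) * real k) * u_crs"
    and "rgs_assumptions \<epsilon>\<^sub>0 u_crs u_fine \<Theta> W Q' Q R"
    and "\<epsilon> \<le> 1/4"
    and "eps_embedding_mat \<epsilon> \<Theta> W"
  shows "eps_embedding_mat (2 * \<epsilon> + 180 * u_crs * (real m)\<^sup>2 * cond W) \<Theta> Q"
proof -
  note m = assms(1) and dims = assms(2,3) and \<Theta> = assms(4) and W = assms(5) and fine = assms(10)
  define u where "u = u_crs"
  define v where "v = u_fine"
  have v0: "0 < v" and vu: "v \<le> u" unfolding u_def v_def using assms by auto
  have u0: "0 < u" using v0 vu by simp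
  have k: "1 \<le> k" and n: "1 \<le> n" using m dims by auto
  define M where "M = Max (singular_values W)"
  define \<sigma> where "\<sigma> = Min (singular_values W)"
  note sv = extreme_singular_values[OF W m, folded M_def \<sigma>_def]
  have cond: "cond W = M / \<sigma>" unfolding cond_def M_def \<sigma>_def ..
  have u_cond: "u \<le> 1/1000 * (\<sigma> / M) * inverse ((real m)\<^sup>2)"
    using assms(12) unfolding u_def cond by (simp add: power_int_minus)
  \<comment> \<open>For \<sigma> = 0 division by zero makes \<open>cond W\<close> vanish, and the
    bound on \<open>u_crs\<close> would read u \<le> 0.\<close>
  have \<sigma>: "0 < \<sigma>"
  proof (rule ccontr)
    assume "\<not> 0 < \<sigma>"
    then have "\<sigma> = 0" using sv(3) by simp
    then show False using u_cond u0 by simp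
  qed
  then have M: "0 < M" using sv(4) by simp
  have u_le: "u * (real m)\<^sup>2 * M \<le> \<sigma> / 1000"
    using u_cond M m by (simp add: field_simps)
  have sqrt_m: "1 \<le> sqrt (real m)" using m by simp
  have "v * (100 * (sqrt m * (n * sqrt n)) + 10 ^ 4 * (m * sqrt m * k)) \<le> u"
  proof -
    define D where "D = 100 * (sqrt m * (n * sqrt n)) + 10 ^ 4 * (m * sqrt m * k)"
    have "0 < D" unfolding D_def using m n k by (intro add_pos_pos) auto
    moreover have "v \<le> inverse D * u"
      using assms(13) m n unfolding v_def u_def D_def
      by (simp add: powr_half_sqrt powr_three_halves mult.assoc)
    ultimately show ?thesis unfolding D_def[symmetric] by (simp add: field_simps)
  qed
  then have vD: "100 * (v * (sqrt m * (n * sqrt n))) + 10 ^ 4 * (v * (m * sqrt m * k)) \<le> u"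
    by (simp add: algebra_simps)
  \<comment> \<open>The share of the bound on \<open>u_fine\<close> that pays for sketching.\<close>
  have vn: "v * (n * sqrt n) \<le> u / 100"
  proof -
    have "v * (1 * (n * sqrt n)) \<le> v * (sqrt m * (n * sqrt n))"
      using v0 sqrt_m by (intro mult_left_mono mult_right_mono) auto
    moreover have "0 \<le> v * (m * sqrt m * k)" using v0 by simp
    ultimately show ?thesis using vD by simp
  qed
  \<comment> \<open>The share that pays for the least-squares solver and the norms of
    sketches.\<close>
  have vk: "10 ^ 4 * (v * (m * sqrt m * k)) \<le> u"
  proof -
    have "0 \<le> v * (sqrt m * (n * sqrt n))" using v0 by simp
    then show ?thesis using vD by simp
  qed
  have vk1: "10 ^ 4 * (k * v) \<le> u"
  proof -
    have "1 * real k \<le> m * sqrt m * k" using m sqrt_m mult_mono[of 1 "real m" 1 "sqrt m"] by (intro mult_right_mono) auto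
    then have "v * (1 * real k) \<le> v * (m * sqrt m * k)" using v0 by (intro mult_left_mono) auto
    then show ?thesis using vk by (simp add: mult.commute)
  qed
  have um: "u * real m \<le> 1/100" using assms(8) m unfolding u_def by (simp add: field_simps)
  have "u * 1 \<le> u * real m" using m u0 by (intro mult_left_mono) auto
  then have u_small: "u \<le> 1/100" using um by linarith
  have nv: "real n * v \<le> 1/100"
  proof -
    have "v * (n * 1) \<le> v * (n * sqrt n)" using v0 n by (intro mult_left_mono) auto
    then show ?thesis using vn u_small by (simp add: mult.commute)
  qed
  have v_le: "v \<le> u / 100"
  proof -
    have "v * 1 \<le> v * (n * sqrt n)" using v0 n mult_mono[of 1 "real n" 1 "sqrt n"] by (intro mult_left_mono) auto
    then show ?thesis using vn by simp
  qed
  \<comment> \<open>49/40 is just above sqrt (3/2).\<close>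
  have \<Theta>F: "frobenius_norm \<Theta> \<le> 49/40 * sqrt n" and D: "sqrt (1 + \<epsilon>\<^sub>0) \<le> 49/40"
  proof -
    have "\<epsilon>\<^sub>0 \<le> 1/2" "frobenius_norm \<Theta> \<le> sqrt (1 + \<epsilon>\<^sub>0) * sqrt n"
      using assms(14) W unfolding rgs_assumptions_def Let_def by auto
    then show D: "sqrt (1 + \<epsilon>\<^sub>0) \<le> 49/40" by (intro real_le_lsqrt) (auto simp: power2_eq_square)
    have "sqrt (1 + \<epsilon>\<^sub>0) * sqrt n \<le> 49/40 * sqrt n" by (rule mult_right_mono[OF D]) simp
    then show "frobenius_norm \<Theta> \<le> 49/40 * sqrt n" using \<open>frobenius_norm \<Theta> \<le> _\<close> by linarith
  qed
  define A where "A = (\<lambda>a j. \<Theta> $$ (a, j))"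
  have sketch: "nrm k (\<lambda>a. fl_mat_vec fine \<Theta> x $ a - apply_rows n A (\<lambda>j. x $ j) a) \<le> u / 40 * nrm n (\<lambda>j. x $ j)"
    if x: "dim_vec x = n" for x
  proof -
    have "nrm k (\<lambda>a. fl_mat_vec fine \<Theta> x $ a - apply_rows n A (\<lambda>j. x $ j) a)
      \<le> 2 * real n * v * frobenius_norm \<Theta> * nrm n (\<lambda>j. x $ j)"
      unfolding A_def v_def by (rule fl_mat_vec_error[OF fine \<Theta> x]) (use nv in \<open>simp add: v_def\<close>)
    also have "\<dots> \<le> u / 40 * nrm n (\<lambda>j. x $ j)"
    proof (rule mult_right_mono)
      have "2 * real n * v * frobenius_norm \<Theta> \<le> 2 * real n * v * (49/40 * sqrt n)"
        using \<Theta>F v0 by (intro mult_left_mono) auto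
      also have "\<dots> = 49/20 * (v * (n * sqrt n))" by simp
      also have "\<dots> \<le> 49/20 * (u / 100)" using vn by (intro mult_left_mono) auto
      finally show "2 * real n * v * frobenius_norm \<Theta> \<le> u / 40" using u0 by linarith
    qed simp
    finally show ?thesis .
  qed
  have car: "P \<in> carrier_mat k m" "Q' \<in> carrier_mat n m" "S' \<in> carrier_mat k m"
      "S \<in> carrier_mat k m" "Q \<in> carrier_mat n m" "R \<in> carrier_mat m m"
    and run: "\<And>i. i < m \<Longrightarrow> col P i = fl_mat_vec fine \<Theta> (col W i)"
      "\<And>i. i < m \<Longrightarrow> 0 < i \<Longrightarrow> vec_first (col R i) i = fl_least_squares solver fine (first_cols S i) (col P i)"
      "\<And>i. i < m \<Longrightarrow> i = 0 \<Longrightarrow> col Q' i = col W i"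
      "\<And>i. i < m \<Longrightarrow> col S' i = (if i = 0 then col P i else fl_mat_vec fine \<Theta> (col Q' i))"
      "\<And>i. i < m \<Longrightarrow> R $$ (i, i) = fl_norm fine (col S' i)"
      "\<And>i. i < m \<Longrightarrow> col S i = fl_vec_div fine (col S' i) (R $$ (i,i))"
      "\<And>i. i < m \<Longrightarrow> col Q i = fl_vec_div fine (col Q' i) (R $$ (i,i))"
    using assms(11) \<Theta> W unfolding rgs_run_def Let_def by auto
  have col_nth: "col B i $ a = colf B i a" if "B \<in> carrier_mat k' m" "i < m" "a < k'" for B i a k'
    using that by (simp add: colf_def)
  have nrm_col: "nrm k' (\<lambda>a. col B i $ a) = nrm k' (colf B i)" if "B \<in> carrier_mat k' m" "i < m" for B i k'
    by (rule nrm_cong) (rule col_nth[OF that])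
  have r_nth: "vec_first (col R i) i $ c = colf R i c" if "i < m" "c < i" for i c
    using that car(6) by (simp add: vec_first_def colf_def)
  have lincomb: "lincomb_cols B x = (\<lambda>j. \<Sum>c<m. x c * colf B c j)" if "B \<in> carrier_mat k' m" for B k' x
    using carrier_matD(2)[OF that] by (intro ext) (simp add: lincomb_cols_def colf_def)
  have emb: "\<bar>ip n (lincomb_cols W x) (lincomb_cols W y)
      - ip k (apply_rows n A (lincomb_cols W x)) (apply_rows n A (lincomb_cols W y))\<bar>
    \<le> \<epsilon> * nrm n (lincomb_cols W x) * nrm n (lincomb_cols W y)" for x y
    using assms(16) unfolding eps_embedding_mat_iff[OF W \<Theta>] A_def by blast
  \<comment> \<open>Nonnegativity is not assumed; it follows from the embedding property at the
    first column of W, which is nonzero as \<sigma> > 0.\<close>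
  have \<epsilon>0: "0 \<le> \<epsilon>"
  proof -
    define x where "x c = (if c = 0 then 1 else 0 :: real)" for c :: nat
    have "1 \<le> nrm m x" using abs_le_nrm[of 0 m x] m by (simp add: x_def)
    then have "\<sigma> * 1 \<le> \<sigma> * nrm m x" using \<sigma> by (intro mult_left_mono) auto
    then have N: "0 < nrm n (lincomb_cols W x)" using sv(1)[of x] \<sigma> by linarith
    have "0 \<le> \<epsilon> * (nrm n (lincomb_cols W x) * nrm n (lincomb_cols W x))"
      using order.trans[OF abs_ge_zero emb[of x x]] by (simp add: mult.assoc)
    with mult_pos_pos[OF N N] show ?thesis using mult_neg_pos not_le by blast
  qed
  have core: "perturbed_rgs m n k (colf W) (colf Q) (colf Q') (colf P) (colf S) (colf S') (colf R) (\<lambda>i. R $$ (i, i)) A u \<epsilon> \<sigma> M"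
  proof
    show "1 \<le> m" "0 \<le> u" "0 < \<sigma>" "\<sigma> \<le> M" "u * (real m)\<^sup>2 * M \<le> \<sigma> / 1000" "0 \<le> \<epsilon>" "\<epsilon> \<le> 1/4"
      using m u0 \<sigma> sv(4) u_le \<epsilon>0 assms(15) by auto
    show "nrm n (colf W i) \<le> M" if i: "i < m" for i
    proof -
      define x where "x c = (if c = i then 1 else 0 :: real)" for c
      have "lincomb_cols W x = colf W i"
        unfolding lincomb[OF W] using i by (simp add: x_def if_distrib[of "\<lambda>z. z * _"] cong: if_cong)
      moreover have "nrm m x = 1"
        using i by (simp add: nrm_eq_sqrt_ip ip_def x_def if_distrib[of "\<lambda>z. z * _"] cong: if_cong)
      ultimately show ?thesis using sv(2)[of x] by simp
    qed
    show "\<sigma> * nrm m x \<le> nrm n (\<lambda>j. \<Sum>c<m. x c * colf W c j)" for x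
      using sv(1)[of x] unfolding lincomb[OF W] .
    show "\<bar>ip n (\<lambda>j. \<Sum>c<m. x c * colf W c j) (\<lambda>j. \<Sum>c<m. y c * colf W c j)
      - ip k (apply_rows n A (\<lambda>j. \<Sum>c<m. x c * colf W c j)) (apply_rows n A (\<lambda>j. \<Sum>c<m. y c * colf W c j))\<bar>
      \<le> \<epsilon> * nrm n (\<lambda>j. \<Sum>c<m. x c * colf W c j) * nrm n (\<lambda>j. \<Sum>c<m. y c * colf W c j)" for x y
      using emb[of x y] unfolding lincomb[OF W] .
  next
    fix i assume i: "i < m"
    \<comment> \<open>Serves \<open>P\<close> and \<open>S'\<close> alike: in the first column q' =
      w and s' = p, so s' is the computed sketch of q' there too.\<close>
    have sk: "nrm k (\<lambda>a. colf Y i a - apply_rows n A (colf X i) a) \<le> u / 40 * nrm n (colf X i)"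
      if X: "X \<in> carrier_mat n m" and Y: "Y \<in> carrier_mat k m" and eq: "col Y i = fl_mat_vec fine \<Theta> (col X i)" for X Y
    proof -
      have "apply_rows n A (\<lambda>j. col X i $ j) = apply_rows n A (colf X i)"
        by (rule apply_rows_cong) (rule col_nth[OF X i])
      then have "nrm k (\<lambda>a. colf Y i a - apply_rows n A (colf X i) a)
        = nrm k (\<lambda>a. fl_mat_vec fine \<Theta> (col X i) $ a - apply_rows n A (\<lambda>j. col X i $ j) a)"
        unfolding eq[symmetric] by (intro nrm_cong) (simp only: col_nth[OF Y i])
      also have "\<dots> \<le> u / 40 * nrm n (\<lambda>j. col X i $ j)" by (rule sketch) (use X in simp)
      finally show ?thesis unfolding nrm_col[OF X i] .
    qed
    show "nrm k (\<lambda>a. colf P i a - apply_rows n A (colf W i) a) \<le> u / 40 * nrm n (colf W i)"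
      by (rule sk[OF W car(1) run(1)[OF i]])
    show "nrm k (\<lambda>a. colf S' i a - apply_rows n A (colf Q' i) a) \<le> u / 40 * nrm n (colf Q' i)"
      by (rule sk[OF car(2,3)]) (use run(1,3,4)[OF i] in auto)
    show "nrm i (colf R i) \<le> 6/5 * nrm k (colf P i) \<and>
      nrm i (\<lambda>c. ip k (colf S c) (\<lambda>a. colf P i a - (\<Sum>d<i. colf R i d * colf S d a))) \<le> u * sqrt m * nrm k (colf P i)"
      if near: "\<And>y. 9/10 * (nrm i y)\<^sup>2 \<le> (nrm k (\<lambda>a. \<Sum>c<i. y c * colf S c a))\<^sup>2"
        "\<And>y. (nrm k (\<lambda>a. \<Sum>c<i. y c * colf S c a))\<^sup>2 \<le> 11/10 * (nrm i y)\<^sup>2"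
    proof (cases "i = 0")
      \<comment> \<open>The first column has no least-squares problem, and norms over an empty index
        range vanish.\<close>
      case True
      then have "nrm i f = 0" for f unfolding nrm_eq_0_iff by simp
      then show ?thesis using u0 by simp
    next
      case False
      \<comment> \<open>\<open>m\<close> replaces the number \<open>i\<close> of columns, giving one
        \<delta> for all steps. Then 6 i \<delta> \<le> 6000 m^2 k v, which the solver's share of
        the \<open>u_fine\<close> bound, multiplied by sqrt m, keeps below u sqrt m.\<close>
      define \<delta> where "\<delta> = 1000 * real k * real m * v"
      have mk: "10000 * (real m * (real m * (real k * v))) \<le> u * sqrt m"
      proof -
        have "10 ^ 4 * (v * (m * sqrt m * k)) * sqrt m \<le> u * sqrt m" using vk by (rule mult_right_mono) simp
        also have "10 ^ 4 * (v * (m * sqrt m * k)) * sqrt m = 10 ^ 4 * (v * (m * (sqrt m * sqrt m) * k))" by simp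
        finally show ?thesis by (simp add: mult_ac)
      qed
      have "sqrt m * 1 \<le> sqrt m * sqrt m" using sqrt_m by (intro mult_left_mono) auto
      then have "u * sqrt m \<le> u * m" using u0 by (intro mult_left_mono) auto
      have i\<delta>: "real i * \<delta> \<le> 1000 * (real m * (real m * (real k * v)))"
      proof -
        have "real i * \<delta> \<le> real m * \<delta>" unfolding \<delta>_def using i v0 by (intro mult_right_mono) auto
        then show ?thesis unfolding \<delta>_def by (simp add: mult_ac)
      qed
      define C where "C = first_cols S i"
      have C: "C \<in> carrier_mat k i" unfolding C_def by (rule first_cols_carrier[OF car(4)]) (use i in simp)
      have CS: "colf C c a = colf S c a" if "c < i" "a < k" for c a
        unfolding C_def colf_def using first_cols_nth[OF car(4) _ that(2,1)] i by simp
      have lc: "nrm k (\<lambda>a. \<Sum>c<i. y c * colf C c a) = nrm k (\<lambda>a. \<Sum>c<i. y c * colf S c a)" for y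
        by (rule nrm_cong) (simp add: CS)
      define y where "y = fl_least_squares solver fine C (col P i)"
      have yR: "y $ c = colf R i c" if "c < i" for c
        using r_nth[OF i that] run(2)[OF i] False unfolding y_def C_def by simp
      have res: "nrm i (\<lambda>c. y $ c) \<le> 6/5 * nrm k (\<lambda>a. col P i $ a)"
        "nrm i (\<lambda>c. ip k (colf C c) (\<lambda>a. col P i $ a - (\<Sum>d<i. y $ d * colf C d a))) \<le> 6 * real i * \<delta> * nrm k (\<lambda>a. col P i $ a)"
      proof -
        have kv: "real k * v \<le> 1/10^4" using vk1 u_small by simp
        have d1: "1000 * real k * real i * v \<le> \<delta>" unfolding \<delta>_def using i v0 by (intro mult_right_mono mult_left_mono) auto
        have d2: "real i * \<delta> \<le> 1/1000" using i\<delta> mk \<open>u * sqrt m \<le> u * m\<close> um by linarith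
        have ik: "i \<le> k" "1 \<le> i" and dP: "dim_vec (col P i) = k" using i dims False car(1) by auto
        note * = fl_least_squares_residual[OF C dP ik fine[folded v_def] kv d1 d2 _ _ y_def, unfolded lc, OF near]
        show "nrm i (\<lambda>c. y $ c) \<le> 6/5 * nrm k (\<lambda>a. col P i $ a)" by (rule *(1))
        show "nrm i (\<lambda>c. ip k (colf C c) (\<lambda>a. col P i $ a - (\<Sum>d<i. y $ d * colf C d a))) \<le> 6 * real i * \<delta> * nrm k (\<lambda>a. col P i $ a)"
          by (rule *(2))
      qed
      have "nrm i (colf R i) = nrm i (\<lambda>c. y $ c)" by (rule nrm_cong) (simp add: yR)
      moreover have "nrm i (\<lambda>c. ip k (colf S c) (\<lambda>a. colf P i a - (\<Sum>d<i. colf R i d * colf S d a)))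
        = nrm i (\<lambda>c. ip k (colf C c) (\<lambda>a. col P i $ a - (\<Sum>d<i. y $ d * colf C d a)))"
        by (intro nrm_cong ip_cong) (auto simp: CS yR simp del: index_col intro!: col_nth[OF car(1) i, symmetric])
      moreover have "6 * real i * \<delta> * nrm k (colf P i) \<le> u * sqrt m * nrm k (colf P i)"
      proof (rule mult_right_mono)
        have "0 \<le> real m * (real m * (real k * v))" using v0 by simp
        then show "6 * real i * \<delta> \<le> u * sqrt m" using i\<delta> mk by simp
      qed simp
      ultimately show ?thesis using res unfolding nrm_col[OF car(1) i] by linarith
    qed
    have dS': "dim_vec (col S' i) = k" using car by auto
    have kv: "real k * v \<le> 1/100" using vk1 u_small by simp
    have "rounded (4 * real k * v) (nrm k (colf S' i)) (R $$ (i, i))"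
      using fl_norm_rounded[OF fine[folded v_def] dS' kv k] unfolding run(5)[OF i] nrm_col[OF car(3) i] .
    then have "\<bar>R $$ (i, i) - nrm k (colf S' i)\<bar> \<le> 4 * real k * v * \<bar>nrm k (colf S' i)\<bar>" by (rule roundedD)
    also have "\<dots> \<le> u / 100 * nrm k (colf S' i)"
      unfolding abs_of_nonneg[OF nrm_nonneg] using vk1 u0 by (intro mult_right_mono) auto
    finally show "\<bar>R $$ (i, i) - nrm k (colf S' i)\<bar> \<le> u / 100 * nrm k (colf S' i)" .
    have vec_div: "nrm l (\<lambda>a. colf Y i a - colf X i a / \<rho>) \<le> u / 100 * (nrm l (colf X i) / \<rho>)"
      if X: "X \<in> carrier_mat l m" and Y: "Y \<in> carrier_mat l m" and eq: "col Y i = fl_vec_div fine (col X i) \<rho>"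
        and \<rho>: "0 < \<rho>" for X Y l \<rho>
    proof -
      have "nrm l (\<lambda>a. colf Y i a - colf X i a / \<rho>) = nrm l (\<lambda>a. fl_vec_div fine (col X i) \<rho> $ a - col X i $ a / \<rho>)"
        unfolding eq[symmetric] by (rule nrm_cong) (simp only: col_nth[OF X i] col_nth[OF Y i])
      also have "\<dots> \<le> v * (nrm l (\<lambda>a. col X i $ a) / \<rho>)"
        by (rule fl_vec_div_error[OF fine[folded v_def] _ \<rho>]) (use X in simp)
      also have "\<dots> \<le> u / 100 * (nrm l (colf X i) / \<rho>)"
        unfolding nrm_col[OF X i] using v_le \<rho> by (intro mult_right_mono) auto
      finally show ?thesis .
    qed
    show "nrm k (\<lambda>a. colf S i a - colf S' i a / R $$ (i, i)) \<le> u / 100 * (nrm k (colf S' i) / R $$ (i, i))" if "0 < R $$ (i, i)"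
      by (rule vec_div[OF car(3,4) run(6)[OF i] that])
    show "nrm n (\<lambda>a. colf Q i a - colf Q' i a / R $$ (i, i)) \<le> u / 100 * (nrm n (colf Q' i) / R $$ (i, i))" if "0 < R $$ (i, i)"
      by (rule vec_div[OF car(2,5) run(7)[OF i] that])
    define r where "r = vec_first (col R i) i"
    have dr: "dim_vec r = i" unfolding r_def vec_first_def by simp
    define \<Delta>' where "\<Delta>' = col Q' i - (col W i - first_cols Q i *\<^sub>v r)"
    define bound where "bound = map_vec abs (col W i) + real (i + 1) \<cdot>\<^sub>v (map_mat abs (first_cols Q i) *\<^sub>v map_vec abs r)"
    define qe where "qe = (1 / R $$ (i,i)) \<cdot>\<^sub>v col Q' i"
    define \<Delta> where "\<Delta> = col Q i - qe"
    have "i < dim_col W" using i W by simp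
    note step = assms(14)[unfolded rgs_assumptions_def Let_def, THEN conjunct2, THEN conjunct2, THEN spec, THEN mp, OF this]
    have "map_vec abs \<Delta>' \<le> (1.02 * u) \<cdot>\<^sub>v bound \<and> map_vec abs \<Delta> \<le> v \<cdot>\<^sub>v map_vec abs qe \<and>
      l2_norm (\<Theta> *\<^sub>v \<Delta>') \<le> 1.02 * u * sqrt (1 + \<epsilon>\<^sub>0) * l2_norm bound \<and>
      l2_norm (\<Theta> *\<^sub>v \<Delta>) \<le> v * sqrt (1 + \<epsilon>\<^sub>0) * l2_norm qe"
      unfolding \<Delta>_def \<Delta>'_def bound_def qe_def r_def u_def v_def by (rule step)
    then have A1: "map_vec abs \<Delta>' \<le> (1.02 * u) \<cdot>\<^sub>v bound"
      and A3: "l2_norm (\<Theta> *\<^sub>v \<Delta>') \<le> 1.02 * u * sqrt (1 + \<epsilon>\<^sub>0) * l2_norm bound"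
      and A4: "l2_norm (\<Theta> *\<^sub>v \<Delta>) \<le> v * sqrt (1 + \<epsilon>\<^sub>0) * l2_norm qe" by blast+
    have Qi: "first_cols Q i \<in> carrier_mat n i" by (rule first_cols_carrier[OF car(5)]) (use i in simp)
    have Qi_nth: "first_cols Q i $$ (j, c) = colf Q c j" if "j < n" "c < i" for j c
      unfolding colf_def using first_cols_nth[OF car(5) _ that] i by simp
    have db: "dim_vec bound = n" "dim_vec \<Delta>' = n" "dim_vec qe = n" "dim_vec \<Delta> = n"
      unfolding bound_def \<Delta>'_def qe_def \<Delta>_def using W Qi car by auto
    have \<Delta>'_nth: "\<Delta>' $ j = colf Q' i j - (colf W i j - (\<Sum>c<i. colf R i c * colf Q c j))" if j: "j < n" for j
    proof -
      have "(first_cols Q i *\<^sub>v r) $ j = apply_rows i (\<lambda>a c. first_cols Q i $$ (a, c)) (\<lambda>c. r $ c) j"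
        by (rule mult_mat_vec_nth[OF Qi dr j])
      also have "\<dots> = (\<Sum>c<i. colf R i c * colf Q c j)"
        unfolding apply_rows_def r_def using j i by (intro sum.cong) (simp_all add: r_nth Qi_nth)
      finally show ?thesis
        unfolding \<Delta>'_def using j W Qi car i by (simp add: colf_def del: index_mult_mat_vec)
    qed
    have bound_nth: "bound $ j = \<bar>colf W i j\<bar> + real (i + 1) * (\<Sum>c<i. \<bar>colf R i c\<bar> * \<bar>colf Q c j\<bar>)" if j: "j < n" for j
    proof -
      have "(map_mat abs (first_cols Q i) *\<^sub>v map_vec abs r) $ j
        = apply_rows i (\<lambda>a c. map_mat abs (first_cols Q i) $$ (a, c)) (\<lambda>c. map_vec abs r $ c) j"
        by (rule mult_mat_vec_nth) (use Qi dr j in auto)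
      also have "\<dots> = (\<Sum>c<i. \<bar>colf R i c\<bar> * \<bar>colf Q c j\<bar>)"
        unfolding apply_rows_def using j i Qi dr r_nth[OF i] by (intro sum.cong) (auto simp: Qi_nth r_def)
      finally show ?thesis
        unfolding bound_def using j W Qi i by (simp add: colf_def del: index_mult_mat_vec)
    qed
    \<comment> \<open>The 1-based column number i + 1 of the assumptions is at most m, which takes
      its place.\<close>
    define \<beta> where "\<beta> = nrm n (colf W i) + real m * (\<Sum>c<i. \<bar>colf R i c\<bar> * nrm n (colf Q c))"
    have l2_bound: "l2_norm bound \<le> \<beta>"
    proof -
      have "l2_norm bound = nrm n (\<lambda>j. bound $ j)" by (rule l2_norm_eq_nrm[OF db(1)])
      also have "\<dots> = nrm n (\<lambda>j. \<bar>colf W i j\<bar> + real (i + 1) * (\<Sum>c<i. \<bar>colf R i c\<bar> * \<bar>colf Q c j\<bar>))"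
        by (rule nrm_cong) (rule bound_nth)
      also have "\<dots> \<le> nrm n (colf W i) + real (i + 1) * nrm n (\<lambda>j. \<Sum>c<i. \<bar>colf R i c\<bar> * \<bar>colf Q c j\<bar>)"
        by (rule order.trans[OF nrm_add_le]) (simp only: nrm_scale nrm_abs abs_of_nat order.refl)
      also have "\<dots> \<le> \<beta>"
        unfolding \<beta>_def
      proof (intro add_left_mono mult_mono)
        show "nrm n (\<lambda>j. \<Sum>c<i. \<bar>colf R i c\<bar> * \<bar>colf Q c j\<bar>) \<le> (\<Sum>c<i. \<bar>colf R i c\<bar> * nrm n (colf Q c))"
          using nrm_sum_le[of n "\<lambda>c j. \<bar>colf R i c\<bar> * \<bar>colf Q c j\<bar>" "{..<i}"] by (simp add: nrm_scale nrm_abs)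
      qed (use i in auto)
      finally show ?thesis .
    qed
    have l2_0: "0 \<le> l2_norm bound" unfolding l2_norm_eq_nrm[OF db(1)] by simp
    have "nrm n (\<lambda>j. colf Q' i j - (colf W i j - (\<Sum>c<i. colf R i c * colf Q c j))) = nrm n (\<lambda>j. \<Delta>' $ j)"
      by (rule nrm_cong) (simp add: \<Delta>'_nth)
    also have "\<dots> \<le> nrm n (\<lambda>j. 1.02 * u * bound $ j)"
    proof (rule nrm_mono)
      fix j assume "j < n"
      then show "\<bar>\<Delta>' $ j\<bar> \<le> 1.02 * u * bound $ j" using A1 db unfolding less_eq_vec_def by auto
    qed
    also have "\<dots> = 1.02 * u * l2_norm bound" unfolding nrm_scale l2_norm_eq_nrm[OF db(1)] using u0 by simp
    also have "\<dots> \<le> 5/4 * u * \<beta>" using l2_bound l2_0 u0 by (intro mult_mono) auto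
    finally show "nrm n (\<lambda>j. colf Q' i j - (colf W i j - (\<Sum>c<i. colf R i c * colf Q c j)))
        \<le> 5/4 * u * (nrm n (colf W i) + real m * (\<Sum>c<i. \<bar>colf R i c\<bar> * nrm n (colf Q c)))" unfolding \<beta>_def .
    have "apply_rows n A (\<lambda>j. colf Q' i j - (colf W i j - (\<Sum>c<i. colf R i c * colf Q c j))) = apply_rows n A (\<lambda>j. \<Delta>' $ j)"
      by (rule apply_rows_cong) (simp add: \<Delta>'_nth)
    then have "nrm k (apply_rows n A (\<lambda>j. colf Q' i j - (colf W i j - (\<Sum>c<i. colf R i c * colf Q c j)))) = l2_norm (\<Theta> *\<^sub>v \<Delta>')"
      unfolding A_def l2_norm_mult_mat_vec[OF \<Theta> db(2)] by simp
    also have "\<dots> \<le> (1.02 * u * sqrt (1 + \<epsilon>\<^sub>0)) * l2_norm bound" using A3 .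
    also have "\<dots> \<le> 5/4 * u * \<beta>"
    proof (rule mult_mono)
      \<comment> \<open>1.02 * 49/40 = 1.2495 is the origin of the factor 5/4 in the abstract
        recurrence.\<close>
      have "1.02 * u * sqrt (1 + \<epsilon>\<^sub>0) \<le> 1.02 * u * (49/40)" using D u0 by (intro mult_left_mono) auto
      then show "1.02 * u * sqrt (1 + \<epsilon>\<^sub>0) \<le> 5/4 * u" using u0 by simp
    qed (use l2_bound l2_0 u0 in auto)
    finally show "nrm k (apply_rows n A (\<lambda>j. colf Q' i j - (colf W i j - (\<Sum>c<i. colf R i c * colf Q c j))))
        \<le> 5/4 * u * (nrm n (colf W i) + real m * (\<Sum>c<i. \<bar>colf R i c\<bar> * nrm n (colf Q c)))" unfolding \<beta>_def .
    show "nrm k (apply_rows n A (\<lambda>j. colf Q i j - colf Q' i j / R $$ (i, i))) \<le> u / 50 * (nrm n (colf Q' i) / R $$ (i, i))"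
      if \<rho>: "0 < R $$ (i, i)"
    proof -
      have qe: "l2_norm qe = nrm n (colf Q' i) / R $$ (i, i)"
      proof -
        have "l2_norm qe = nrm n (\<lambda>j. 1 / R $$ (i, i) * colf Q' i j)"
          unfolding l2_norm_eq_nrm[OF db(3)] by (rule nrm_cong) (use car i in \<open>simp add: qe_def colf_def\<close>)
        then show ?thesis unfolding nrm_scale using \<rho> by simp
      qed
      have "apply_rows n A (\<lambda>j. colf Q i j - colf Q' i j / R $$ (i, i)) = apply_rows n A (\<lambda>j. \<Delta> $ j)"
        by (rule apply_rows_cong) (use car i in \<open>simp add: \<Delta>_def qe_def colf_def\<close>)
      then have "nrm k (apply_rows n A (\<lambda>j. colf Q i j - colf Q' i j / R $$ (i, i))) = l2_norm (\<Theta> *\<^sub>v \<Delta>)"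
        unfolding A_def l2_norm_mult_mat_vec[OF \<Theta> db(4)] by simp
      also have "\<dots> \<le> (v * sqrt (1 + \<epsilon>\<^sub>0)) * l2_norm qe" using A4 .
      also have "\<dots> \<le> u / 50 * l2_norm qe"
      proof (rule mult_right_mono)
        have "v * sqrt (1 + \<epsilon>\<^sub>0) \<le> v * (49/40)" using D v0 by (intro mult_left_mono) auto
        then show "v * sqrt (1 + \<epsilon>\<^sub>0) \<le> u / 50" using v_le u0 by linarith
      qed (use \<rho> in \<open>simp add: qe\<close>)
      finally show ?thesis unfolding qe .
    qed
  qed
  have \<kappa>: "u * (real m)\<^sup>2 * cond W \<le> 1/1000" "0 \<le> u * (real m)\<^sup>2 * cond W"
    using u_le \<sigma> M u0 unfolding cond by (simp_all add: pos_divide_le_eq)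
  have "\<epsilon> + 36 * u * (real m)\<^sup>2 * M / \<sigma> \<le> 2 * \<epsilon> + 180 * u * (real m)\<^sup>2 * cond W"
  proof -
    define X where "X = u * (real m)\<^sup>2 * cond W"
    have "36 * u * (real m)\<^sup>2 * M / \<sigma> = 36 * X" "180 * u * (real m)\<^sup>2 * cond W = 180 * X" "0 \<le> X"
      using \<kappa>(2) unfolding X_def cond by simp_all
    then show ?thesis using \<epsilon>0 by linarith
  qed
  then have le: "(\<epsilon> + 36 * u * (real m)\<^sup>2 * M / \<sigma>) * a * b \<le> (2 * \<epsilon> + 180 * u * (real m)\<^sup>2 * cond W) * a * b"
    if "0 \<le> a" "0 \<le> b" for a b
    using that by (intro mult_right_mono) auto
  \<comment> \<open>An embedding constant must be below 1; here it is at most 2/4 + 180/1000 =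
    0.68.\<close>
  have "2 * \<epsilon> + 180 * u * (real m)\<^sup>2 * cond W < 1" using \<kappa>(1) assms(15) by simp
  then show ?thesis
    unfolding eps_embedding_mat_iff[OF car(5) \<Theta>] lincomb[OF car(5)] u_def[symmetric] A_def[symmetric]
    using order.trans[OF perturbed_rgs.embedding_Q[OF core] le[OF nrm_nonneg nrm_nonneg]] by blast
qed

end
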